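(* Let $k$ be a field. There exists an $\mathbb{N}$-graded Lie algebra $L_0$ over $k$ that has infinitely many ends, i.e. $\dim_k H^1(L_0, U(L_0)) = \infty$, but $L_0$ is not a free product of non-zero $\mathbb{N}$-graded Lie subalgebras, i.e. there are no non-zero $\mathbb{N}$-graded Lie subalgebras $C, D$ of $L_0$ with $L_0=C*D$.
   Context: $\mathbb{N}=\{1,2,\ldots\}$. An $\mathbb{N}$-graded Lie algebra is a Lie algebra $L=\bigoplus_{i\in\mathbb{N}}L_i$ with $[L_i,L_j]\subseteq L_{i+j}$; a subalgebra $S$ is $\mathbb{N}$-graded if $S=\bigoplus_i S\cap L_i$. $U(L)$ is the universal enveloping algebra and $H^1(L,U(L))=\operatorname{Ext}^1_{U(L)}(k,U(L))$. $C*D$ is the free product (coproduct) of Lie algebras over $k$; $L_0=C*D$ means that the homomorphism $C*D\to L_0$ induced by the inclusions is an isomorphism. *)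

theory Defs
  imports "HOL-Algebra.AbelCoset" "Jordan_Normal_Form.VS_Connect"
begin

text \<open>The base field is a type \<open>'k\<close> of class \<open>field\<close>, seen as the structure \<^term>\<open>class_ring\<close>
  when it acts on vector spaces. The record type \<open>('k, 'v) module\<close> carries a multiplication besides
  the vector space structure, so it serves for all \<open>'k\<close>-algebras, associative or not; for a Lie
  algebra the multiplication is the bracket and the field \<open>one\<close> has no meaning.\<close>


section \<open>Graded Lie algebras\<close>

locale lie_algebra = vectorspace "class_ring :: 'k::field ring" L
  for L :: "('k::field, 'v) module" (structure) +
  assumes bracket_closed: "\<lbrakk>x \<in> carrier L; y \<in> carrier L\<rbrakk> \<Longrightarrow> x \<otimes> y \<in> carrier L"
    and bracket_add_left: "\<lbrakk>x \<in> carrier L; y \<in> carrier L; z \<in> carrier L\<rbrakk>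
      \<Longrightarrow> (x \<oplus> y) \<otimes> z = x \<otimes> z \<oplus> y \<otimes> z"
    and bracket_add_right: "\<lbrakk>x \<in> carrier L; y \<in> carrier L; z \<in> carrier L\<rbrakk>
      \<Longrightarrow> x \<otimes> (y \<oplus> z) = x \<otimes> y \<oplus> x \<otimes> z"
    and bracket_smult_left: "\<lbrakk>x \<in> carrier L; y \<in> carrier L\<rbrakk> \<Longrightarrow> (c \<odot> x) \<otimes> y = c \<odot> (x \<otimes> y)"
    and bracket_smult_right: "\<lbrakk>x \<in> carrier L; y \<in> carrier L\<rbrakk> \<Longrightarrow> x \<otimes> (c \<odot> y) = c \<odot> (x \<otimes> y)"
    and bracket_self: "x \<in> carrier L \<Longrightarrow> x \<otimes> x = \<zero>"
    and jacobi: "\<lbrakk>x \<in> carrier L; y \<in> carrier L; z \<in> carrier L\<rbrakk>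
      \<Longrightarrow> x \<otimes> (y \<otimes> z) \<oplus> (y \<otimes> (z \<otimes> x) \<oplus> z \<otimes> (x \<otimes> y)) = \<zero>"

definition lie_subalgebra :: "('k::field, 'v) module \<Rightarrow> 'v set \<Rightarrow> bool" where
  "lie_subalgebra L S \<longleftrightarrow>
     subspace class_ring S L \<and> (\<forall>x\<in>S. \<forall>y\<in>S. x \<otimes>\<^bsub>L\<^esub> y \<in> S)"

text \<open>\<open>S\<close> is the internal direct sum of the subspaces \<open>V\<^sub>i\<close>, \<open>i \<ge> 1\<close>. The value \<open>V 0\<close> is
  irrelevant.\<close>

definition is_direct_sum :: "('k::field, 'v) module \<Rightarrow> (nat \<Rightarrow> 'v set) \<Rightarrow> 'v set \<Rightarrow> bool" where
  "is_direct_sum L V S \<longleftrightarrow>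
     (\<forall>i\<ge>1. subspace class_ring (V i) L \<and> V i \<subseteq> S) \<and>
     (\<forall>x\<in>S. \<exists>!f. f 0 = \<zero>\<^bsub>L\<^esub> \<and> (\<forall>i\<ge>1. f i \<in> V i) \<and> finite {i. f i \<noteq> \<zero>\<^bsub>L\<^esub>} \<and>
        x = (\<Oplus>\<^bsub>L\<^esub>i\<in>{i. f i \<noteq> \<zero>\<^bsub>L\<^esub>}. f i))"

definition graded_lie_algebra :: "('k::field, 'v) module \<Rightarrow> (nat \<Rightarrow> 'v set) \<Rightarrow> bool" where
  "graded_lie_algebra L V \<longleftrightarrow>
     lie_algebra L \<and> is_direct_sum L V (carrier L) \<and>
     (\<forall>i\<ge>1. \<forall>j\<ge>1. \<forall>x\<in>V i. \<forall>y\<in>V j. x \<otimes>\<^bsub>L\<^esub> y \<in> V (i + j))"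

definition graded_lie_subalgebra ::
    "('k::field, 'v) module \<Rightarrow> (nat \<Rightarrow> 'v set) \<Rightarrow> 'v set \<Rightarrow> bool" where
  "graded_lie_subalgebra L V S \<longleftrightarrow>
     lie_subalgebra L S \<and> is_direct_sum L (\<lambda>i. S \<inter> V i) S"

definition lie_iso :: "('k::field, 'v) module \<Rightarrow> ('k, 'w) module \<Rightarrow> ('v \<Rightarrow> 'w) set" where
  "lie_iso L M = {f \<in> LinearCombinations.module_hom class_ring L M.
     (\<forall>x\<in>carrier L. \<forall>y\<in>carrier L. f (x \<otimes>\<^bsub>L\<^esub> y) = f x \<otimes>\<^bsub>M\<^esub> f y) \<and>
     bij_betw f (carrier L) (carrier M)}"


section \<open>Algebras given by generators and relations\<close>

datatype ('k, gens: 'g) alg_term =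
    Gen 'g
  | Zero
  | Plus "('k, 'g) alg_term" "('k, 'g) alg_term"
  | Scale 'k "('k, 'g) alg_term"
  | Times "('k, 'g) alg_term" "('k, 'g) alg_term"

definition terms :: "'g set \<Rightarrow> ('k, 'g) alg_term set" where
  "terms X = {t. gens t \<subseteq> X}"

text \<open>The least congruence on the terms over \<open>X\<close> that contains \<open>E\<close> and makes the quotient a vector
  space with a bilinear multiplication. Associativity, the Jacobi identity etc. are not built in;
  they are to be put into \<open>E\<close>.\<close>

inductive_set alg_cong ::
    "'g set \<Rightarrow> (('k::field, 'g) alg_term \<times> ('k, 'g) alg_term) set
      \<Rightarrow> (('k, 'g) alg_term \<times> ('k, 'g) alg_term) set"
  for X :: "'g set" and E :: "(('k::field, 'g) alg_term \<times> ('k, 'g) alg_term) set"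
where
  rel: "\<lbrakk>(s, t) \<in> E; s \<in> terms X; t \<in> terms X\<rbrakk> \<Longrightarrow> (s, t) \<in> alg_cong X E"
| refl: "t \<in> terms X \<Longrightarrow> (t, t) \<in> alg_cong X E"
| sym: "(s, t) \<in> alg_cong X E \<Longrightarrow> (t, s) \<in> alg_cong X E"
| trans: "\<lbrakk>(s, t) \<in> alg_cong X E; (t, u) \<in> alg_cong X E\<rbrakk> \<Longrightarrow> (s, u) \<in> alg_cong X E"
| Plus_cong: "\<lbrakk>(s, s') \<in> alg_cong X E; (t, t') \<in> alg_cong X E\<rbrakk>
    \<Longrightarrow> (Plus s t, Plus s' t') \<in> alg_cong X E"
| Scale_cong: "(t, t') \<in> alg_cong X E \<Longrightarrow> (Scale c t, Scale c t') \<in> alg_cong X E"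
| Times_cong: "\<lbrakk>(s, s') \<in> alg_cong X E; (t, t') \<in> alg_cong X E\<rbrakk>
    \<Longrightarrow> (Times s t, Times s' t') \<in> alg_cong X E"
| Plus_assoc: "\<lbrakk>s \<in> terms X; t \<in> terms X; u \<in> terms X\<rbrakk>
    \<Longrightarrow> (Plus (Plus s t) u, Plus s (Plus t u)) \<in> alg_cong X E"
| Plus_comm: "\<lbrakk>s \<in> terms X; t \<in> terms X\<rbrakk> \<Longrightarrow> (Plus s t, Plus t s) \<in> alg_cong X E"
| Plus_Zero: "t \<in> terms X \<Longrightarrow> (Plus t Zero, t) \<in> alg_cong X E"
| Plus_inverse: "t \<in> terms X \<Longrightarrow> (Plus t (Scale (- 1) t), Zero) \<in> alg_cong X E"
| Scale_Plus: "\<lbrakk>s \<in> terms X; t \<in> terms X\<rbrakk>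
    \<Longrightarrow> (Scale c (Plus s t), Plus (Scale c s) (Scale c t)) \<in> alg_cong X E"
| Scale_add: "t \<in> terms X \<Longrightarrow> (Scale (c + d) t, Plus (Scale c t) (Scale d t)) \<in> alg_cong X E"
| Scale_Scale: "t \<in> terms X \<Longrightarrow> (Scale (c * d) t, Scale c (Scale d t)) \<in> alg_cong X E"
| Scale_one: "t \<in> terms X \<Longrightarrow> (Scale 1 t, t) \<in> alg_cong X E"
| Times_Plus_left: "\<lbrakk>s \<in> terms X; t \<in> terms X; u \<in> terms X\<rbrakk>
    \<Longrightarrow> (Times (Plus s t) u, Plus (Times s u) (Times t u)) \<in> alg_cong X E"
| Times_Plus_right: "\<lbrakk>s \<in> terms X; t \<in> terms X; u \<in> terms X\<rbrakk>
    \<Longrightarrow> (Times s (Plus t u), Plus (Times s t) (Times s u)) \<in> alg_cong X E"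
| Times_Scale_left: "\<lbrakk>s \<in> terms X; t \<in> terms X\<rbrakk>
    \<Longrightarrow> (Times (Scale c s) t, Scale c (Times s t)) \<in> alg_cong X E"
| Times_Scale_right: "\<lbrakk>s \<in> terms X; t \<in> terms X\<rbrakk>
    \<Longrightarrow> (Times s (Scale c t), Scale c (Times s t)) \<in> alg_cong X E"

definition presented_algebra ::
    "'g set \<Rightarrow> (('k::field, 'g) alg_term \<times> ('k, 'g) alg_term) set
      \<Rightarrow> ('k, ('k, 'g) alg_term set) module" where
  "presented_algebra X E = \<lparr>
     carrier = terms X // alg_cong X E,
     mult = (\<lambda>S T. \<Union>s\<in>S. \<Union>t\<in>T. alg_cong X E `` {Times s t}),
     one = undefined,
     zero = alg_cong X E `` {Zero},
     add = (\<lambda>S T. \<Union>s\<in>S. \<Union>t\<in>T. alg_cong X E `` {Plus s t}),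
     smult = (\<lambda>c T. \<Union>t\<in>T. alg_cong X E `` {Scale c t})\<rparr>"

primrec term_eval :: "('k, 'a) module \<Rightarrow> ('g \<Rightarrow> 'a) \<Rightarrow> ('k, 'g) alg_term \<Rightarrow> 'a" where
  "term_eval A f (Gen x) = f x"
| "term_eval A f Zero = \<zero>\<^bsub>A\<^esub>"
| "term_eval A f (Plus s t) = term_eval A f s \<oplus>\<^bsub>A\<^esub> term_eval A f t"
| "term_eval A f (Scale c t) = c \<odot>\<^bsub>A\<^esub> term_eval A f t"
| "term_eval A f (Times s t) = term_eval A f s \<otimes>\<^bsub>A\<^esub> term_eval A f t"

text \<open>The homomorphism from a presented algebra to \<open>A\<close> that \<open>f\<close> induces. It is meaningful if \<open>f\<close>
  respects the relations; then \<^term>\<open>term_eval A f\<close> is constant on each congruence class.\<close>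

definition induced_hom ::
    "('k, 'a) module \<Rightarrow> ('g \<Rightarrow> 'a) \<Rightarrow> ('k, 'g) alg_term set \<Rightarrow> 'a" where
  "induced_hom A f T = the_elem (term_eval A f ` T)"

text \<open>The relations saying that \<open>i\<close>, as a map from \<open>V\<close> to the presented algebra, is linear,
  respectively multiplicative.\<close>

definition linear_rels ::
    "('k, 'v) module \<Rightarrow> ('v \<Rightarrow> 'g) \<Rightarrow> (('k, 'g) alg_term \<times> ('k, 'g) alg_term) set" where
  "linear_rels V i =
     {(Gen (i (x \<oplus>\<^bsub>V\<^esub> y)), Plus (Gen (i x)) (Gen (i y))) | x y. x \<in> carrier V \<and> y \<in> carrier V} \<union>
     {(Gen (i (c \<odot>\<^bsub>V\<^esub> x)), Scale c (Gen (i x))) | c x. x \<in> carrier V}"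

definition mult_rels ::
    "('k, 'v) module \<Rightarrow> ('v \<Rightarrow> 'g) \<Rightarrow> (('k, 'g) alg_term \<times> ('k, 'g) alg_term) set" where
  "mult_rels V i =
     {(Gen (i (x \<otimes>\<^bsub>V\<^esub> y)), Times (Gen (i x)) (Gen (i y))) | x y. x \<in> carrier V \<and> y \<in> carrier V}"


section \<open>The free product of Lie algebras\<close>

definition lie_rels :: "(('k, 'g) alg_term \<times> ('k, 'g) alg_term) set" where
  "lie_rels =
     {(Times t t, Zero) | t. True} \<union>
     {(Plus (Times s (Times t u)) (Plus (Times t (Times u s)) (Times u (Times s t))), Zero)
        | s t u. True}"

definition lie_free_product ::
    "('k::field, 'v) module \<Rightarrow> ('k, 'w) module \<Rightarrow> ('k, ('k, 'v + 'w) alg_term set) module" where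
  "lie_free_product C D = presented_algebra (Inl ` carrier C \<union> Inr ` carrier D)
     (lie_rels \<union> linear_rels C Inl \<union> mult_rels C Inl \<union> linear_rels D Inr \<union> mult_rels D Inr)"

text \<open>\<open>L = C * D\<close> for subalgebras \<open>C\<close>, \<open>D\<close> of \<open>L\<close>.\<close>

definition is_lie_free_product :: "('k::field, 'v) module \<Rightarrow> 'v set \<Rightarrow> 'v set \<Rightarrow> bool" where
  "is_lie_free_product L C D \<longleftrightarrow>
     induced_hom L (case_sum (\<lambda>x. x) (\<lambda>x. x))
       \<in> lie_iso (lie_free_product (L\<lparr>carrier := C\<rparr>) (L\<lparr>carrier := D\<rparr>)) L"


section \<open>The universal enveloping algebra\<close>

text \<open>The unit of the enveloping algebra is the additional generator \<open>None\<close>.\<close>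

definition uea_rels ::
    "('k::field, 'v) module \<Rightarrow> (('k, 'v option) alg_term \<times> ('k, 'v option) alg_term) set" where
  "uea_rels L =
     {(Times (Times s t) u, Times s (Times t u)) | s t u. True} \<union>
     {(Times (Gen None) t, t) | t. True} \<union>
     {(Times t (Gen None), t) | t. True} \<union>
     linear_rels L Some \<union>
     {(Gen (Some (x \<otimes>\<^bsub>L\<^esub> y)),
       Plus (Times (Gen (Some x)) (Gen (Some y)))
            (Scale (- 1) (Times (Gen (Some y)) (Gen (Some x)))))
        | x y. x \<in> carrier L \<and> y \<in> carrier L}"

definition uea_gens :: "('k, 'v) module \<Rightarrow> 'v option set" where
  "uea_gens L = insert None (Some ` carrier L)"

definition uea :: "('k::field, 'v) module \<Rightarrow> ('k, ('k, 'v option) alg_term set) module" where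
  "uea L = (presented_algebra (uea_gens L) (uea_rels L))
     \<lparr>one := alg_cong (uea_gens L) (uea_rels L) `` {Gen None}\<rparr>"

definition base_algebra :: "('k::field, 'k) module" where
  "base_algebra = \<lparr>carrier = UNIV, mult = (*), one = 1, zero = 0, add = (+), smult = (*)\<rparr>"

definition augmentation :: "('k::field, 'v option) alg_term set \<Rightarrow> 'k" where
  "augmentation = induced_hom base_algebra (case_option 1 (\<lambda>x. 0))"


section \<open>Ext of left modules\<close>

text \<open>In this section \<open>R\<close> is an associative unital \<open>'k\<close>-algebra, and \<open>M\<close>, \<open>N\<close> are left
  \<open>R\<close>-modules. (The library locale \<open>module\<close> is restricted to commutative rings, but its record type
  and \<^const>\<open>LinearCombinations.module_hom\<close> are not.)\<close>

definition free_module :: "('k, 'r) module \<Rightarrow> 'x set \<Rightarrow> ('r, 'x \<Rightarrow> 'r) module" where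
  "free_module R X = \<lparr>
     carrier = {f. f \<in> X \<rightarrow> carrier R \<and> (\<forall>x. x \<notin> X \<longrightarrow> f x = \<zero>\<^bsub>R\<^esub>) \<and> finite {x. f x \<noteq> \<zero>\<^bsub>R\<^esub>}},
     mult = undefined,
     one = undefined,
     zero = (\<lambda>x. \<zero>\<^bsub>R\<^esub>),
     add = (\<lambda>f g x. f x \<oplus>\<^bsub>R\<^esub> g x),
     smult = (\<lambda>r f x. r \<otimes>\<^bsub>R\<^esub> f x)\<rparr>"

text \<open>The \<open>R\<close>-linear map into \<open>M\<close>, on the free module over a subset of \<open>M\<close>, that sends each basis
  vector to the corresponding element of \<open>M\<close>.\<close>

definition free_eval :: "('k, 'r) module \<Rightarrow> ('r, 'm) module \<Rightarrow> ('m \<Rightarrow> 'r) \<Rightarrow> 'm" where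
  "free_eval R M f = (\<Oplus>\<^bsub>M\<^esub>x\<in>{x. f x \<noteq> \<zero>\<^bsub>R\<^esub>}. f x \<odot>\<^bsub>M\<^esub> x)"

text \<open>The beginning \<open>F\<^sub>2 \<rightarrow> F\<^sub>1 \<rightarrow> F\<^sub>0 \<rightarrow> M\<close> of the canonical free resolution: \<open>F\<^sub>0\<close> is free on \<open>M\<close>, and
  each further \<open>F\<^sub>n\<close> is free on the kernel of the previous map. All maps are \<^const>\<open>free_eval\<close>.\<close>

definition res0 :: "('k, 'r) module \<Rightarrow> ('r, 'm) module \<Rightarrow> ('r, 'm \<Rightarrow> 'r) module" where
  "res0 R M = free_module R (carrier M)"

definition res1 :: "('k, 'r) module \<Rightarrow> ('r, 'm) module \<Rightarrow> ('r, ('m \<Rightarrow> 'r) \<Rightarrow> 'r) module" where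
  "res1 R M = free_module R {f \<in> carrier (res0 R M). free_eval R M f = \<zero>\<^bsub>M\<^esub>}"

definition res2 ::
    "('k, 'r) module \<Rightarrow> ('r, 'm) module \<Rightarrow> ('r, (('m \<Rightarrow> 'r) \<Rightarrow> 'r) \<Rightarrow> 'r) module" where
  "res2 R M =
     free_module R {f \<in> carrier (res1 R M). free_eval R (res0 R M) f = \<zero>\<^bsub>res0 R M\<^esub>}"

text \<open>The \<open>'k\<close>-vector space of \<open>R\<close>-linear maps. They are taken to be extensional, so that maps which
  agree on \<open>M\<close> are equal. A scalar \<open>c\<close> acts on \<open>N\<close> as the central element \<open>c \<sqdot> 1\<close> of \<open>R\<close>.\<close>

definition hom_space ::
    "('k, 'r) module \<Rightarrow> ('r, 'm) module \<Rightarrow> ('r, 'n) module \<Rightarrow> ('k, 'm \<Rightarrow> 'n) module" where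
  "hom_space R M N = \<lparr>
     carrier = LinearCombinations.module_hom R M N \<inter> extensional (carrier M),
     mult = undefined,
     one = undefined,
     zero = (\<lambda>x\<in>carrier M. \<zero>\<^bsub>N\<^esub>),
     add = (\<lambda>f g. \<lambda>x\<in>carrier M. f x \<oplus>\<^bsub>N\<^esub> g x),
     smult = (\<lambda>c f. \<lambda>x\<in>carrier M. (c \<odot>\<^bsub>R\<^esub> \<one>\<^bsub>R\<^esub>) \<odot>\<^bsub>N\<^esub> f x)\<rparr>"

definition quotient_space :: "('k, 'v) module \<Rightarrow> 'v set \<Rightarrow> ('k, 'v set) module" where
  "quotient_space V W = \<lparr>
     carrier = a_rcosets\<^bsub>V\<^esub> W,
     mult = undefined,
     one = undefined,
     zero = W,
     add = (\<lambda>S T. S <+>\<^bsub>V\<^esub> T),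
     smult = (\<lambda>c S. \<Union>v\<in>S. W +>\<^bsub>V\<^esub> (c \<odot>\<^bsub>V\<^esub> v))\<rparr>"

definition ext1_cocycles ::
    "('k, 'r) module \<Rightarrow> ('r, 'm) module \<Rightarrow> ('r, 'n) module \<Rightarrow> ((('m \<Rightarrow> 'r) \<Rightarrow> 'r) \<Rightarrow> 'n) set" where
  "ext1_cocycles R M N = {\<phi> \<in> carrier (hom_space R (res1 R M) N).
     \<forall>z\<in>carrier (res2 R M). \<phi> (free_eval R (res1 R M) z) = \<zero>\<^bsub>N\<^esub>}"

definition ext1_coboundaries ::
    "('k, 'r) module \<Rightarrow> ('r, 'm) module \<Rightarrow> ('r, 'n) module \<Rightarrow> ((('m \<Rightarrow> 'r) \<Rightarrow> 'r) \<Rightarrow> 'n) set" where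
  "ext1_coboundaries R M N =
     (\<lambda>\<psi>. \<lambda>y\<in>carrier (res1 R M). \<psi> (free_eval R (res0 R M) y))
       ` carrier (hom_space R (res0 R M) N)"

definition ext1 ::
    "('k, 'r) module \<Rightarrow> ('r, 'm) module \<Rightarrow> ('r, 'n) module
      \<Rightarrow> ('k, ((('m \<Rightarrow> 'r) \<Rightarrow> 'r) \<Rightarrow> 'n) set) module" where
  "ext1 R M N = quotient_space
     ((hom_space R (res1 R M) N)\<lparr>carrier := ext1_cocycles R M N\<rparr>) (ext1_coboundaries R M N)"


section \<open>Ends\<close>

definition trivial_module :: "(('k::field, 'v option) alg_term set, 'k) module" where
  "trivial_module = \<lparr>carrier = UNIV, mult = (*), one = 1, zero = 0, add = (+),
     smult = (\<lambda>u c. augmentation u * c)\<rparr>"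

definition regular_module :: "('k, 'r) module \<Rightarrow> ('r, 'r) module" where
  "regular_module R = \<lparr>carrier = carrier R, mult = mult R, one = \<one>\<^bsub>R\<^esub>, zero = \<zero>\<^bsub>R\<^esub>, add = add R,
     smult = mult R\<rparr>"

definition infinitely_many_ends :: "('k::field, 'v) module \<Rightarrow> bool" where
  "infinitely_many_ends L \<longleftrightarrow>
     \<not> vectorspace.fin_dim class_ring (ext1 (uea L) trivial_module (regular_module (uea L)))"

end

theory Submission
  imports Defs "HOL-Library.Product_Plus" "HOL-Library.Function_Algebras"
begin

text \<open>Let \<open>L\<close> be generated by \<open>x\<^sub>0, x\<^sub>1, \<dots>\<close> with \<open>x\<^sub>n\<close> of degree \<open>n + 1\<close>, put
  \<open>a(t) = \<Sum>\<^sub>i x\<^sub>2\<^sub>i t\<^sup>i\<close> and \<open>b(t) = \<Sum>\<^sub>j x\<^sub>2\<^sub>j\<^sub>+\<^sub>1 t\<^sup>j\<close>, and impose \<open>[a(t), b(t)] = 0\<close>.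

  For every \<open>m\<close> there is a 1-cocycle with values in \<open>U(L)\<close> that sends \<open>a(t), b(t)\<close> to
  \<open>t\<^sup>m a(t), t\<^sup>m b(t)\<close>. A coboundary sends the coefficient \<open>a\<^sub>n\<close> of \<open>a(t)\<close> to a multiple \<open>a\<^sub>n u\<close>,
  which has no linear part along \<open>a\<^sub>0\<close> if \<open>n > 0\<close>, whereas the cocycle above sends \<open>a\<^sub>m\<close> to \<open>a\<^sub>0\<close>. So
  these cocycles, \<open>m > 0\<close>, are independent modulo coboundaries.

  Let \<open>L = C * D\<close>, graded, with \<open>x\<^sub>0 \<in> C\<close>, and suppose that \<open>x\<^sub>i \<in> C\<close> for \<open>i < n\<close>. Then
  \<open>x\<^sub>n = c + d\<close> with \<open>c \<in> C\<close> and \<open>d \<in> D\<close>. Map \<open>C\<close> and \<open>D\<close> to two non-commuting lines of the Heisenberg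
  algebra, the first by the coefficient of \<open>x\<^sub>0\<close> or \<open>x\<^sub>1\<close> and the second by the coefficient of \<open>x\<^sub>n\<close>. The
  first relation that involves \<open>x\<^sub>n\<close> says that the coefficient of \<open>x\<^sub>n\<close> in \<open>d\<close> vanishes, whence
  \<open>x\<^sub>n \<in> C\<close>. Thus \<open>C = L\<close>, and \<open>D = 0\<close> as \<open>L = C * D\<close> maps onto \<open>D\<close> with \<open>C\<close> sent to \<open>0\<close>.\<close>


section \<open>Presented algebras\<close>

text \<open>The cocycles rest on the relation being bilinear over power series. A 1-cocycle f into
  the left module U(L) must satisfy f([x,y]) = x f(y) - y f(x), and multiplying both series by t^m
  turns this, on the relation, into t^m [a(t), b(t)] = 0. Infinitely many generators leave room for
  every shift. The generators have pairwise distinct degrees, so degree n + 1 is spanned by x_n and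
  brackets of elements of lower degree. This drives the induction on n and also starts it: degree 1
  is the line of x_0, so one of the two factors contains x_0. The coefficient used on C is that of
  the partner of x_n in relation number n div 2, namely x_1 for even n and x_0 for odd n. All other
  terms of that relation then die, even the one that contains x_(n+1) for even n. The obstacle is
  that L and U(L) are given only as quotients of term algebras. Whatever must be shown nonzero is
  therefore detected by a homomorphism to something explicit: the field as an abelian Lie algebra,
  the dual numbers, an extension of U(L), power series over L, the Heisenberg algebra.\<close>

locale bilinear_algebra =
  fixes A :: "('k::field, 'a) module" (structure)
  assumes zero_closed: "\<zero> \<in> carrier A"
    and add_closed: "\<lbrakk>x \<in> carrier A; y \<in> carrier A\<rbrakk> \<Longrightarrow> x \<oplus> y \<in> carrier A"
    and smult_closed: "x \<in> carrier A \<Longrightarrow> c \<odot> x \<in> carrier A"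
    and mult_closed: "\<lbrakk>x \<in> carrier A; y \<in> carrier A\<rbrakk> \<Longrightarrow> x \<otimes> y \<in> carrier A"
    and add_assoc: "\<lbrakk>x \<in> carrier A; y \<in> carrier A; z \<in> carrier A\<rbrakk>
      \<Longrightarrow> (x \<oplus> y) \<oplus> z = x \<oplus> (y \<oplus> z)"
    and add_comm: "\<lbrakk>x \<in> carrier A; y \<in> carrier A\<rbrakk> \<Longrightarrow> x \<oplus> y = y \<oplus> x"
    and add_zero: "x \<in> carrier A \<Longrightarrow> x \<oplus> \<zero> = x"
    and add_inverse: "x \<in> carrier A \<Longrightarrow> x \<oplus> (- 1) \<odot> x = \<zero>"
    and smult_add: "\<lbrakk>x \<in> carrier A; y \<in> carrier A\<rbrakk> \<Longrightarrow> c \<odot> (x \<oplus> y) = c \<odot> x \<oplus> c \<odot> y"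
    and add_smult: "x \<in> carrier A \<Longrightarrow> (c + d) \<odot> x = c \<odot> x \<oplus> d \<odot> x"
    and smult_smult: "x \<in> carrier A \<Longrightarrow> (c * d) \<odot> x = c \<odot> (d \<odot> x)"
    and one_smult: "x \<in> carrier A \<Longrightarrow> 1 \<odot> x = x"
    and mult_add_left: "\<lbrakk>x \<in> carrier A; y \<in> carrier A; z \<in> carrier A\<rbrakk>
      \<Longrightarrow> (x \<oplus> y) \<otimes> z = x \<otimes> z \<oplus> y \<otimes> z"
    and mult_add_right: "\<lbrakk>x \<in> carrier A; y \<in> carrier A; z \<in> carrier A\<rbrakk>
      \<Longrightarrow> x \<otimes> (y \<oplus> z) = x \<otimes> y \<oplus> x \<otimes> z"
    and mult_smult_left: "\<lbrakk>x \<in> carrier A; y \<in> carrier A\<rbrakk> \<Longrightarrow> (c \<odot> x) \<otimes> y = c \<odot> (x \<otimes> y)"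
    and mult_smult_right: "\<lbrakk>x \<in> carrier A; y \<in> carrier A\<rbrakk> \<Longrightarrow> x \<otimes> (c \<odot> y) = c \<odot> (x \<otimes> y)"
begin

lemma abelian_group: "abelian_group A"
proof (rule abelian_groupI)
  fix x assume "x \<in> carrier A"
  then have "(- 1) \<odot> x \<oplus> x = \<zero>"
    using add_inverse[of x] add_comm[of x "(- 1) \<odot> x"] smult_closed by simp
  then show "\<exists>y\<in>carrier A. y \<oplus> x = \<zero>"
    using \<open>x \<in> carrier A\<close> smult_closed by blast
next
  fix x assume "x \<in> carrier A"
  then show "\<zero> \<oplus> x = x"
    using add_zero[of x] add_comm[of x \<zero>] zero_closed by simp
qed (auto simp: zero_closed add_closed add_assoc intro: add_comm)

lemma vectorspace: "vectorspace class_ring A"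
proof -
  have "module (class_ring :: 'k ring) A"
    by (rule moduleI)
      (auto simp: class_cring.is_cring abelian_group smult_closed add_smult smult_add
         smult_smult one_smult)
  moreover have "field (class_ring :: 'k ring)"
    by (rule class_field)
  ultimately show ?thesis
    unfolding vectorspace_def by simp
qed

lemma term_eval_closed:
  "\<lbrakk>t \<in> terms X; \<And>x. x \<in> X \<Longrightarrow> g x \<in> carrier A\<rbrakk> \<Longrightarrow> term_eval A g t \<in> carrier A"
  by (induction t) (auto simp: terms_def zero_closed add_closed smult_closed mult_closed)

text \<open>Apart from \<open>rel\<close>, each rule of \<open>alg_cong\<close> is either an axiom
  of \<open>bilinear_algebra\<close> or a closure property of equality, so only the relations in
  \<open>E\<close> have to be checked in the target.\<close>

lemma term_eval_cong:
  assumes "(s, t) \<in> alg_cong X E" and g: "\<And>x. x \<in> X \<Longrightarrow> g x \<in> carrier A"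
    and E: "\<And>s t. \<lbrakk>(s, t) \<in> E; s \<in> terms X; t \<in> terms X\<rbrakk> \<Longrightarrow> term_eval A g s = term_eval A g t"
  shows "term_eval A g s = term_eval A g t"
  using assms(1)
proof induction
  case (trans s t u)
  then show ?case by simp
next
  case (rel s t)
  then show ?case by (rule E)
next
  case (Plus_comm s t)
  then show ?case using g by (simp add: add_comm term_eval_closed)
qed (use g in \<open>simp_all add: term_eval_closed add_assoc add_zero add_inverse smult_add
    add_smult smult_smult one_smult mult_add_left mult_add_right mult_smult_left mult_smult_right\<close>)

end

locale algebra_hom =
  fixes A :: "('k::field, 'a) module" and B :: "('k, 'b) module" and f
  assumes hom_closed: "x \<in> carrier A \<Longrightarrow> f x \<in> carrier B"
    and hom_add: "\<lbrakk>x \<in> carrier A; y \<in> carrier A\<rbrakk> \<Longrightarrow> f (x \<oplus>\<^bsub>A\<^esub> y) = f x \<oplus>\<^bsub>B\<^esub> f y"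
    and hom_smult: "x \<in> carrier A \<Longrightarrow> f (c \<odot>\<^bsub>A\<^esub> x) = c \<odot>\<^bsub>B\<^esub> f x"
    and hom_mult: "\<lbrakk>x \<in> carrier A; y \<in> carrier A\<rbrakk> \<Longrightarrow> f (x \<otimes>\<^bsub>A\<^esub> y) = f x \<otimes>\<^bsub>B\<^esub> f y"

lemma alg_cong_terms: "(s, t) \<in> alg_cong X E \<Longrightarrow> s \<in> terms X \<and> t \<in> terms X"
  by (induction rule: alg_cong.induct) (auto simp: terms_def)

lemma equiv_alg_cong: "equiv (terms X) (alg_cong X E)"
proof (rule equivI)
  show "alg_cong X E \<subseteq> terms X \<times> terms X"
    using alg_cong_terms by auto
qed (auto intro: refl_onI symI transI alg_cong.refl alg_cong.sym alg_cong.trans)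

abbreviation cong_class where
  "cong_class X E t \<equiv> alg_cong X E `` {t}"

lemma cong_class_eq_iff:
  "\<lbrakk>s \<in> terms X; t \<in> terms X\<rbrakk> \<Longrightarrow> cong_class X E s = cong_class X E t \<longleftrightarrow> (s, t) \<in> alg_cong X E"
  using equiv_alg_cong eq_equiv_class_iff by metis

lemma terms_simps [simp]:
  "Gen x \<in> terms X \<longleftrightarrow> x \<in> X" "Zero \<in> terms X"
  "Plus s t \<in> terms X \<longleftrightarrow> s \<in> terms X \<and> t \<in> terms X"
  "Times s t \<in> terms X \<longleftrightarrow> s \<in> terms X \<and> t \<in> terms X"
  "Scale c t \<in> terms X \<longleftrightarrow> t \<in> terms X"
  by (auto simp: terms_def)

lemma presented_algebra_simps:
  "carrier (presented_algebra X E) = cong_class X E ` terms X"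
  "zero (presented_algebra X E) = cong_class X E Zero"
  "\<lbrakk>s \<in> terms X; t \<in> terms X\<rbrakk> \<Longrightarrow>
    cong_class X E s \<oplus>\<^bsub>presented_algebra X E\<^esub> cong_class X E t = cong_class X E (Plus s t)"
  "\<lbrakk>s \<in> terms X; t \<in> terms X\<rbrakk> \<Longrightarrow>
    cong_class X E s \<otimes>\<^bsub>presented_algebra X E\<^esub> cong_class X E t = cong_class X E (Times s t)"
  "t \<in> terms X \<Longrightarrow> c \<odot>\<^bsub>presented_algebra X E\<^esub> cong_class X E t = cong_class X E (Scale c t)"
proof -
  show "carrier (presented_algebra X E) = cong_class X E ` terms X"
    by (auto simp: presented_algebra_def quotient_def)
  show "zero (presented_algebra X E) = cong_class X E Zero"
    by (simp add: presented_algebra_def)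
  \<comment> \<open>The record defines its operations as unions over all representatives.
    Compatibility of \<open>F\<close> with the congruence makes all members of the union the same
    class.\<close>
  have union2: "(\<Union>s'\<in>cong_class X E s. \<Union>t'\<in>cong_class X E t. cong_class X E (F s' t'))
      = cong_class X E (F s t)"
    if "s \<in> terms X" "t \<in> terms X"
      and F: "\<And>s s' t t'. \<lbrakk>(s, s') \<in> alg_cong X E; (t, t') \<in> alg_cong X E\<rbrakk>
        \<Longrightarrow> (F s t, F s' t') \<in> alg_cong X E" for F s t
  proof -
    have "cong_class X E (F s' t') = cong_class X E (F s t)"
      if "s' \<in> cong_class X E s" "t' \<in> cong_class X E t" for s' t'
      using F[of s s' t t'] that equiv_class_eq[OF equiv_alg_cong] by (metis Image_singleton_iff)
    moreover have "s \<in> cong_class X E s" "t \<in> cong_class X E t"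
      using that alg_cong.refl by auto
    ultimately show ?thesis by blast
  qed
  show "\<lbrakk>s \<in> terms X; t \<in> terms X\<rbrakk> \<Longrightarrow>
    cong_class X E s \<oplus>\<^bsub>presented_algebra X E\<^esub> cong_class X E t = cong_class X E (Plus s t)"
    using union2[of s t Plus] by (simp add: presented_algebra_def alg_cong.Plus_cong)
  show "\<lbrakk>s \<in> terms X; t \<in> terms X\<rbrakk> \<Longrightarrow>
    cong_class X E s \<otimes>\<^bsub>presented_algebra X E\<^esub> cong_class X E t = cong_class X E (Times s t)"
    using union2[of s t Times] by (simp add: presented_algebra_def alg_cong.Times_cong)
  show "t \<in> terms X \<Longrightarrow>
    c \<odot>\<^bsub>presented_algebra X E\<^esub> cong_class X E t = cong_class X E (Scale c t)"
  proof -
    assume t: "t \<in> terms X"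
    \<comment> \<open>\<open>Scale c\<close> is treated as a binary operation that ignores its first
      argument; a nonempty class absorbs the extra union.\<close>
    then have "cong_class X E t \<noteq> {}"
      using alg_cong.refl by auto
    then show ?thesis
      using union2[of t t "\<lambda>s t. Scale c t"] t by (simp add: presented_algebra_def alg_cong.Scale_cong)
  qed
qed

lemma bilinear_algebra_presented: "bilinear_algebra (presented_algebra X E)"
  by (unfold_locales; unfold presented_algebra_simps(1); (elim imageE)?;
      simp add: presented_algebra_simps cong_class_eq_iff imageI alg_cong.Plus_assoc alg_cong.Plus_comm
        alg_cong.Plus_Zero alg_cong.Plus_inverse alg_cong.Scale_Plus alg_cong.Scale_add
        alg_cong.Scale_Scale alg_cong.Scale_one alg_cong.Times_Plus_left alg_cong.Times_Plus_right
        alg_cong.Times_Scale_left alg_cong.Times_Scale_right)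

context bilinear_algebra
begin

text \<open>Universal property of generators and relations. \<open>term_eval\<close> takes a single
  value on each class, which gives the \<open>the_elem\<close> in \<open>induced_hom\<close> its
  meaning.\<close>

lemma
  assumes g: "\<And>x. x \<in> X \<Longrightarrow> g x \<in> carrier A"
    and E: "\<And>s t. \<lbrakk>(s, t) \<in> E; s \<in> terms X; t \<in> terms X\<rbrakk> \<Longrightarrow> term_eval A g s = term_eval A g t"
  shows induced_hom_class:
      "t \<in> terms X \<Longrightarrow> induced_hom A g (cong_class X E t) = term_eval A g t"
    and algebra_hom_induced: "algebra_hom (presented_algebra X E) A (induced_hom A g)"
proof -
  show class_eq: "induced_hom A g (cong_class X E t) = term_eval A g t" if "t \<in> terms X" for t
  proof -
    have "t \<in> cong_class X E t" using that alg_cong.refl by auto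
    moreover have "term_eval A g s = term_eval A g t" if "s \<in> cong_class X E t" for s
      using that term_eval_cong[of t s X E g] g E by auto
    ultimately have "term_eval A g ` cong_class X E t = {term_eval A g t}" by blast
    then show ?thesis by (simp add: induced_hom_def)
  qed
  show "algebra_hom (presented_algebra X E) A (induced_hom A g)"
    using g by unfold_locales
      (auto simp: presented_algebra_simps class_eq term_eval_closed)
qed

end


section \<open>Algebras on types\<close>

text \<open>The carrier is a whole type, so that sums and signs come from the type class.
  \<open>rec\<close> turns such an algebra back into a record and so makes it a target for
  \<open>induced_hom\<close>.\<close>

locale type_algebra =
  fixes s :: "'k::field \<Rightarrow> 'a::ab_group_add \<Rightarrow> 'a" and m :: "'a \<Rightarrow> 'a \<Rightarrow> 'a"
  assumes s_add: "s c (x + y) = s c x + s c y"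
    and add_s: "s (c + d) x = s c x + s d x"
    and s_s: "s (c * d) x = s c (s d x)"
    and s_one: "s 1 x = x"
    and m_add_left: "m (x + y) z = m x z + m y z"
    and m_add_right: "m x (y + z) = m x y + m x z"
    and m_s_left: "m (s c x) y = s c (m x y)"
    and m_s_right: "m x (s c y) = s c (m x y)"
begin

lemma s_zero_left: "s 0 x = 0"
  using add_s[of 0 0 x] by simp

lemma s_zero_right: "s c 0 = 0"
  using s_add[of c 0 0] by simp

lemma s_uminus_one: "s (- 1) x = - x"
  using add_s[of "-1" 1 x] s_one s_zero_left by (simp add: eq_neg_iff_add_eq_0)

lemma s_diff: "s c (x - y) = s c x - s c y"
  using s_add[of c "x - y" y] by (simp add: algebra_simps)

lemma m_zero_left: "m 0 y = 0"
  using m_add_left[of 0 0 y] by simp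

lemma m_zero_right: "m x 0 = 0"
  using m_add_right[of x 0 0] by simp

lemma m_uminus_left: "m (- x) y = - m x y"
  using m_add_left[of x "- x" y] by (simp add: m_zero_left minus_unique)

lemma m_uminus_right: "m x (- y) = - m x y"
  using m_add_right[of x y "- y"] by (simp add: m_zero_right minus_unique)

lemma m_diff_left: "m (x - y) z = m x z - m y z"
  using m_add_left[of x "- y" z] by (simp add: m_uminus_left)

lemma m_diff_right: "m z (x - y) = m z x - m z y"
  using m_add_right[of z x "- y"] by (simp add: m_uminus_right)

lemma s_sum: "s c (sum f I) = (\<Sum>i\<in>I. s c (f i))"
  by (induction I rule: infinite_finite_induct) (auto simp: s_zero_right s_add)

lemma m_sum_left: "m (sum f I) y = (\<Sum>i\<in>I. m (f i) y)"
  by (induction I rule: infinite_finite_induct) (auto simp: m_zero_left m_add_left)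

lemma m_sum_right: "m y (sum f I) = (\<Sum>i\<in>I. m y (f i))"
  by (induction I rule: infinite_finite_induct) (auto simp: m_zero_right m_add_right)

definition rec :: "('k, 'a) module" where
  "rec = \<lparr>carrier = UNIV, mult = m, one = undefined, zero = 0, add = (+), smult = s\<rparr>"

lemma rec_simps [simp]:
  "carrier rec = UNIV" "mult rec = m" "zero rec = 0" "add rec = (+)" "smult rec = s"
  by (auto simp: rec_def)

lemma bilinear_algebra_rec: "bilinear_algebra rec"
  by unfold_locales
    (auto simp: s_add add_s s_s s_one m_add_left m_add_right m_s_left m_s_right s_uminus_one algebra_simps)

end

locale lie_type_algebra = type_algebra +
  assumes m_self: "m x x = 0"
    and m_jacobi: "m x (m y z) + (m y (m z x) + m z (m x y)) = 0"
begin

lemma m_anticomm: "m y x = - m x y"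
  using m_self[of "x + y"] m_self[of x] m_self[of y]
  by (simp add: m_add_left m_add_right eq_neg_iff_add_eq_0 add.commute)

end

lemma (in type_algebra) lie_type_algebra_commutator:
  assumes "\<And>x y z. m (m x y) z = m x (m y z)"
  shows "lie_type_algebra s (\<lambda>x y. m x y - m y x)"
  by unfold_locales
    (auto simp: s_add add_s s_s s_one m_add_left m_add_right m_s_left m_s_right s_diff assms
      m_diff_left m_diff_right algebra_simps)


section \<open>The Lie algebra\<close>

text \<open>The generators \<open>Gen (2 * i)\<close> and \<open>Gen (2 * j + 1)\<close> are the coefficients of power series
  \<open>a(t)\<close> and \<open>b(t)\<close>, and the relations say that \<open>[a(t), b(t)] = 0\<close>.\<close>

definition convolution_term :: "nat \<Rightarrow> ('k, nat) alg_term" where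
  "convolution_term n =
     foldr (\<lambda>i. Plus (Times (Gen (2 * i)) (Gen (2 * (n - i) + 1)))) [0..<Suc n] Zero"

definition series_rels :: "(('k, nat) alg_term \<times> ('k, nat) alg_term) set" where
  "series_rels = lie_rels \<union> {(convolution_term n, Zero) | n. True}"

lemma (in type_algebra) term_eval_convolution_term:
  "term_eval rec g (convolution_term n) = (\<Sum>i\<le>n. m (g (2 * i)) (g (2 * (n - i) + 1)))"
proof -
  have "term_eval rec g (foldr (\<lambda>i. Plus (Times (Gen (2 * i)) (Gen (2 * (n - i) + 1)))) is Zero)
      = (\<Sum>i\<leftarrow>is. m (g (2 * i)) (g (2 * (n - i) + 1)))" for "is"
    by (induction "is") auto
  then show ?thesis
    by (simp add: convolution_term_def interv_sum_list_conv_sum_set_nat atLeast0LessThan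
        flip: lessThan_Suc_atMost del: upt_Suc)
qed

typedef (overloaded) ('k::field) lie =
  "carrier (presented_algebra UNIV series_rels :: ('k, ('k, nat) alg_term set) module)"
  using bilinear_algebra.zero_closed[OF bilinear_algebra_presented] by auto

interpretation series: bilinear_algebra
  "presented_algebra UNIV series_rels :: ('k::field, ('k, nat) alg_term set) module"
  by (rule bilinear_algebra_presented)

instantiation lie :: (field) ab_group_add
begin

definition "0 = Abs_lie \<zero>\<^bsub>presented_algebra UNIV series_rels\<^esub>"
definition "x + y = Abs_lie (Rep_lie x \<oplus>\<^bsub>presented_algebra UNIV series_rels\<^esub> Rep_lie y)"
definition "- x = Abs_lie ((- 1) \<odot>\<^bsub>presented_algebra UNIV series_rels\<^esub> Rep_lie x)"
definition "x - y = x + - (y :: 'a lie)"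

lemma Rep_lie_simps:
  "Rep_lie (0 :: 'a lie) = \<zero>\<^bsub>presented_algebra UNIV series_rels\<^esub>"
  "Rep_lie (x + y) = Rep_lie x \<oplus>\<^bsub>presented_algebra UNIV series_rels\<^esub> Rep_lie y"
  "Rep_lie (- x) = (- 1) \<odot>\<^bsub>presented_algebra UNIV series_rels\<^esub> Rep_lie x"
  by (simp_all add: zero_lie_def plus_lie_def uminus_lie_def Abs_lie_inverse Rep_lie
      series.zero_closed series.add_closed series.smult_closed)

instance
proof
  fix a b c :: "'a lie"
  show "a + b = b + a"
    using series.add_comm[OF Rep_lie Rep_lie, of a b] by (simp add: Rep_lie_simps flip: Rep_lie_inject)
  then show "0 + a = a"
    using series.add_zero[OF Rep_lie, of a] series.add_comm[OF Rep_lie series.zero_closed, of a]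
    by (simp add: Rep_lie_simps flip: Rep_lie_inject)
  show "a + b + c = a + (b + c)"
    using series.add_assoc[OF Rep_lie Rep_lie Rep_lie, of a b c]
    by (simp add: Rep_lie_simps flip: Rep_lie_inject)
  show "- a + a = 0"
    using series.add_inverse[OF Rep_lie, of a] series.add_comm[OF Rep_lie series.smult_closed, OF Rep_lie, of a "-1" a]
    by (simp add: Rep_lie_simps flip: Rep_lie_inject)
  show "a - b = a + - b"
    by (simp add: minus_lie_def)
qed

end

definition lie_scale :: "'k \<Rightarrow> 'k lie \<Rightarrow> 'k::field lie" where
  "lie_scale c x = Abs_lie (c \<odot>\<^bsub>presented_algebra UNIV series_rels\<^esub> Rep_lie x)"

definition bracket :: "'k lie \<Rightarrow> 'k lie \<Rightarrow> 'k::field lie" where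
  "bracket x y = Abs_lie (Rep_lie x \<otimes>\<^bsub>presented_algebra UNIV series_rels\<^esub> Rep_lie y)"

definition lie_gen :: "nat \<Rightarrow> 'k::field lie" where
  "lie_gen n = Abs_lie (cong_class UNIV series_rels (Gen n))"

lemma Rep_lie_simps2:
  "Rep_lie (lie_scale c x) = c \<odot>\<^bsub>presented_algebra UNIV series_rels\<^esub> Rep_lie x"
  "Rep_lie (bracket x y) = Rep_lie x \<otimes>\<^bsub>presented_algebra UNIV series_rels\<^esub> Rep_lie y"
  "Rep_lie (lie_gen n) = cong_class UNIV series_rels (Gen n)"
  apply (simp_all add: lie_scale_def bracket_def Abs_lie_inverse Rep_lie
      series.mult_closed series.smult_closed)
  by (simp add: lie_gen_def Abs_lie_inverse presented_algebra_simps)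

lemma lie_cases:
  obtains t where "Rep_lie (x :: 'k::field lie) = cong_class UNIV series_rels t"
  using Rep_lie[of x] by (auto simp: presented_algebra_simps)

lemma Rep_lie_eqI:
  assumes "Rep_lie x = cong_class UNIV series_rels s" "Rep_lie y = cong_class UNIV series_rels t"
    and "(s, t) \<in> alg_cong UNIV series_rels"
  shows "x = (y :: 'k::field lie)"
proof -
  have "Rep_lie x = Rep_lie y"
    using assms by (simp add: cong_class_eq_iff terms_def)
  then show ?thesis by (simp add: Rep_lie_inject)
qed

lemma terms_UNIV [simp]: "t \<in> terms UNIV"
  by (simp add: terms_def)

interpretation lie: lie_type_algebra lie_scale "bracket :: _ \<Rightarrow> _ \<Rightarrow> 'k::field lie"
proof -
  have self: "bracket x x = 0" for x :: "'k lie"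
  proof -
    obtain t where t: "Rep_lie x = cong_class UNIV series_rels t" by (rule lie_cases)
    have "(Times t t, Zero) \<in> alg_cong UNIV series_rels"
      by (rule alg_cong.rel) (auto simp: series_rels_def lie_rels_def)
    then show ?thesis
      by (intro Rep_lie_eqI) (auto simp: t Rep_lie_simps Rep_lie_simps2 presented_algebra_simps)
  qed
  have jacobi: "bracket x (bracket y z) + (bracket y (bracket z x) + bracket z (bracket x y)) = 0"
    for x y z :: "'k lie"
  proof -
    obtain r s t where t: "Rep_lie x = cong_class UNIV series_rels r"
      "Rep_lie y = cong_class UNIV series_rels s" "Rep_lie z = cong_class UNIV series_rels t"
      using lie_cases by metis
    have "(Plus (Times r (Times s t)) (Plus (Times s (Times t r)) (Times t (Times r s))), Zero)
        \<in> alg_cong UNIV series_rels"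
      by (rule alg_cong.rel) (auto simp: series_rels_def lie_rels_def)
    then show ?thesis
      by (intro Rep_lie_eqI) (auto simp: t Rep_lie_simps Rep_lie_simps2 presented_algebra_simps)
  qed
  show "lie_type_algebra lie_scale (bracket :: _ \<Rightarrow> _ \<Rightarrow> 'k lie)"
    by unfold_locales
      (simp_all add: self jacobi,
       simp_all add: Rep_lie_simps Rep_lie_simps2 Rep_lie series.smult_add series.add_smult series.smult_smult
        series.one_smult series.mult_add_left series.mult_add_right series.mult_smult_left series.mult_smult_right
        flip: Rep_lie_inject)
qed

text \<open>Each element is the class of some term, so induction on terms descends to the quotient.
  Statements about all elements are proved this way, in place of an argument with a basis.\<close>

lemma lie_induct [case_names gen zero add scale bracket]:
  fixes x :: "'k::field lie"
  assumes "\<And>n. P (lie_gen n)" "P 0" "\<And>x y. \<lbrakk>P x; P y\<rbrakk> \<Longrightarrow> P (x + y)"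
    "\<And>c x. P x \<Longrightarrow> P (lie_scale c x)" "\<And>x y. \<lbrakk>P x; P y\<rbrakk> \<Longrightarrow> P (bracket x y)"
  shows "P x"
proof -
  have "\<exists>x. P x \<and> Rep_lie x = cong_class UNIV series_rels t" for t :: "('k, nat) alg_term"
  proof (induction t)
    case (Gen n)
    show ?case using assms(1) Rep_lie_simps2(3) by blast
  next
    case Zero
    show ?case using assms(2) by (auto simp: Rep_lie_simps presented_algebra_simps)
  next
    case (Plus s t)
    then obtain x y where "P x" "P y" "Rep_lie x = cong_class UNIV series_rels s"
      "Rep_lie y = cong_class UNIV series_rels t" by blast
    then show ?case
      using assms(3) by (intro exI[of _ "x + y"]) (auto simp: Rep_lie_simps presented_algebra_simps)
  next
    case (Scale c t)
    then obtain x where "P x" "Rep_lie x = cong_class UNIV series_rels t" by blast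
    then show ?case
      using assms(4)
      by (intro exI[of _ "lie_scale c x"]) (auto simp: Rep_lie_simps2 presented_algebra_simps)
  next
    case (Times s t)
    then obtain x y where "P x" "P y" "Rep_lie x = cong_class UNIV series_rels s"
      "Rep_lie y = cong_class UNIV series_rels t" by blast
    then show ?case
      using assms(5)
      by (intro exI[of _ "bracket x y"]) (auto simp: Rep_lie_simps2 presented_algebra_simps)
  qed
  then show ?thesis
    by (metis lie_cases Rep_lie_inject)
qed

section \<open>Homomorphisms out of the Lie algebra\<close>

locale lie_map =
  fixes s :: "'k::field \<Rightarrow> 'a::ab_group_add \<Rightarrow> 'a" and m :: "'a \<Rightarrow> 'a \<Rightarrow> 'a"
    and h :: "'k lie \<Rightarrow> 'a"
  assumes map_add: "h (x + y) = h x + h y"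
    and map_scale: "h (lie_scale c x) = s c (h x)"
    and map_bracket: "h (bracket x y) = m (h x) (h y)"
begin

lemma map_zero: "h 0 = 0"
  using map_add[of 0 0] by simp

lemma map_sum: "h (sum f I) = (\<Sum>i\<in>I. h (f i))"
  by (induction I rule: infinite_finite_induct) (auto simp: map_zero map_add)

end

lemma lie_map_eqI:
  assumes "lie_map s m f" "lie_map s m g" "\<And>n. f (lie_gen n) = g (lie_gen n)"
  shows "f x = g x"
  by (induction x rule: lie_induct)
    (simp_all add: assms(3) lie_map.map_zero[OF assms(1)] lie_map.map_zero[OF assms(2)]
      lie_map.map_add[OF assms(1)] lie_map.map_add[OF assms(2)]
      lie_map.map_scale[OF assms(1)] lie_map.map_scale[OF assms(2)]
      lie_map.map_bracket[OF assms(1)] lie_map.map_bracket[OF assms(2)])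

lemma lie_gen_relation:
  "(\<Sum>i\<le>n. bracket (lie_gen (2 * i)) (lie_gen (2 * (n - i) + 1))) = (0 :: 'k::field lie)"
proof -
  \<comment> \<open>Evaluating a term at the generators returns the class of that term, so the
    imposed relation between terms becomes an identity in the Lie algebra.\<close>
  have "Rep_lie (term_eval lie.rec lie_gen t :: 'k lie) = cong_class UNIV series_rels t" for t
    by (induction t) (auto simp: Rep_lie_simps Rep_lie_simps2 presented_algebra_simps)
  moreover have "(convolution_term n, Zero)
      \<in> (alg_cong UNIV series_rels :: (('k, nat) alg_term \<times> ('k, nat) alg_term) set)"
    by (rule alg_cong.rel) (auto simp: series_rels_def)
  ultimately have "term_eval lie.rec lie_gen (convolution_term n) = (0 :: 'k lie)"
    by (intro Rep_lie_eqI) (auto simp: Rep_lie_simps presented_algebra_simps)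
  then show ?thesis
    by (simp add: lie.term_eval_convolution_term)
qed

text \<open>The relations in \<open>lie_rels\<close> hold in any Lie algebra, so the images of the
  generators are constrained by the convolution relations alone. Linear forms, cocycles and the
  grading all arise from this lemma.\<close>

lemma (in lie_type_algebra) lie_lift:
  assumes "\<And>n. (\<Sum>i\<le>n. m (g (2 * i)) (g (2 * (n - i) + 1))) = 0"
  obtains h where "lie_map s m h" "\<And>n. h (lie_gen n) = g n"
proof
  interpret R: bilinear_algebra rec by (rule bilinear_algebra_rec)
  have g: "g x \<in> carrier rec" for x by simp
  have E: "term_eval rec g t = term_eval rec g t'" if "(t, t') \<in> series_rels" for t t'
    using that assms term_eval_convolution_term[of g]
    by (auto simp: series_rels_def lie_rels_def m_self m_jacobi simp del: One_nat_def)
  interpret F: algebra_hom "presented_algebra UNIV series_rels" rec "induced_hom rec g"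
    by (rule R.algebra_hom_induced[OF g E])
  show "lie_map s m (\<lambda>x. induced_hom rec g (Rep_lie x))"
    by unfold_locales
      (auto simp: Rep_lie_simps Rep_lie_simps2 F.hom_add F.hom_smult F.hom_mult Rep_lie)
  show "induced_hom rec g (Rep_lie (lie_gen n)) = g n" for n
    using R.induced_hom_class[OF g E, where X = UNIV and t = "Gen n"] by (simp add: Rep_lie_simps2)
qed


section \<open>The Lie algebra inside the space of sequences\<close>

text \<open>A bijection from pairs of sequences to sequences; iterated, it packs a whole term tree
  into one sequence.\<close>

definition interleave :: "(nat \<Rightarrow> 'a) \<Rightarrow> (nat \<Rightarrow> 'a) \<Rightarrow> nat \<Rightarrow> 'a" where
  "interleave f g i = (if even i then f (i div 2) else g (i div 2))"

lemma interleave_eq_iff: "interleave f g = interleave f' g' \<longleftrightarrow> f = f' \<and> g = g'"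
proof
  assume eq: "interleave f g = interleave f' g'"
  have "f i = f' i" "g i = g' i" for i
    using fun_cong[OF eq, of "2 * i"] fun_cong[OF eq, of "2 * i + 1"] by (auto simp: interleave_def)
  then show "f = f' \<and> g = g'" by blast
qed auto

definition unit_seq :: "nat \<Rightarrow> nat \<Rightarrow> 'k::field" where
  "unit_seq n i = of_bool (i = n)"

lemma unit_seq_eq_iff: "unit_seq m = (unit_seq n :: nat \<Rightarrow> 'k::field) \<longleftrightarrow> m = n"
proof
  assume "unit_seq m = (unit_seq n :: nat \<Rightarrow> 'k)"
  then have "unit_seq m m = (unit_seq n m :: 'k)" by simp
  then show "m = n" by (auto simp: unit_seq_def split: if_splits)
qed auto

text \<open>The first component is a tag for the constructor. Tags are unit sequences rather than
  the scalars 0 to 4, which need not be distinct in a field of small characteristic; the same holds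
  for the index of a generator.\<close>

primrec encode :: "('k::field, nat) alg_term \<Rightarrow> nat \<Rightarrow> 'k" where
  "encode (Gen n) = interleave (unit_seq 0) (unit_seq n)"
| "encode Zero = interleave (unit_seq 1) (unit_seq 0)"
| "encode (Plus s t) = interleave (unit_seq 2) (interleave (encode s) (encode t))"
| "encode (Scale c t) = interleave (unit_seq 3) (interleave (\<lambda>_. c) (encode t))"
| "encode (Times s t) = interleave (unit_seq 4) (interleave (encode s) (encode t))"

lemma encode_inject: "encode s = encode t \<Longrightarrow> s = t"
proof (induction s arbitrary: t)
  case (Gen n)
  then show ?case by (cases t) (auto simp: interleave_eq_iff unit_seq_eq_iff)
next
  case Zero
  then show ?case by (cases t) (auto simp: interleave_eq_iff unit_seq_eq_iff)
next
  case (Plus s1 s2)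
  from Plus.prems show ?case
    by (cases t) (auto simp: interleave_eq_iff unit_seq_eq_iff intro: Plus.IH)
next
  case (Scale c s)
  from Scale.prems show ?case
    by (cases t) (auto simp: interleave_eq_iff unit_seq_eq_iff fun_eq_iff[of "\<lambda>_. c"] intro: Scale.IH)
next
  case (Times s1 s2)
  from Times.prems show ?case
    by (cases t) (auto simp: interleave_eq_iff unit_seq_eq_iff intro: Times.IH)
qed

text \<open>The theorem asks for a Lie algebra of sequences. Any injection serves to transport the structure;
  this one encodes a chosen term of each congruence class.\<close>

definition emb :: "'k::field lie \<Rightarrow> nat \<Rightarrow> 'k" where
  "emb x = encode (SOME t. Rep_lie x = cong_class UNIV series_rels t)"

lemma inj_emb: "inj (emb :: 'k::field lie \<Rightarrow> _)"
proof (rule injI)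
  fix x y :: "'k lie" assume "emb x = emb y"
  then have "(SOME t. Rep_lie x = cong_class UNIV series_rels t)
      = (SOME t. Rep_lie y = cong_class UNIV series_rels t)"
    by (simp add: emb_def encode_inject)
  moreover have "Rep_lie z = cong_class UNIV series_rels (SOME t. Rep_lie z = cong_class UNIV series_rels t)"
    for z :: "'k lie"
    by (rule someI_ex) (metis lie_cases)
  ultimately have "Rep_lie x = Rep_lie y" by metis
  then show "x = y" by (simp add: Rep_lie_inject)
qed

lemma emb_eq_iff [simp]: "emb x = emb y \<longleftrightarrow> x = y"
  using inj_emb by (auto dest: injD)

lemma inv_emb [simp]: "the_inv emb (emb x) = x"
  by (simp add: inj_emb the_inv_f_f)

definition lie_alg :: "('k::field, nat \<Rightarrow> 'k) module" where
  "lie_alg = \<lparr>carrier = range emb, mult = (\<lambda>x y. emb (bracket (the_inv emb x) (the_inv emb y))),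
     one = undefined, zero = emb 0, add = (\<lambda>x y. emb (the_inv emb x + the_inv emb y)),
     smult = (\<lambda>c x. emb (lie_scale c (the_inv emb x)))\<rparr>"

lemma lie_alg_simps [simp]:
  "carrier lie_alg = range emb"
  "\<zero>\<^bsub>lie_alg\<^esub> = emb 0"
  "emb x \<oplus>\<^bsub>lie_alg\<^esub> emb y = emb (x + y)"
  "emb x \<otimes>\<^bsub>lie_alg\<^esub> emb y = emb (bracket x y)"
  "c \<odot>\<^bsub>lie_alg\<^esub> emb x = emb (lie_scale c x)"
  by (simp_all add: lie_alg_def)

lemma bilinear_algebra_lie_alg: "bilinear_algebra lie_alg"
  by unfold_locales
    (auto simp: lie.s_uminus_one lie.s_add lie.add_s lie.s_s lie.s_one lie.m_add_left
      lie.m_add_right lie.m_s_left lie.m_s_right algebra_simps)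

lemma lie_algebra_lie_alg: "lie_algebra lie_alg"
proof -
  interpret L: bilinear_algebra lie_alg by (rule bilinear_algebra_lie_alg)
  interpret vectorspace class_ring lie_alg by (rule L.vectorspace)
  show ?thesis
    by unfold_locales
      (auto simp: lie.m_add_left lie.m_add_right lie.m_s_left lie.m_s_right lie.m_self lie.m_jacobi)
qed


section \<open>Its enveloping algebra\<close>

lemma uea_simps:
  "carrier (uea L) = carrier (presented_algebra (uea_gens L) (uea_rels L))"
  "\<one>\<^bsub>uea L\<^esub> = cong_class (uea_gens L) (uea_rels L) (Gen None)"
  "\<zero>\<^bsub>uea L\<^esub> = \<zero>\<^bsub>presented_algebra (uea_gens L) (uea_rels L)\<^esub>"
  "x \<oplus>\<^bsub>uea L\<^esub> y = x \<oplus>\<^bsub>presented_algebra (uea_gens L) (uea_rels L)\<^esub> y"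
  "x \<otimes>\<^bsub>uea L\<^esub> y = x \<otimes>\<^bsub>presented_algebra (uea_gens L) (uea_rels L)\<^esub> y"
  "c \<odot>\<^bsub>uea L\<^esub> x = c \<odot>\<^bsub>presented_algebra (uea_gens L) (uea_rels L)\<^esub> x"
  by (simp_all add: uea_def)

lemma bilinear_algebra_uea: "bilinear_algebra (uea L)"
  using bilinear_algebra_presented[of "uea_gens L" "uea_rels L"]
  unfolding bilinear_algebra_def uea_simps .

abbreviation env_class where
  "env_class \<equiv> cong_class (uea_gens (lie_alg :: ('k::field, nat \<Rightarrow> 'k) module)) (uea_rels lie_alg)"

typedef (overloaded) ('k::field) env = "carrier (uea (lie_alg :: ('k, nat \<Rightarrow> 'k) module))"
  using bilinear_algebra.zero_closed[OF bilinear_algebra_uea] by auto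

interpretation uea_lie: bilinear_algebra "uea (lie_alg :: ('k::field, nat \<Rightarrow> 'k) module)"
  by (rule bilinear_algebra_uea)

lemma uea_gens_simps [simp]:
  "None \<in> uea_gens L" "Some x \<in> uea_gens L \<longleftrightarrow> x \<in> carrier L"
  by (auto simp: uea_gens_def)

lemma uea_class_simps:
  assumes "s \<in> terms (uea_gens L)"
  shows "t \<in> terms (uea_gens L) \<Longrightarrow>
      cong_class (uea_gens L) (uea_rels L) s \<oplus>\<^bsub>uea L\<^esub> cong_class (uea_gens L) (uea_rels L) t
      = cong_class (uea_gens L) (uea_rels L) (Plus s t)"
    "t \<in> terms (uea_gens L) \<Longrightarrow>
      cong_class (uea_gens L) (uea_rels L) s \<otimes>\<^bsub>uea L\<^esub> cong_class (uea_gens L) (uea_rels L) t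
      = cong_class (uea_gens L) (uea_rels L) (Times s t)"
    "c \<odot>\<^bsub>uea L\<^esub> cong_class (uea_gens L) (uea_rels L) s
      = cong_class (uea_gens L) (uea_rels L) (Scale c s)"
  using assms by (simp_all add: uea_simps presented_algebra_simps)

lemma uea_rels_class:
  "\<lbrakk>(s, t) \<in> uea_rels L; s \<in> terms (uea_gens L); t \<in> terms (uea_gens L)\<rbrakk>
    \<Longrightarrow> cong_class (uea_gens L) (uea_rels L) s = cong_class (uea_gens L) (uea_rels L) t"
  by (simp add: cong_class_eq_iff alg_cong.rel)

lemma uea_cases:
  assumes "u \<in> carrier (uea L)"
  obtains t where "t \<in> terms (uea_gens L)" "u = cong_class (uea_gens L) (uea_rels L) t"
  using assms by (auto simp: uea_simps presented_algebra_simps)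

lemma uea_one_closed: "\<one>\<^bsub>uea L\<^esub> \<in> carrier (uea L)"
  by (auto simp: uea_simps presented_algebra_simps)

lemma uea_assoc:
  assumes "u \<in> carrier (uea L)" "v \<in> carrier (uea L)" "w \<in> carrier (uea L)"
  shows "(u \<otimes>\<^bsub>uea L\<^esub> v) \<otimes>\<^bsub>uea L\<^esub> w = u \<otimes>\<^bsub>uea L\<^esub> (v \<otimes>\<^bsub>uea L\<^esub> w)"
proof -
  obtain r s t where t: "r \<in> terms (uea_gens L)" "s \<in> terms (uea_gens L)" "t \<in> terms (uea_gens L)"
    and "u = cong_class (uea_gens L) (uea_rels L) r" "v = cong_class (uea_gens L) (uea_rels L) s"
      "w = cong_class (uea_gens L) (uea_rels L) t"
    using assms uea_cases by metis
  moreover have "(Times (Times r s) t, Times r (Times s t)) \<in> uea_rels L"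
    by (auto simp: uea_rels_def)
  ultimately show ?thesis
    by (simp add: uea_class_simps uea_rels_class)
qed

lemma uea_one:
  assumes "u \<in> carrier (uea L)"
  shows "\<one>\<^bsub>uea L\<^esub> \<otimes>\<^bsub>uea L\<^esub> u = u" "u \<otimes>\<^bsub>uea L\<^esub> \<one>\<^bsub>uea L\<^esub> = u"
proof -
  obtain t where t: "t \<in> terms (uea_gens L)" "u = cong_class (uea_gens L) (uea_rels L) t"
    using assms uea_cases by metis
  moreover have "(Times (Gen None) t, t) \<in> uea_rels L" "(Times t (Gen None), t) \<in> uea_rels L"
    by (auto simp: uea_rels_def)
  ultimately show "\<one>\<^bsub>uea L\<^esub> \<otimes>\<^bsub>uea L\<^esub> u = u" "u \<otimes>\<^bsub>uea L\<^esub> \<one>\<^bsub>uea L\<^esub> = u"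
    by (simp_all add: uea_class_simps uea_rels_class uea_simps(2))
qed

lemma ring_uea: "ring (uea L)"
proof (rule ringI)
  interpret bilinear_algebra "uea L" by (rule bilinear_algebra_uea)
  show "abelian_group (uea L)" by (rule abelian_group)
  show "Group.monoid (uea L)"
    by unfold_locales (auto simp: mult_closed uea_one_closed uea_assoc uea_one)
qed (auto simp: bilinear_algebra.mult_add_left[OF bilinear_algebra_uea]
    bilinear_algebra.mult_add_right[OF bilinear_algebra_uea])

lemma uea_rels_augmentation:
  "(s, t) \<in> uea_rels L \<Longrightarrow>
    term_eval base_algebra (case_option 1 (\<lambda>x. 0)) s = term_eval base_algebra (case_option 1 (\<lambda>x. 0)) t"
  by (auto simp: uea_rels_def linear_rels_def base_algebra_def)

lemma bilinear_algebra_base: "bilinear_algebra base_algebra"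
  by unfold_locales (auto simp: base_algebra_def algebra_simps)

lemma algebra_hom_augmentation: "algebra_hom (uea L) base_algebra augmentation"
proof -
  interpret algebra_hom "presented_algebra (uea_gens L) (uea_rels L)" base_algebra augmentation
    unfolding augmentation_def
    by (rule bilinear_algebra.algebra_hom_induced[OF bilinear_algebra_base _ uea_rels_augmentation])
      (auto simp: base_algebra_def)
  show ?thesis
    by unfold_locales (simp_all add: uea_simps hom_closed hom_add hom_smult hom_mult)
qed

lemma augmentation_class:
  "t \<in> terms (uea_gens L) \<Longrightarrow> augmentation (cong_class (uea_gens L) (uea_rels L) t)
    = term_eval base_algebra (case_option 1 (\<lambda>x. 0)) t"
  unfolding augmentation_def
  by (rule bilinear_algebra.induced_hom_class[OF bilinear_algebra_base _ uea_rels_augmentation])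
    (auto simp: base_algebra_def)

lemma augmentation_simps:
  "\<lbrakk>u \<in> carrier (uea L); v \<in> carrier (uea L)\<rbrakk>
    \<Longrightarrow> augmentation (u \<oplus>\<^bsub>uea L\<^esub> v) = augmentation u + augmentation v"
  "\<lbrakk>u \<in> carrier (uea L); v \<in> carrier (uea L)\<rbrakk>
    \<Longrightarrow> augmentation (u \<otimes>\<^bsub>uea L\<^esub> v) = augmentation u * augmentation v"
  "u \<in> carrier (uea L) \<Longrightarrow> augmentation (c \<odot>\<^bsub>uea L\<^esub> u) = c * augmentation u"
  "augmentation \<one>\<^bsub>uea L\<^esub> = 1" "augmentation \<zero>\<^bsub>uea L\<^esub> = 0"
  by (simp_all add: algebra_hom.hom_add[OF algebra_hom_augmentation]
      algebra_hom.hom_mult[OF algebra_hom_augmentation]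
      algebra_hom.hom_smult[OF algebra_hom_augmentation]
      uea_simps(2,3) presented_algebra_simps augmentation_class)
    (simp_all add: base_algebra_def)

instantiation env :: (field) ring_1
begin

definition "0 = Abs_env \<zero>\<^bsub>uea lie_alg\<^esub>"
definition "1 = Abs_env \<one>\<^bsub>uea lie_alg\<^esub>"
definition "u + v = Abs_env (Rep_env u \<oplus>\<^bsub>uea lie_alg\<^esub> Rep_env v)"
definition "u * v = Abs_env (Rep_env u \<otimes>\<^bsub>uea lie_alg\<^esub> Rep_env v)"
definition "- u = Abs_env ((- 1) \<odot>\<^bsub>uea lie_alg\<^esub> Rep_env u)"
definition "u - v = u + - (v :: 'a env)"

lemma Rep_env_simps:
  "Rep_env (0 :: 'a env) = \<zero>\<^bsub>uea lie_alg\<^esub>"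
  "Rep_env (1 :: 'a env) = \<one>\<^bsub>uea lie_alg\<^esub>"
  "Rep_env (u + v) = Rep_env u \<oplus>\<^bsub>uea lie_alg\<^esub> Rep_env v"
  "Rep_env (u * v) = Rep_env u \<otimes>\<^bsub>uea lie_alg\<^esub> Rep_env v"
  "Rep_env (- u) = (- 1) \<odot>\<^bsub>uea lie_alg\<^esub> Rep_env u"
  by (simp_all add: zero_env_def one_env_def plus_env_def times_env_def uminus_env_def
      Abs_env_inverse Rep_env uea_lie.zero_closed uea_lie.add_closed uea_lie.smult_closed
      uea_lie.mult_closed uea_one_closed)

instance
proof
  fix a b c :: "'a env"
  show "a + b = b + a"
    using uea_lie.add_comm[OF Rep_env Rep_env, of a b] by (simp add: Rep_env_simps flip: Rep_env_inject)
  then show "0 + a = a"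
    using uea_lie.add_zero[OF Rep_env, of a] uea_lie.add_comm[OF Rep_env uea_lie.zero_closed, of a]
    by (simp add: Rep_env_simps flip: Rep_env_inject)
  show "a + b + c = a + (b + c)"
    using uea_lie.add_assoc[OF Rep_env Rep_env Rep_env, of a b c]
    by (simp add: Rep_env_simps flip: Rep_env_inject)
  show "- a + a = 0"
    using uea_lie.add_inverse[OF Rep_env, of a]
      uea_lie.add_comm[OF Rep_env uea_lie.smult_closed, OF Rep_env, of a "-1" a]
    by (simp add: Rep_env_simps flip: Rep_env_inject)
  show "a - b = a + - b"
    by (simp add: minus_env_def)
  show "a * b * c = a * (b * c)"
    by (simp add: Rep_env_simps uea_assoc Rep_env flip: Rep_env_inject)
  show "1 * a = a" "a * 1 = a"
    by (simp_all add: Rep_env_simps uea_one Rep_env flip: Rep_env_inject)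
  show "(a + b) * c = a * c + b * c" "a * (b + c) = a * b + a * c"
    by (simp_all add: Rep_env_simps uea_lie.mult_add_left uea_lie.mult_add_right Rep_env
        flip: Rep_env_inject)
  \<comment> \<open>The augmentation sends the two elements to 0 and 1 in the field.\<close>
  show "(0 :: 'a env) \<noteq> 1"
    using augmentation_simps(4,5)[of "lie_alg :: ('a, nat \<Rightarrow> 'a) module"]
    by (auto simp: Rep_env_simps simp flip: Rep_env_inject)
qed

end

definition env_scale :: "'k \<Rightarrow> 'k env \<Rightarrow> 'k::field env" where
  "env_scale c u = Abs_env (c \<odot>\<^bsub>uea lie_alg\<^esub> Rep_env u)"

definition inc :: "'k lie \<Rightarrow> 'k::field env" where
  "inc x = Abs_env (env_class (Gen (Some (emb x))))"

lemma Rep_env_simps2: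
  "Rep_env (env_scale c u) = c \<odot>\<^bsub>uea lie_alg\<^esub> Rep_env u"
  by (simp add: env_scale_def Abs_env_inverse Rep_env uea_lie.smult_closed)

lemma Rep_env_inc: "Rep_env (inc x) = env_class (Gen (Some (emb x)))"
  by (simp add: inc_def Abs_env_inverse uea_simps presented_algebra_simps)

interpretation env: type_algebra env_scale "(*) :: _ \<Rightarrow> _ \<Rightarrow> 'k::field env"
  by unfold_locales
    (simp_all add: ring_distribs, simp_all add: Rep_env_simps Rep_env_simps2 Rep_env
      uea_lie.smult_add uea_lie.add_smult uea_lie.smult_smult uea_lie.one_smult
      uea_lie.mult_smult_left uea_lie.mult_smult_right flip: Rep_env_inject)

lemma inc_simps:
  "inc (x + y) = inc x + inc y"
  "inc (lie_scale c x) = env_scale c (inc x)"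
  "inc (bracket x y) = inc x * inc y - inc y * inc x"
proof -
  have "(Gen (Some (emb (x + y))), Plus (Gen (Some (emb x))) (Gen (Some (emb y)))) \<in> uea_rels lie_alg"
    unfolding uea_rels_def linear_rels_def lie_alg_simps(3)[symmetric] by auto
  from uea_rels_class[OF this] show "inc (x + y) = inc x + inc y"
    by (simp add: Rep_env_simps Rep_env_inc uea_class_simps flip: Rep_env_inject)
  have "(Gen (Some (emb (lie_scale c x))), Scale c (Gen (Some (emb x)))) \<in> uea_rels lie_alg"
    unfolding uea_rels_def linear_rels_def lie_alg_simps(5)[symmetric] by auto
  from uea_rels_class[OF this] show "inc (lie_scale c x) = env_scale c (inc x)"
    by (simp add: Rep_env_simps2 Rep_env_inc uea_class_simps flip: Rep_env_inject)
  have "(Gen (Some (emb (bracket x y))), Plus (Times (Gen (Some (emb x))) (Gen (Some (emb y))))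
      (Scale (- 1) (Times (Gen (Some (emb y))) (Gen (Some (emb x)))))) \<in> uea_rels lie_alg"
    unfolding uea_rels_def lie_alg_simps(4)[symmetric] by auto
  from uea_rels_class[OF this] show "inc (bracket x y) = inc x * inc y - inc y * inc x"
    by (simp add: diff_conv_add_uminus Rep_env_simps Rep_env_inc uea_class_simps
        flip: Rep_env_inject del: add_uminus_conv_diff)
qed

lemma lie_map_inc: "lie_map env_scale (\<lambda>u v. u * v - v * u) inc"
  by unfold_locales (simp_all add: inc_simps)

lemma env_induct [case_names inc one zero add scale mult]:
  fixes u :: "'k::field env"
  assumes "\<And>x. P (inc x)" "P 1" "P 0" "\<And>u v. \<lbrakk>P u; P v\<rbrakk> \<Longrightarrow> P (u + v)"
    "\<And>c u. P u \<Longrightarrow> P (env_scale c u)" "\<And>u v. \<lbrakk>P u; P v\<rbrakk> \<Longrightarrow> P (u * v)"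
  shows "P u"
proof -
  have "\<exists>u. P u \<and> Rep_env u = env_class t" if "t \<in> terms (uea_gens lie_alg)" for t
    using that
  proof (induction t)
    case (Gen y)
    show ?case
    proof (cases y)
      case None
      then show ?thesis using assms(2) by (auto simp: Rep_env_simps uea_simps)
    next
      case (Some z)
      then show ?thesis using Gen assms(1) Rep_env_inc by auto
    qed
  next
    case Zero
    show ?case using assms(3) by (auto simp: Rep_env_simps uea_simps presented_algebra_simps)
  next
    case (Plus s t)
    then obtain u v where "P u" "P v" "Rep_env u = env_class s" "Rep_env v = env_class t" by auto
    then show ?case
      using assms(4) Plus.prems by (intro exI[of _ "u + v"]) (auto simp: Rep_env_simps uea_class_simps)
  next
    case (Scale c t)
    then obtain u where "P u" "Rep_env u = env_class t" by auto
    then show ?case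
      using assms(5) Scale.prems
      by (intro exI[of _ "env_scale c u"]) (auto simp: Rep_env_simps2 uea_class_simps)
  next
    case (Times s t)
    then obtain u v where "P u" "P v" "Rep_env u = env_class s" "Rep_env v = env_class t" by auto
    then show ?case
      using assms(6) Times.prems by (intro exI[of _ "u * v"]) (auto simp: Rep_env_simps uea_class_simps)
  qed
  then show ?thesis
    by (metis uea_cases Rep_env Rep_env_inject)
qed

text \<open>Universal property of the enveloping algebra: a Lie map into the commutator algebra of
  an associative algebra with unit \<open>e\<close> extends to U(L). The generator
  \<open>None\<close> goes to \<open>e\<close>, and the assumptions on \<open>m\<close> and
  \<open>e\<close> are exactly what the relations of \<open>uea_rels\<close> other than those on
  elements of L demand.\<close>

lemma (in type_algebra) env_lift:
  fixes f :: "'k lie \<Rightarrow> 'a"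
  assumes assoc: "\<And>x y z. m (m x y) z = m x (m y z)" and one: "\<And>x. m e x = x" "\<And>x. m x e = x"
    and f: "lie_map s (\<lambda>x y. m x y - m y x) f"
  obtains h where "\<And>u v. h (u + v) = h u + h v" "\<And>c u. h (env_scale c u) = s c (h u)"
    "\<And>u v. h (u * v) = m (h u) (h v)" "h 1 = e" "\<And>x. h (inc x) = f x"
proof
  interpret R: bilinear_algebra rec by (rule bilinear_algebra_rec)
  interpret f: lie_map s "\<lambda>x y. m x y - m y x" f by (rule f)
  define g where "g = case_option e (\<lambda>x. f (the_inv emb x))"
  have g: "g x \<in> carrier rec" for x by simp
  have E: "term_eval rec g t = term_eval rec g t'"
    if "(t, t') \<in> uea_rels lie_alg" for t t'
    using that
    by (auto simp: uea_rels_def linear_rels_def assoc one g_def f.map_add f.map_scale f.map_bracket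
        s_uminus_one)
  interpret F: algebra_hom "presented_algebra (uea_gens lie_alg) (uea_rels lie_alg)" rec "induced_hom rec g"
    by (rule R.algebra_hom_induced[OF g E])
  let ?h = "\<lambda>u. induced_hom rec g (Rep_env u)"
  show "?h (u + v) = ?h u + ?h v" "?h (env_scale c u) = s c (?h u)" "?h (u * v) = m (?h u) (?h v)"
    for u v c
    using Rep_env[of u] Rep_env[of v]
    by (auto simp: Rep_env_simps Rep_env_simps2 uea_simps F.hom_add F.hom_smult F.hom_mult)
  note classes = R.induced_hom_class[OF g E, where X = "uea_gens lie_alg"]
  show "?h 1 = e"
    using classes[where t = "Gen None"] by (simp add: Rep_env_simps uea_simps g_def)
  show "?h (inc x) = f x" for x
    using classes[where t = "Gen (Some (emb x))"] by (simp add: Rep_env_inc g_def)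
qed

definition counit :: "'k::field env \<Rightarrow> 'k" where
  "counit u = augmentation (Rep_env u)"

lemma counit_simps [simp]:
  "counit (u + v) = counit u + counit v" "counit (u * v) = counit u * counit v"
  "counit (env_scale c u) = c * counit u" "counit 1 = 1" "counit 0 = 0" "counit (inc x) = 0"
  using Rep_env[of u] Rep_env[of v]
  by (simp_all add: counit_def Rep_env_simps Rep_env_simps2 augmentation_simps Rep_env_inc
      augmentation_class)


section \<open>Infinite-dimensional quotients\<close>

lemma abelian_subgroup_subspace:
  assumes V: "vectorspace (class_ring :: 'k::field ring) V" and W: "subspace class_ring W V"
  shows "abelian_subgroup W V"
proof -
  interpret vectorspace "class_ring :: 'k ring" V by (rule V)
  interpret W: submodule "class_ring :: 'k ring" W V
    using W by (simp add: subspace_def)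
  have "\<ominus>\<^bsub>V\<^esub> x \<in> W" if "x \<in> W" for x
  proof -
    have "x \<in> carrier V" using that W.subset by auto
    then have "\<ominus>\<^bsub>V\<^esub> x = (- 1) \<odot>\<^bsub>V\<^esub> x"
      using smult_l_minus[of 1 x] smult_one[of x] by (simp add: class_ring_simps)
    then show ?thesis using that by simp
  qed
  moreover have "W \<noteq> {}" using W.zero_closed by blast
  ultimately have "subgroup W (add_monoid V)"
    using W.subset by (intro add.subgroupI) (auto simp: a_inv_def[symmetric])
  then show ?thesis
    by (intro abelian_subgroupI3 additive_subgroupI) (auto intro: abelian_group_axioms)
qed

lemma coset_eq_iff:
  assumes V: "vectorspace (class_ring :: 'k::field ring) V" and W: "subspace class_ring W V"
    and "v \<in> carrier V" "w \<in> carrier V"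
  shows "W +>\<^bsub>V\<^esub> v = W +>\<^bsub>V\<^esub> w \<longleftrightarrow> v \<ominus>\<^bsub>V\<^esub> w \<in> W"
proof -
  interpret abelian_subgroup W V by (rule abelian_subgroup_subspace[OF V W])
  show ?thesis
  proof
    assume "W +>\<^bsub>V\<^esub> v = W +>\<^bsub>V\<^esub> w"
    then have "v \<in> W +>\<^bsub>V\<^esub> w" using a_rcos_self assms by blast
    then obtain x where "x \<in> W" "v = x \<oplus>\<^bsub>V\<^esub> w" by (auto simp: a_r_coset_def')
    then show "v \<ominus>\<^bsub>V\<^esub> w \<in> W"
      using assms a_subset by (auto simp: a_minus_def a_assoc r_neg)
  next
    assume "v \<ominus>\<^bsub>V\<^esub> w \<in> W"
    moreover have "v = (v \<ominus>\<^bsub>V\<^esub> w) \<oplus>\<^bsub>V\<^esub> w"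
      using assms by (simp add: a_minus_def a_assoc l_neg)
    ultimately have "v \<in> W +>\<^bsub>V\<^esub> w" unfolding a_r_coset_def' by blast
    then show "W +>\<^bsub>V\<^esub> v = W +>\<^bsub>V\<^esub> w"
      using a_repr_independence[of v W w] assms a_subgroup by simp
  qed
qed

lemma quotient_space_simps:
  assumes V: "vectorspace (class_ring :: 'k::field ring) V" and W: "subspace class_ring W V"
  shows "carrier (quotient_space V W) = (\<lambda>v. W +>\<^bsub>V\<^esub> v) ` carrier V"
    and "\<zero>\<^bsub>quotient_space V W\<^esub> = W +>\<^bsub>V\<^esub> \<zero>\<^bsub>V\<^esub>"
    and "\<lbrakk>v \<in> carrier V; w \<in> carrier V\<rbrakk>
      \<Longrightarrow> (W +>\<^bsub>V\<^esub> v) \<oplus>\<^bsub>quotient_space V W\<^esub> (W +>\<^bsub>V\<^esub> w) = W +>\<^bsub>V\<^esub> (v \<oplus>\<^bsub>V\<^esub> w)"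
    and "v \<in> carrier V \<Longrightarrow> c \<odot>\<^bsub>quotient_space V W\<^esub> (W +>\<^bsub>V\<^esub> v) = W +>\<^bsub>V\<^esub> (c \<odot>\<^bsub>V\<^esub> v)"
proof -
  interpret V: vectorspace "class_ring :: 'k ring" V by (rule V)
  interpret S: abelian_subgroup W V by (rule abelian_subgroup_subspace[OF V W])
  interpret W: submodule "class_ring :: 'k ring" W V
    using W by (simp add: subspace_def)
  show "carrier (quotient_space V W) = (\<lambda>v. W +>\<^bsub>V\<^esub> v) ` carrier V"
    by (auto simp: quotient_space_def A_RCOSETS_def')
  show "\<zero>\<^bsub>quotient_space V W\<^esub> = W +>\<^bsub>V\<^esub> \<zero>\<^bsub>V\<^esub>"
    using V.a_coset_join2[of "\<zero>\<^bsub>V\<^esub>" W] S.a_subgroup by (simp add: quotient_space_def)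
  show "\<lbrakk>v \<in> carrier V; w \<in> carrier V\<rbrakk>
      \<Longrightarrow> (W +>\<^bsub>V\<^esub> v) \<oplus>\<^bsub>quotient_space V W\<^esub> (W +>\<^bsub>V\<^esub> w) = W +>\<^bsub>V\<^esub> (v \<oplus>\<^bsub>V\<^esub> w)"
    by (simp add: quotient_space_def S.a_rcos_sum)
  show "c \<odot>\<^bsub>quotient_space V W\<^esub> (W +>\<^bsub>V\<^esub> v) = W +>\<^bsub>V\<^esub> (c \<odot>\<^bsub>V\<^esub> v)" if v: "v \<in> carrier V"
  proof -
    have "W +>\<^bsub>V\<^esub> (c \<odot>\<^bsub>V\<^esub> u) = W +>\<^bsub>V\<^esub> (c \<odot>\<^bsub>V\<^esub> v)" if u: "u \<in> W +>\<^bsub>V\<^esub> v" for u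
    proof -
      obtain w where w: "w \<in> W" "u = w \<oplus>\<^bsub>V\<^esub> v" using u by (auto simp: a_r_coset_def')
      then have "w \<in> carrier V" using W.subset by auto
      then have "c \<odot>\<^bsub>V\<^esub> u \<ominus>\<^bsub>V\<^esub> c \<odot>\<^bsub>V\<^esub> v = c \<odot>\<^bsub>V\<^esub> w"
        using v w by (simp add: V.smult_r_distr a_minus_def V.a_assoc V.r_neg)
      then show ?thesis
        using w v \<open>w \<in> carrier V\<close> by (subst coset_eq_iff[OF V W]) auto
    qed
    moreover have "v \<in> W +>\<^bsub>V\<^esub> v" using v by (rule S.a_rcos_self)
    ultimately have "(\<Union>u\<in>W +>\<^bsub>V\<^esub> v. W +>\<^bsub>V\<^esub> (c \<odot>\<^bsub>V\<^esub> u)) = W +>\<^bsub>V\<^esub> (c \<odot>\<^bsub>V\<^esub> v)"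
      by blast
    then show ?thesis by (simp add: quotient_space_def)
  qed
qed

lemma vectorspace_quotient_space:
  assumes V: "vectorspace (class_ring :: 'k::field ring) V" and W: "subspace class_ring W V"
  shows "vectorspace class_ring (quotient_space V W)"
proof -
  interpret V: vectorspace "class_ring :: 'k ring" V by (rule V)
  note simps = quotient_space_simps[OF V W]
  have ab: "abelian_group (quotient_space V W)"
  proof (rule abelian_groupI)
    fix x assume "x \<in> carrier (quotient_space V W)"
    then obtain v where "v \<in> carrier V" "x = W +>\<^bsub>V\<^esub> v" unfolding simps by blast
    then show "\<exists>y\<in>carrier (quotient_space V W). y \<oplus>\<^bsub>quotient_space V W\<^esub> x = \<zero>\<^bsub>quotient_space V W\<^esub>"
      by (intro bexI[of _ "W +>\<^bsub>V\<^esub> (\<ominus>\<^bsub>V\<^esub> v)"]) (simp_all add: simps V.l_neg)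
  qed (unfold simps(1); (elim imageE)?; simp add: simps V.a_ac imageI)+
  have "module (class_ring :: 'k ring) (quotient_space V W)"
    by (rule moduleI; (unfold simps(1))?; (elim imageE)?; simp add: simps ab class_cring.is_cring
        V.smult_l_distr[simplified] V.smult_r_distr V.smult_assoc1[simplified]
        V.smult_one[simplified] imageI)
  then show ?thesis
    by (simp add: vectorspace_def class_field)
qed

text \<open>The functionals \<open>F n\<close> vanish on \<open>W\<close> and hence descend to the
  quotient, where they are dual to the cosets of the vectors \<open>e n\<close>. Those cosets are
  therefore distinct and linearly independent.\<close>

lemma not_fin_dim_quotient_space:
  assumes V: "vectorspace (class_ring :: 'k::field ring) V" and W: "subspace class_ring W V"
    and F_add: "\<And>(n :: nat) x y. \<lbrakk>x \<in> carrier V; y \<in> carrier V\<rbrakk> \<Longrightarrow> F n (x \<oplus>\<^bsub>V\<^esub> y) = F n x + F n y"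
    and F_smult: "\<And>n c x. x \<in> carrier V \<Longrightarrow> F n (c \<odot>\<^bsub>V\<^esub> x) = c * F n x"
    and F_W: "\<And>n x. x \<in> W \<Longrightarrow> F n x = 0"
    and e: "\<And>n. e n \<in> carrier V" "\<And>m n. F n (e m) = of_bool (m = n)"
  shows "\<not> vectorspace.fin_dim class_ring (quotient_space V W)"
proof
  interpret V: vectorspace "class_ring :: 'k ring" V by (rule V)
  interpret Q: vectorspace "class_ring :: 'k ring" "quotient_space V W"
    by (rule vectorspace_quotient_space[OF V W])
  note simps = quotient_space_simps[OF V W]
  \<comment> \<open>The functional on the quotient is read off at a chosen representative;
    \<open>F_W\<close> makes the choice immaterial.\<close>
  define G where "G n S = F n (SOME v. v \<in> carrier V \<and> S = W +>\<^bsub>V\<^esub> v)" for n :: nat and S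
  have G: "G n (W +>\<^bsub>V\<^esub> v) = F n v" if v: "v \<in> carrier V" for n v
  proof -
    let ?u = "SOME u. u \<in> carrier V \<and> W +>\<^bsub>V\<^esub> v = W +>\<^bsub>V\<^esub> u"
    have u: "?u \<in> carrier V \<and> W +>\<^bsub>V\<^esub> v = W +>\<^bsub>V\<^esub> ?u"
      by (rule someI[of _ v]) (use v in simp)
    then have "v \<ominus>\<^bsub>V\<^esub> ?u \<in> W"
      using coset_eq_iff[OF V W v, of ?u] by blast
    then have "F n (v \<ominus>\<^bsub>V\<^esub> ?u) = 0" by (rule F_W)
    moreover have "v = (v \<ominus>\<^bsub>V\<^esub> ?u) \<oplus>\<^bsub>V\<^esub> ?u"
      using v u by (simp add: a_minus_def V.a_assoc V.l_neg)
    ultimately have "F n v = F n ?u"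
      using F_add[of "v \<ominus>\<^bsub>V\<^esub> ?u" ?u n] v u by simp
    then show ?thesis by (simp add: G_def)
  qed
  have G_lincomb: "G n (Q.lincomb a A) = (\<Sum>S\<in>A. a S * G n S)"
    if "finite A" "A \<subseteq> carrier (quotient_space V W)" for a A n
    using that
  proof induction
    case empty
    then show ?case using F_smult[of "\<zero>\<^bsub>V\<^esub>" n 0] by (simp add: Q.lincomb_def simps(2) G)
  next
    case (insert S A)
    then obtain v where v: "v \<in> carrier V" "S = W +>\<^bsub>V\<^esub> v" by (auto simp: simps)
    have "Q.lincomb a A \<in> carrier (quotient_space V W)"
      using insert by (intro Q.lincomb_closed) auto
    then obtain w where w: "w \<in> carrier V" "Q.lincomb a A = W +>\<^bsub>V\<^esub> w" by (auto simp: simps)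
    have "Q.lincomb a (insert S A) = a S \<odot>\<^bsub>quotient_space V W\<^esub> S \<oplus>\<^bsub>quotient_space V W\<^esub> Q.lincomb a A"
      unfolding Q.lincomb_def using insert by (subst Q.finsum_insert) auto
    then have "Q.lincomb a (insert S A) = W +>\<^bsub>V\<^esub> (a S \<odot>\<^bsub>V\<^esub> v \<oplus>\<^bsub>V\<^esub> w)"
      using v w by (simp add: simps)
    then have "G n (Q.lincomb a (insert S A)) = a S * G n S + G n (Q.lincomb a A)"
      using v w by (simp add: G F_add F_smult)
    then show ?case using insert by simp
  qed
  define b where "b n = W +>\<^bsub>V\<^esub> e n" for n
  have b: "b n \<in> carrier (quotient_space V W)" "G m (b n) = of_bool (n = m)" for m n
    using e by (auto simp: b_def simps(1) G)
  have "inj b"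
    by (rule injI) (metis b(2) of_bool_eq_iff)
  then have "infinite (range b)" by (simp add: finite_image_iff)
  moreover have "Q.lin_indpt (range b)"
  proof
    assume "Q.lin_dep (range b)"
    then obtain A a v where A: "finite A" "A \<subseteq> range b" "Q.lincomb a A = \<zero>\<^bsub>quotient_space V W\<^esub>"
      and v: "v \<in> A" "a v \<noteq> 0"
      unfolding Q.lin_dep_def by auto
    obtain n where n: "v = b n" using v A by auto
    \<comment> \<open>By duality \<open>G n\<close> isolates the coefficient of
      \<open>v = b n\<close> in the vanishing combination.\<close>
    have "(\<Sum>S\<in>A. a S * G n S) = (\<Sum>S\<in>{v}. a S * G n S)"
      using A v by (intro sum.mono_neutral_right) (auto simp: b n)
    then have "G n \<zero>\<^bsub>quotient_space V W\<^esub> = a v"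
      using G_lincomb[of A n a] A b by (auto simp: n)
    moreover have "G n \<zero>\<^bsub>quotient_space V W\<^esub> = 0"
      using F_smult[of "\<zero>\<^bsub>V\<^esub>" n 0] by (simp add: simps(2) G)
    ultimately show False using v by simp
  qed
  moreover assume "Q.fin_dim"
  ultimately show False
    using Q.fin_dim_li_fin b by blast
qed


section \<open>Left modules\<close>

locale left_module =
  fixes R :: "('k, 'r) module" and M :: "('r, 'm) module"
  assumes ring: "ring R" and abelian_group: "abelian_group M"
    and smult_closed: "\<lbrakk>r \<in> carrier R; x \<in> carrier M\<rbrakk> \<Longrightarrow> r \<odot>\<^bsub>M\<^esub> x \<in> carrier M"
    and smult_l_distr: "\<lbrakk>r \<in> carrier R; s \<in> carrier R; x \<in> carrier M\<rbrakk>
      \<Longrightarrow> (r \<oplus>\<^bsub>R\<^esub> s) \<odot>\<^bsub>M\<^esub> x = r \<odot>\<^bsub>M\<^esub> x \<oplus>\<^bsub>M\<^esub> s \<odot>\<^bsub>M\<^esub> x"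
    and smult_r_distr: "\<lbrakk>r \<in> carrier R; x \<in> carrier M; y \<in> carrier M\<rbrakk>
      \<Longrightarrow> r \<odot>\<^bsub>M\<^esub> (x \<oplus>\<^bsub>M\<^esub> y) = r \<odot>\<^bsub>M\<^esub> x \<oplus>\<^bsub>M\<^esub> r \<odot>\<^bsub>M\<^esub> y"
    and smult_assoc: "\<lbrakk>r \<in> carrier R; s \<in> carrier R; x \<in> carrier M\<rbrakk>
      \<Longrightarrow> (r \<otimes>\<^bsub>R\<^esub> s) \<odot>\<^bsub>M\<^esub> x = r \<odot>\<^bsub>M\<^esub> (s \<odot>\<^bsub>M\<^esub> x)"
    and smult_one: "x \<in> carrier M \<Longrightarrow> \<one>\<^bsub>R\<^esub> \<odot>\<^bsub>M\<^esub> x = x"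
begin

sublocale R: ring R by (rule ring)
sublocale M: abelian_group M by (rule abelian_group)

lemma zero_smult: "x \<in> carrier M \<Longrightarrow> \<zero>\<^bsub>R\<^esub> \<odot>\<^bsub>M\<^esub> x = \<zero>\<^bsub>M\<^esub>"
  using smult_l_distr[of "\<zero>\<^bsub>R\<^esub>" "\<zero>\<^bsub>R\<^esub>" x] smult_closed[of "\<zero>\<^bsub>R\<^esub>" x]
  by (metis M.add.l_cancel_one' R.l_zero R.zero_closed)

lemma smult_zero: "r \<in> carrier R \<Longrightarrow> r \<odot>\<^bsub>M\<^esub> \<zero>\<^bsub>M\<^esub> = \<zero>\<^bsub>M\<^esub>"
  using smult_r_distr[of r "\<zero>\<^bsub>M\<^esub>" "\<zero>\<^bsub>M\<^esub>"] smult_closed[of r "\<zero>\<^bsub>M\<^esub>"]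
  by (metis M.add.l_cancel_one' M.l_zero M.zero_closed)

lemma smult_finsum:
  "\<lbrakk>finite S; r \<in> carrier R; g \<in> S \<rightarrow> carrier M\<rbrakk>
    \<Longrightarrow> r \<odot>\<^bsub>M\<^esub> finsum M g S = (\<Oplus>\<^bsub>M\<^esub>x\<in>S. r \<odot>\<^bsub>M\<^esub> g x)"
proof (induction rule: finite_induct)
  case empty
  then show ?case by (simp add: smult_zero)
next
  case (insert x S)
  then have "g \<in> S \<rightarrow> carrier M" "g x \<in> carrier M" by auto
  then show ?case
    using insert by (simp add: smult_r_distr smult_closed M.finsum_closed Pi_def)
qed

text \<open>Different elements of a free module have different supports. Summing over any finite set
  that contains the support lets several evaluations be compared term by term.\<close>

lemma free_eval_eq:
  assumes "finite S" "{x. f x \<noteq> \<zero>\<^bsub>R\<^esub>} \<subseteq> S" "S \<subseteq> carrier M" "\<And>x. x \<in> S \<Longrightarrow> f x \<in> carrier R"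
  shows "free_eval R M f = (\<Oplus>\<^bsub>M\<^esub>x\<in>S. f x \<odot>\<^bsub>M\<^esub> x)"
  unfolding free_eval_def
  using assms by (intro M.add.finprod_mono_neutral_cong_left)
    (auto simp: zero_smult subset_iff intro!: smult_closed)

end

lemma left_module_free:
  fixes X :: "'x set"
  assumes "ring R" shows "left_module R (free_module R X)"
proof -
  interpret ring R by (rule assms)
  have supp: "finite {x. f x \<oplus>\<^bsub>R\<^esub> g x \<noteq> \<zero>\<^bsub>R\<^esub>}"
    if "finite {x. f x \<noteq> \<zero>\<^bsub>R\<^esub>}" "finite {x. g x \<noteq> \<zero>\<^bsub>R\<^esub>}" for f g :: "'x \<Rightarrow> _"
    by (rule finite_subset[OF _ finite_UnI[OF that]]) auto
  have supp2: "finite {x. r \<otimes>\<^bsub>R\<^esub> f x \<noteq> \<zero>\<^bsub>R\<^esub>}"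
    if "finite {x. f x \<noteq> \<zero>\<^bsub>R\<^esub>}" "r \<in> carrier R" for r and f :: "'x \<Rightarrow> _"
    by (rule finite_subset[OF _ that(1)]) (use that in auto)
  have closed: "f x \<in> carrier R" if "f \<in> carrier (free_module R X)" for f x
    using that by (cases "x \<in> X") (auto simp: free_module_def)
  have "abelian_group (free_module R X)"
  proof (rule abelian_groupI)
    fix f assume f: "f \<in> carrier (free_module R X)"
    have "{x. \<ominus>\<^bsub>R\<^esub> f x \<noteq> \<zero>\<^bsub>R\<^esub>} = {x. f x \<noteq> \<zero>\<^bsub>R\<^esub>}"
      using closed[OF f] by auto
    then have "(\<lambda>x. \<ominus>\<^bsub>R\<^esub> f x) \<in> carrier (free_module R X)"
      using f by (auto simp: free_module_def)
    moreover have "(\<lambda>x. \<ominus>\<^bsub>R\<^esub> f x \<oplus>\<^bsub>R\<^esub> f x) = (\<lambda>x. \<zero>\<^bsub>R\<^esub>)"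
      using closed[OF f] by (auto simp: l_neg)
    ultimately show "\<exists>g\<in>carrier (free_module R X). g \<oplus>\<^bsub>free_module R X\<^esub> f = \<zero>\<^bsub>free_module R X\<^esub>"
      by (intro bexI[of _ "\<lambda>x. \<ominus>\<^bsub>R\<^esub> f x"]) (auto simp: free_module_def)
  next
    fix f g h
    assume "f \<in> carrier (free_module R X)" "g \<in> carrier (free_module R X)"
      "h \<in> carrier (free_module R X)"
    then show "f \<oplus>\<^bsub>free_module R X\<^esub> g \<oplus>\<^bsub>free_module R X\<^esub> h
        = f \<oplus>\<^bsub>free_module R X\<^esub> (g \<oplus>\<^bsub>free_module R X\<^esub> h)"
      using closed[of f] closed[of g] closed[of h] by (simp add: free_module_def a_assoc)
  next
    fix f g
    assume fg: "f \<in> carrier (free_module R X)" "g \<in> carrier (free_module R X)"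
    then show "f \<oplus>\<^bsub>free_module R X\<^esub> g = g \<oplus>\<^bsub>free_module R X\<^esub> f"
      using closed[of f] closed[of g] by (simp add: free_module_def a_comm)
    show "f \<oplus>\<^bsub>free_module R X\<^esub> g \<in> carrier (free_module R X)"
      using fg by (auto simp: free_module_def supp)
  next
    fix f assume "f \<in> carrier (free_module R X)"
    then show "\<zero>\<^bsub>free_module R X\<^esub> \<oplus>\<^bsub>free_module R X\<^esub> f = f"
      using closed[of f] by (simp add: free_module_def)
  qed (auto simp: free_module_def)
  then show ?thesis
  proof (intro left_module.intro assms)
    fix r f assume "r \<in> carrier R" "f \<in> carrier (free_module R X)"
    then show "r \<odot>\<^bsub>free_module R X\<^esub> f \<in> carrier (free_module R X)"
      by (auto simp: free_module_def supp2)
  next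
    fix r s f assume "r \<in> carrier R" "s \<in> carrier R" "f \<in> carrier (free_module R X)"
    then show "(r \<oplus>\<^bsub>R\<^esub> s) \<odot>\<^bsub>free_module R X\<^esub> f
        = r \<odot>\<^bsub>free_module R X\<^esub> f \<oplus>\<^bsub>free_module R X\<^esub> s \<odot>\<^bsub>free_module R X\<^esub> f"
      "(r \<otimes>\<^bsub>R\<^esub> s) \<odot>\<^bsub>free_module R X\<^esub> f = r \<odot>\<^bsub>free_module R X\<^esub> (s \<odot>\<^bsub>free_module R X\<^esub> f)"
      using closed[of f] by (simp_all add: free_module_def l_distr m_assoc)
  next
    fix r f g
    assume "r \<in> carrier R" "f \<in> carrier (free_module R X)" "g \<in> carrier (free_module R X)"
    then show "r \<odot>\<^bsub>free_module R X\<^esub> (f \<oplus>\<^bsub>free_module R X\<^esub> g)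
        = r \<odot>\<^bsub>free_module R X\<^esub> f \<oplus>\<^bsub>free_module R X\<^esub> r \<odot>\<^bsub>free_module R X\<^esub> g"
      using closed[of f] closed[of g] by (simp add: free_module_def r_distr)
  next
    fix f assume "f \<in> carrier (free_module R X)"
    then show "\<one>\<^bsub>R\<^esub> \<odot>\<^bsub>free_module R X\<^esub> f = f"
      using closed[of f] by (simp add: free_module_def)
  qed
qed

lemma free_module_closed:
  assumes "ring R" "f \<in> carrier (free_module R X)" shows "f x \<in> carrier R"
proof -
  interpret ring R by fact
  show ?thesis using assms(2) by (cases "x \<in> X") (auto simp: free_module_def)
qed

lemma (in left_module) free_eval_hom:
  assumes X: "X \<subseteq> carrier M"
  shows "free_eval R M \<in> LinearCombinations.module_hom R (free_module R X) M"
proof -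
  have closed: "f x \<in> carrier R" if "f \<in> carrier (free_module R X)" for f x
    by (rule free_module_closed[OF ring that])
  have supp: "{x. f x \<noteq> \<zero>\<^bsub>R\<^esub>} \<subseteq> X" "finite {x. f x \<noteq> \<zero>\<^bsub>R\<^esub>}"
    if "f \<in> carrier (free_module R X)" for f
    using that by (auto simp: free_module_def)
  have eq: "free_eval R M f = (\<Oplus>\<^bsub>M\<^esub>x\<in>S. f x \<odot>\<^bsub>M\<^esub> x)"
    if "\<And>x. f x \<in> carrier R" "finite S" "{x. f x \<noteq> \<zero>\<^bsub>R\<^esub>} \<subseteq> S" "S \<subseteq> X" for f S
    using that X by (intro free_eval_eq) auto
  show ?thesis
    unfolding LinearCombinations.module_hom_def
  proof (intro CollectI conjI allI impI)
    show "free_eval R M \<in> carrier (free_module R X) \<rightarrow> carrier M"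
    proof
      fix f assume f: "f \<in> carrier (free_module R X)"
      show "free_eval R M f \<in> carrier M"
        unfolding free_eval_def using supp[OF f] X closed[OF f]
        by (intro M.finsum_closed) (auto intro!: smult_closed)
    qed
  next
    fix f g assume "f \<in> carrier (free_module R X) \<and> g \<in> carrier (free_module R X)"
    then have f: "f \<in> carrier (free_module R X)" and g: "g \<in> carrier (free_module R X)" by auto
    define S where "S = {x. f x \<noteq> \<zero>\<^bsub>R\<^esub>} \<union> {x. g x \<noteq> \<zero>\<^bsub>R\<^esub>}"
    have S: "finite S" "S \<subseteq> X" using supp[OF f] supp[OF g] by (auto simp: S_def)
    have "free_eval R M (f \<oplus>\<^bsub>free_module R X\<^esub> g) = (\<Oplus>\<^bsub>M\<^esub>x\<in>S. (f x \<oplus>\<^bsub>R\<^esub> g x) \<odot>\<^bsub>M\<^esub> x)"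
    proof -
      have "{x. f x \<oplus>\<^bsub>R\<^esub> g x \<noteq> \<zero>\<^bsub>R\<^esub>} \<subseteq> S" by (auto simp: S_def)
      then show ?thesis
        using S closed[OF f] closed[OF g] eq[of "\<lambda>x. f x \<oplus>\<^bsub>R\<^esub> g x" S]
        by (simp add: free_module_def)
    qed
    also have "\<dots> = (\<Oplus>\<^bsub>M\<^esub>x\<in>S. f x \<odot>\<^bsub>M\<^esub> x \<oplus>\<^bsub>M\<^esub> g x \<odot>\<^bsub>M\<^esub> x)"
      using S X closed[OF f] closed[OF g]
      by (intro M.add.finprod_cong') (auto simp: smult_l_distr intro!: M.a_closed smult_closed)
    also have "\<dots> = (\<Oplus>\<^bsub>M\<^esub>x\<in>S. f x \<odot>\<^bsub>M\<^esub> x) \<oplus>\<^bsub>M\<^esub> (\<Oplus>\<^bsub>M\<^esub>x\<in>S. g x \<odot>\<^bsub>M\<^esub> x)"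
      using S X closed[OF f] closed[OF g] by (intro M.finsum_addf) (auto intro!: smult_closed)
    also have "\<dots> = free_eval R M f \<oplus>\<^bsub>M\<^esub> free_eval R M g"
      using S closed[OF f] closed[OF g] by (simp add: eq[of _ S] S_def)
    finally show "free_eval R M (f \<oplus>\<^bsub>free_module R X\<^esub> g) = free_eval R M f \<oplus>\<^bsub>M\<^esub> free_eval R M g" .
  next
    fix r f assume "r \<in> carrier R \<and> f \<in> carrier (free_module R X)"
    then have r: "r \<in> carrier R" and f: "f \<in> carrier (free_module R X)" by auto
    define S where "S = {x. f x \<noteq> \<zero>\<^bsub>R\<^esub>}"
    have S: "finite S" "S \<subseteq> X" using supp[OF f] by (auto simp: S_def)
    have "free_eval R M (r \<odot>\<^bsub>free_module R X\<^esub> f) = (\<Oplus>\<^bsub>M\<^esub>x\<in>S. (r \<otimes>\<^bsub>R\<^esub> f x) \<odot>\<^bsub>M\<^esub> x)"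
    proof -
      have "{x. r \<otimes>\<^bsub>R\<^esub> f x \<noteq> \<zero>\<^bsub>R\<^esub>} \<subseteq> S" using r by (auto simp: S_def)
      then show ?thesis
        using S r closed[OF f] eq[of "\<lambda>x. r \<otimes>\<^bsub>R\<^esub> f x" S] by (simp add: free_module_def)
    qed
    also have "\<dots> = (\<Oplus>\<^bsub>M\<^esub>x\<in>S. r \<odot>\<^bsub>M\<^esub> (f x \<odot>\<^bsub>M\<^esub> x))"
      using S X r closed[OF f]
      by (intro M.add.finprod_cong') (auto simp: smult_assoc intro!: smult_closed)
    also have "\<dots> = r \<odot>\<^bsub>M\<^esub> free_eval R M f"
      unfolding free_eval_def S_def[symmetric]
      using S X r closed[OF f] by (intro smult_finsum[symmetric]) (auto intro!: smult_closed)
    finally show "free_eval R M (r \<odot>\<^bsub>free_module R X\<^esub> f) = r \<odot>\<^bsub>M\<^esub> free_eval R M f" .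
  qed
qed


lemma module_hom_zero:
  assumes "left_module R M" "left_module R N" "h \<in> LinearCombinations.module_hom R M N"
  shows "h \<zero>\<^bsub>M\<^esub> = \<zero>\<^bsub>N\<^esub>"
proof -
  interpret M: left_module R M by fact
  interpret N: left_module R N by fact
  have "h (\<zero>\<^bsub>R\<^esub> \<odot>\<^bsub>M\<^esub> \<zero>\<^bsub>M\<^esub>) = \<zero>\<^bsub>R\<^esub> \<odot>\<^bsub>N\<^esub> h \<zero>\<^bsub>M\<^esub>"
    using LinearCombinations.module_hom_smult[OF assms(3)] by simp
  moreover have "h \<zero>\<^bsub>M\<^esub> \<in> carrier N"
    using LinearCombinations.module_hom_closed[OF assms(3)] by auto
  ultimately show ?thesis by (simp add: M.zero_smult N.zero_smult)
qed

lemma module_hom_finsum: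
  assumes "left_module R M" "left_module R N" "h \<in> LinearCombinations.module_hom R M N"
    and "finite S" "g \<in> S \<rightarrow> carrier M"
  shows "h (finsum M g S) = (\<Oplus>\<^bsub>N\<^esub>x\<in>S. h (g x))"
proof -
  interpret M: left_module R M by fact
  interpret N: left_module R N by fact
  have closed: "h x \<in> carrier N" if "x \<in> carrier M" for x
    using LinearCombinations.module_hom_closed[OF assms(3)] that by auto
  show ?thesis
    using assms(4,5)
  proof induction
    case empty
    then show ?case by (simp add: module_hom_zero[OF assms(1-3)])
  next
    case (insert x S)
    then have "g x \<in> carrier M" "g \<in> S \<rightarrow> carrier M" by auto
    then show ?case
      using insert closed
      by (simp add: LinearCombinations.module_hom_add[OF assms(3)] Pi_def)
  qed
qed

text \<open>The basis vectors of the outer free module are themselves elements of the kernel.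
  Evaluating \<open>y\<close> once gives a linear combination of them, which the linear map
  \<open>free_eval R A\<close> kills term by term. This is the vanishing of composites in the
  canonical resolution.\<close>

lemma free_eval_kernel:
  assumes A: "left_module R A" and X: "X \<subseteq> carrier A"
    and y: "y \<in> carrier (free_module R {f \<in> carrier (free_module R X). free_eval R A f = \<zero>\<^bsub>A\<^esub>})"
  shows "free_eval R A (free_eval R (free_module R X) y) = \<zero>\<^bsub>A\<^esub>"
proof -
  interpret A: left_module R A by fact
  interpret F: left_module R "free_module R X" by (rule left_module_free[OF A.ring])
  define S where "S = {f. y f \<noteq> \<zero>\<^bsub>R\<^esub>}"
  have S: "finite S" "S \<subseteq> {f \<in> carrier (free_module R X). free_eval R A f = \<zero>\<^bsub>A\<^esub>}"
    using y by (auto simp: S_def free_module_def)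
  have yc: "y f \<in> carrier R" for f by (rule free_module_closed[OF A.ring y])
  note hom = A.free_eval_hom[OF X]
  have "free_eval R A (free_eval R (free_module R X) y)
      = (\<Oplus>\<^bsub>A\<^esub>f\<in>S. free_eval R A (y f \<odot>\<^bsub>free_module R X\<^esub> f))"
    unfolding free_eval_def[of R "free_module R X"] S_def[symmetric]
    using S yc by (intro module_hom_finsum[OF F.left_module_axioms A hom]) (auto intro!: F.smult_closed)
  also have "\<dots> = (\<Oplus>\<^bsub>A\<^esub>f\<in>S. \<zero>\<^bsub>A\<^esub>)"
    using S yc by (intro A.M.add.finprod_cong')
      (auto simp: LinearCombinations.module_hom_smult[OF hom] A.smult_zero)
  finally show ?thesis by simp
qed


section \<open>The first Ext group\<close>

locale assoc_algebra =
  fixes R :: "('k::field, 'r) module"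
  assumes bilinear: "bilinear_algebra R" and ring: "ring R"
begin

sublocale B: bilinear_algebra R by (rule bilinear)
sublocale ring R by (rule ring)

abbreviation scalar :: "'k \<Rightarrow> 'r" where
  "scalar c \<equiv> c \<odot>\<^bsub>R\<^esub> \<one>\<^bsub>R\<^esub>"

lemma scalar_mult: "r \<in> carrier R \<Longrightarrow> scalar c \<otimes>\<^bsub>R\<^esub> r = c \<odot>\<^bsub>R\<^esub> r"
  by (simp add: B.mult_smult_left)

lemma mult_scalar: "r \<in> carrier R \<Longrightarrow> r \<otimes>\<^bsub>R\<^esub> scalar c = c \<odot>\<^bsub>R\<^esub> r"
  by (simp add: B.mult_smult_right)

end

locale hom_setting =
  assoc_algebra R + M: left_module R M + N: left_module R N
  for R :: "('k::field, 'r) module" and M :: "('r, 'm) module" and N :: "('r, 'n) module"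
begin

lemma hom_spaceI:
  assumes "\<And>x. x \<in> carrier M \<Longrightarrow> f x \<in> carrier N"
    "\<And>x y. \<lbrakk>x \<in> carrier M; y \<in> carrier M\<rbrakk> \<Longrightarrow> f (x \<oplus>\<^bsub>M\<^esub> y) = f x \<oplus>\<^bsub>N\<^esub> f y"
    "\<And>r x. \<lbrakk>r \<in> carrier R; x \<in> carrier M\<rbrakk> \<Longrightarrow> f (r \<odot>\<^bsub>M\<^esub> x) = r \<odot>\<^bsub>N\<^esub> f x"
  shows "restrict f (carrier M) \<in> carrier (hom_space R M N)"
  using assms by (auto simp: hom_space_def LinearCombinations.module_hom_def M.smult_closed)

lemma hom_spaceD:
  assumes "f \<in> carrier (hom_space R M N)"
  shows "x \<in> carrier M \<Longrightarrow> f x \<in> carrier N"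
    "\<lbrakk>x \<in> carrier M; y \<in> carrier M\<rbrakk> \<Longrightarrow> f (x \<oplus>\<^bsub>M\<^esub> y) = f x \<oplus>\<^bsub>N\<^esub> f y"
    "\<lbrakk>r \<in> carrier R; x \<in> carrier M\<rbrakk> \<Longrightarrow> f (r \<odot>\<^bsub>M\<^esub> x) = r \<odot>\<^bsub>N\<^esub> f x"
    "f \<in> extensional (carrier M)"
  using assms by (auto simp: hom_space_def LinearCombinations.module_hom_def)

lemma hom_space_simps:
  "\<zero>\<^bsub>hom_space R M N\<^esub> = (\<lambda>x\<in>carrier M. \<zero>\<^bsub>N\<^esub>)"
  "f \<oplus>\<^bsub>hom_space R M N\<^esub> g = (\<lambda>x\<in>carrier M. f x \<oplus>\<^bsub>N\<^esub> g x)"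
  "c \<odot>\<^bsub>hom_space R M N\<^esub> f = (\<lambda>x\<in>carrier M. scalar c \<odot>\<^bsub>N\<^esub> f x)"
  by (simp_all add: hom_space_def)

lemma scalar_closed [simp]: "scalar c \<in> carrier R"
  by (simp add: B.smult_closed)

text \<open>Centrality of the scalars \<open>c \<odot> 1\<close> in \<open>R\<close>: it makes a
  scalar multiple of an \<open>R\<close>-linear map \<open>R\<close>-linear again.\<close>

lemma scalar_smult_commute:
  assumes "r \<in> carrier R" "x \<in> carrier N"
  shows "scalar c \<odot>\<^bsub>N\<^esub> (r \<odot>\<^bsub>N\<^esub> x) = r \<odot>\<^bsub>N\<^esub> (scalar c \<odot>\<^bsub>N\<^esub> x)"
  using assms N.smult_assoc[of "scalar c" r x] N.smult_assoc[of r "scalar c" x]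
  by (simp add: scalar_mult mult_scalar)

lemma hom_space_closed:
  "\<zero>\<^bsub>hom_space R M N\<^esub> \<in> carrier (hom_space R M N)"
  "\<lbrakk>f \<in> carrier (hom_space R M N); g \<in> carrier (hom_space R M N)\<rbrakk>
    \<Longrightarrow> f \<oplus>\<^bsub>hom_space R M N\<^esub> g \<in> carrier (hom_space R M N)"
  "f \<in> carrier (hom_space R M N) \<Longrightarrow> c \<odot>\<^bsub>hom_space R M N\<^esub> f \<in> carrier (hom_space R M N)"
proof -
  show "\<zero>\<^bsub>hom_space R M N\<^esub> \<in> carrier (hom_space R M N)"
    unfolding hom_space_simps by (rule hom_spaceI) (auto simp: N.smult_zero)
  show "f \<oplus>\<^bsub>hom_space R M N\<^esub> g \<in> carrier (hom_space R M N)"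
    if f: "f \<in> carrier (hom_space R M N)" and g: "g \<in> carrier (hom_space R M N)"
    unfolding hom_space_simps
    by (rule hom_spaceI)
      (auto simp: hom_spaceD(1-3)[OF f] hom_spaceD(1-3)[OF g] N.smult_r_distr N.M.a_ac)
  show "c \<odot>\<^bsub>hom_space R M N\<^esub> f \<in> carrier (hom_space R M N)"
    if f: "f \<in> carrier (hom_space R M N)"
    unfolding hom_space_simps
    by (rule hom_spaceI)
      (auto simp: hom_spaceD(1-3)[OF f] N.smult_closed N.smult_r_distr scalar_smult_commute)
qed

lemma vectorspace_hom_space: "vectorspace class_ring (hom_space R M N)"
proof -
  have ext: "(\<lambda>x\<in>carrier M. f x) = f" if "f \<in> carrier (hom_space R M N)" for f
    using hom_spaceD(4)[OF that] extensional_restrict by blast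
  have eqI: "restrict f (carrier M) = restrict g (carrier M)"
    if "\<And>x. x \<in> carrier M \<Longrightarrow> f x = g x" for f g :: "'m \<Rightarrow> 'n"
    using that by (rule restrict_ext)
  have ab: "abelian_group (hom_space R M N)"
  proof (rule abelian_groupI)
    fix f g h
    assume "f \<in> carrier (hom_space R M N)" "g \<in> carrier (hom_space R M N)"
      "h \<in> carrier (hom_space R M N)"
    then show "f \<oplus>\<^bsub>hom_space R M N\<^esub> g \<oplus>\<^bsub>hom_space R M N\<^esub> h
        = f \<oplus>\<^bsub>hom_space R M N\<^esub> (g \<oplus>\<^bsub>hom_space R M N\<^esub> h)"
      unfolding hom_space_simps by (intro eqI) (simp add: hom_spaceD(1) N.M.a_assoc)
  next
    fix f g
    assume "f \<in> carrier (hom_space R M N)" "g \<in> carrier (hom_space R M N)"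
    then show "f \<oplus>\<^bsub>hom_space R M N\<^esub> g = g \<oplus>\<^bsub>hom_space R M N\<^esub> f"
      unfolding hom_space_simps by (intro eqI) (simp add: hom_spaceD(1) N.M.a_comm)
  next
    fix f assume f: "f \<in> carrier (hom_space R M N)"
    have "\<zero>\<^bsub>hom_space R M N\<^esub> \<oplus>\<^bsub>hom_space R M N\<^esub> f = (\<lambda>x\<in>carrier M. f x)"
      unfolding hom_space_simps by (rule eqI) (simp add: hom_spaceD(1)[OF f])
    then show "\<zero>\<^bsub>hom_space R M N\<^esub> \<oplus>\<^bsub>hom_space R M N\<^esub> f = f"
      using ext[OF f] by simp
    have "scalar (- 1) \<odot>\<^bsub>N\<^esub> f x \<oplus>\<^bsub>N\<^esub> f x = \<zero>\<^bsub>N\<^esub>" if "x \<in> carrier M" for x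
    proof -
      have "scalar (- 1) \<oplus>\<^bsub>R\<^esub> \<one>\<^bsub>R\<^esub> = \<zero>\<^bsub>R\<^esub>"
        using B.add_inverse[of "\<one>\<^bsub>R\<^esub>"] by (simp add: a_comm)
      moreover have "(scalar (- 1) \<oplus>\<^bsub>R\<^esub> \<one>\<^bsub>R\<^esub>) \<odot>\<^bsub>N\<^esub> f x = scalar (- 1) \<odot>\<^bsub>N\<^esub> f x \<oplus>\<^bsub>N\<^esub> f x"
        using hom_spaceD(1)[OF f that] by (simp add: N.smult_l_distr N.smult_one)
      ultimately show ?thesis
        using hom_spaceD(1)[OF f that] by (simp add: N.zero_smult)
    qed
    then have "(- 1) \<odot>\<^bsub>hom_space R M N\<^esub> f \<oplus>\<^bsub>hom_space R M N\<^esub> f = \<zero>\<^bsub>hom_space R M N\<^esub>"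
      unfolding hom_space_simps by (intro eqI) simp
    then show "\<exists>g\<in>carrier (hom_space R M N). g \<oplus>\<^bsub>hom_space R M N\<^esub> f = \<zero>\<^bsub>hom_space R M N\<^esub>"
      using hom_space_closed(3)[OF f] by blast
  qed (auto intro: hom_space_closed)
  have "module (class_ring :: 'k ring) (hom_space R M N)"
  proof (rule moduleI)
    fix c :: 'k and f assume f: "f \<in> carrier (hom_space R M N)"
    then show "c \<odot>\<^bsub>hom_space R M N\<^esub> f \<in> carrier (hom_space R M N)"
      by (rule hom_space_closed)
    fix d
    have "(c + d) \<odot>\<^bsub>hom_space R M N\<^esub> f
        = c \<odot>\<^bsub>hom_space R M N\<^esub> f \<oplus>\<^bsub>hom_space R M N\<^esub> d \<odot>\<^bsub>hom_space R M N\<^esub> f"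
      unfolding hom_space_simps
      by (intro eqI) (simp add: hom_spaceD(1)[OF f] B.add_smult N.smult_l_distr)
    then show "(c \<oplus>\<^bsub>class_ring\<^esub> d) \<odot>\<^bsub>hom_space R M N\<^esub> f
        = c \<odot>\<^bsub>hom_space R M N\<^esub> f \<oplus>\<^bsub>hom_space R M N\<^esub> d \<odot>\<^bsub>hom_space R M N\<^esub> f"
      by simp
    have "scalar (c * d) = scalar c \<otimes>\<^bsub>R\<^esub> scalar d"
      by (simp add: scalar_mult B.smult_smult)
    then have "(c * d) \<odot>\<^bsub>hom_space R M N\<^esub> f = c \<odot>\<^bsub>hom_space R M N\<^esub> (d \<odot>\<^bsub>hom_space R M N\<^esub> f)"
      unfolding hom_space_simps
      by (intro eqI) (simp add: hom_spaceD(1)[OF f] N.smult_assoc)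
    then show "(c \<otimes>\<^bsub>class_ring\<^esub> d) \<odot>\<^bsub>hom_space R M N\<^esub> f
        = c \<odot>\<^bsub>hom_space R M N\<^esub> (d \<odot>\<^bsub>hom_space R M N\<^esub> f)"
      by simp
  next
    fix c :: 'k and f g
    assume f: "f \<in> carrier (hom_space R M N)" and g: "g \<in> carrier (hom_space R M N)"
    show "c \<odot>\<^bsub>hom_space R M N\<^esub> (f \<oplus>\<^bsub>hom_space R M N\<^esub> g)
        = c \<odot>\<^bsub>hom_space R M N\<^esub> f \<oplus>\<^bsub>hom_space R M N\<^esub> c \<odot>\<^bsub>hom_space R M N\<^esub> g"
      unfolding hom_space_simps
      by (intro eqI) (simp add: hom_spaceD(1)[OF f] hom_spaceD(1)[OF g] N.smult_r_distr)
  next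
    fix f assume f: "f \<in> carrier (hom_space R M N)"
    have "1 \<odot>\<^bsub>hom_space R M N\<^esub> f = (\<lambda>x\<in>carrier M. f x)"
      unfolding hom_space_simps
      by (intro eqI) (simp add: hom_spaceD(1)[OF f] B.one_smult N.smult_one)
    then show "\<one>\<^bsub>class_ring\<^esub> \<odot>\<^bsub>hom_space R M N\<^esub> f = f"
      using ext[OF f] by simp
  qed (auto simp: class_cring.is_cring ab)
  then show ?thesis
    by (simp add: vectorspace_def class_field)
qed

lemma left_module_res:
  "left_module R (res0 R M)" "left_module R (res1 R M)" "left_module R (res2 R M)"
  by (simp_all add: res0_def res1_def res2_def left_module_free ring)

lemma free_eval_res:
  "free_eval R M \<in> LinearCombinations.module_hom R (res0 R M) M"
  "free_eval R (res0 R M) \<in> LinearCombinations.module_hom R (res1 R M) (res0 R M)"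
  "free_eval R (res1 R M) \<in> LinearCombinations.module_hom R (res2 R M) (res1 R M)"
  unfolding res0_def[of R M] res1_def[of R M] res2_def[of R M]
  by (rule left_module.free_eval_hom; auto intro: left_module_free[OF ring] M.left_module_axioms)+

lemma res_complex:
  "y \<in> carrier (res1 R M) \<Longrightarrow> free_eval R M (free_eval R (res0 R M) y) = \<zero>\<^bsub>M\<^esub>"
  "z \<in> carrier (res2 R M)
    \<Longrightarrow> free_eval R (res0 R M) (free_eval R (res1 R M) z) = \<zero>\<^bsub>res0 R M\<^esub>"
  unfolding res0_def[of R M] res1_def[of R M] res2_def[of R M]
  by (rule free_eval_kernel; auto intro: left_module_free[OF ring] M.left_module_axioms)+

text \<open>The members of the resolution take the place of \<open>M\<close>, so the facts about
  Hom(M, N) apply to the cochain spaces that define Ext.\<close>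

interpretation H0: hom_setting R "res0 R M" N
  by (intro hom_setting.intro assoc_algebra_axioms left_module_res N.left_module_axioms)

interpretation H1: hom_setting R "res1 R M" N
  by (intro hom_setting.intro assoc_algebra_axioms left_module_res N.left_module_axioms)

lemma free_eval_res1:
  "y \<in> carrier (res1 R M) \<Longrightarrow> free_eval R (res0 R M) y \<in> carrier (res0 R M)"
  "z \<in> carrier (res2 R M) \<Longrightarrow> free_eval R (res1 R M) z \<in> carrier (res1 R M)"
  using LinearCombinations.module_hom_closed[OF free_eval_res(2)]
    LinearCombinations.module_hom_closed[OF free_eval_res(3)] by auto

lemma subspace_cocycles: "subspace class_ring (ext1_cocycles R M N) (hom_space R (res1 R M) N)"
  unfolding subspace_def
proof (intro conjI H1.vectorspace_hom_space)
  interpret V: vectorspace "class_ring :: 'k ring" "hom_space R (res1 R M) N"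
    by (rule H1.vectorspace_hom_space)
  show "submodule class_ring (ext1_cocycles R M N) (hom_space R (res1 R M) N)"
    by unfold_locales
      (auto simp: ext1_cocycles_def H1.hom_space_closed, auto simp: H1.hom_space_simps
        free_eval_res1 N.smult_zero)
qed

lemma subspace_coboundaries:
  "subspace class_ring (ext1_coboundaries R M N)
     ((hom_space R (res1 R M) N)\<lparr>carrier := ext1_cocycles R M N\<rparr>)"
  unfolding subspace_def
proof (intro conjI)
  interpret V: vectorspace "class_ring :: 'k ring" "hom_space R (res1 R M) N"
    by (rule H1.vectorspace_hom_space)
  show Z: "vectorspace (class_ring :: 'k ring)
      ((hom_space R (res1 R M) N)\<lparr>carrier := ext1_cocycles R M N\<rparr>)"
    by (rule V.subspace_is_vs[OF subspace_cocycles])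
  then interpret Z: vectorspace "class_ring :: 'k ring"
    "(hom_space R (res1 R M) N)\<lparr>carrier := ext1_cocycles R M N\<rparr>" .
  let ?d = "\<lambda>\<psi>. \<lambda>y\<in>carrier (res1 R M). \<psi> (free_eval R (res0 R M) y)"
  \<comment> \<open>A coboundary is a cocycle because two consecutive maps of the resolution compose
    to zero and \<open>\<psi>\<close> preserves zero.\<close>
  have cob: "?d \<psi> \<in> ext1_cocycles R M N" if \<psi>: "\<psi> \<in> carrier (hom_space R (res0 R M) N)" for \<psi>
  proof -
    have "?d \<psi> \<in> carrier (hom_space R (res1 R M) N)"
      by (rule H1.hom_spaceI)
        (simp_all add: H0.hom_spaceD[OF \<psi>] free_eval_res1
          LinearCombinations.module_hom_add[OF free_eval_res(2)]
          LinearCombinations.module_hom_smult[OF free_eval_res(2)])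
    moreover have "\<psi> \<zero>\<^bsub>res0 R M\<^esub> = \<zero>\<^bsub>N\<^esub>"
      by (rule module_hom_zero[OF left_module_res(1) N.left_module_axioms])
        (use \<psi> in \<open>simp add: hom_space_def\<close>)
    ultimately show ?thesis
      by (simp add: ext1_cocycles_def free_eval_res1 res_complex)
  qed
  show "submodule class_ring (ext1_coboundaries R M N)
     ((hom_space R (res1 R M) N)\<lparr>carrier := ext1_cocycles R M N\<rparr>)"
  proof (intro submodule.intro)
    show "ext1_coboundaries R M N
        \<subseteq> carrier ((hom_space R (res1 R M) N)\<lparr>carrier := ext1_cocycles R M N\<rparr>)"
      using cob by (auto simp: ext1_coboundaries_def)
  next
    fix v w assume "v \<in> ext1_coboundaries R M N" "w \<in> ext1_coboundaries R M N"
    then obtain \<psi> \<psi>' where \<psi>: "\<psi> \<in> carrier (hom_space R (res0 R M) N)" "v = ?d \<psi>"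
      "\<psi>' \<in> carrier (hom_space R (res0 R M) N)" "w = ?d \<psi>'"
      by (auto simp: ext1_coboundaries_def)
    then have "v \<oplus>\<^bsub>hom_space R (res1 R M) N\<^esub> w = ?d (\<psi> \<oplus>\<^bsub>hom_space R (res0 R M) N\<^esub> \<psi>')"
      unfolding H0.hom_space_simps H1.hom_space_simps by (auto simp: free_eval_res1 intro!: restrict_ext)
    then show "v \<oplus>\<^bsub>(hom_space R (res1 R M) N)\<lparr>carrier := ext1_cocycles R M N\<rparr>\<^esub> w
        \<in> ext1_coboundaries R M N"
      using H0.hom_space_closed(2) \<psi> by (simp add: ext1_coboundaries_def)
  next
    have "\<zero>\<^bsub>hom_space R (res1 R M) N\<^esub> = ?d \<zero>\<^bsub>hom_space R (res0 R M) N\<^esub>"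
      unfolding H0.hom_space_simps H1.hom_space_simps by (auto simp: free_eval_res1 intro!: restrict_ext)
    then show "\<zero>\<^bsub>(hom_space R (res1 R M) N)\<lparr>carrier := ext1_cocycles R M N\<rparr>\<^esub>
        \<in> ext1_coboundaries R M N"
      using H0.hom_space_closed(1) by (simp add: ext1_coboundaries_def)
  next
    fix c :: 'k and v assume "v \<in> ext1_coboundaries R M N"
    then obtain \<psi> where \<psi>: "\<psi> \<in> carrier (hom_space R (res0 R M) N)" "v = ?d \<psi>"
      by (auto simp: ext1_coboundaries_def)
    then have "c \<odot>\<^bsub>hom_space R (res1 R M) N\<^esub> v = ?d (c \<odot>\<^bsub>hom_space R (res0 R M) N\<^esub> \<psi>)"
      unfolding H0.hom_space_simps H1.hom_space_simps by (auto simp: free_eval_res1 intro!: restrict_ext)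
    then show "c \<odot>\<^bsub>(hom_space R (res1 R M) N)\<lparr>carrier := ext1_cocycles R M N\<rparr>\<^esub> v
        \<in> ext1_coboundaries R M N"
      using H0.hom_space_closed(3) \<psi> by (simp add: ext1_coboundaries_def)
  qed (use Z in \<open>simp add: vectorspace_def\<close>)
qed

lemma not_fin_dim_ext1:
  assumes F_add: "\<And>(n :: nat) \<phi> \<psi>. \<lbrakk>\<phi> \<in> ext1_cocycles R M N; \<psi> \<in> ext1_cocycles R M N\<rbrakk>
      \<Longrightarrow> F n (\<phi> \<oplus>\<^bsub>hom_space R (res1 R M) N\<^esub> \<psi>) = F n \<phi> + F n \<psi>"
    and F_smult: "\<And>n c \<phi>. \<phi> \<in> ext1_cocycles R M N
      \<Longrightarrow> F n (c \<odot>\<^bsub>hom_space R (res1 R M) N\<^esub> \<phi>) = c * F n \<phi>"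
    and F_W: "\<And>n \<phi>. \<phi> \<in> ext1_coboundaries R M N \<Longrightarrow> F n \<phi> = 0"
    and e: "\<And>n. e n \<in> ext1_cocycles R M N" "\<And>m n. F n (e m) = of_bool (m = n)"
  shows "\<not> vectorspace.fin_dim class_ring (ext1 R M N)"
proof -
  interpret V: vectorspace "class_ring :: 'k ring" "hom_space R (res1 R M) N"
    by (rule H1.vectorspace_hom_space)
  show ?thesis
    unfolding ext1_def
    by (rule not_fin_dim_quotient_space[where F = F and e = e,
          OF V.subspace_is_vs[OF subspace_cocycles] subspace_coboundaries])
      (simp_all add: assms)
qed

end


section \<open>Ends\<close>

lemma assoc_algebra_uea: "assoc_algebra (uea L)"
  by (intro assoc_algebra.intro bilinear_algebra_uea ring_uea)

lemma left_module_trivial: "left_module (uea L) trivial_module"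
proof (intro left_module.intro ring_uea)
  show "abelian_group (trivial_module :: (('a, 'b option) alg_term set, 'a) module)"
  proof (rule abelian_groupI)
    fix x :: 'a
    show "\<exists>y\<in>carrier (trivial_module :: (('a, 'b option) alg_term set, 'a) module).
        y \<oplus>\<^bsub>trivial_module :: (('a, 'b option) alg_term set, 'a) module\<^esub> x
        = \<zero>\<^bsub>trivial_module :: (('a, 'b option) alg_term set, 'a) module\<^esub>"
      by (intro bexI[of _ "- x"]) (auto simp: trivial_module_def)
  qed (auto simp: trivial_module_def)
qed (auto simp: trivial_module_def augmentation_simps algebra_simps)

lemma left_module_regular:
  assumes "ring R" shows "left_module R (regular_module R)"
proof -
  interpret ring R by fact
  have "abelian_group (regular_module R)"
  proof (rule abelian_groupI)
    fix x assume "x \<in> carrier (regular_module R)"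
    then show "\<exists>y\<in>carrier (regular_module R). y \<oplus>\<^bsub>regular_module R\<^esub> x = \<zero>\<^bsub>regular_module R\<^esub>"
      by (intro bexI[of _ "\<ominus>\<^bsub>R\<^esub> x"]) (simp_all add: regular_module_def l_neg)
  qed (auto simp: regular_module_def a_assoc intro: a_comm)
  then show ?thesis
    by (intro left_module.intro assms) (auto simp: regular_module_def l_distr r_distr m_assoc)
qed

lemma (in assoc_algebra) finsum_smult:
  "\<lbrakk>finite S; x \<in> carrier R\<rbrakk> \<Longrightarrow> (\<Oplus>\<^bsub>R\<^esub>c\<in>S. f c \<odot>\<^bsub>R\<^esub> x) = sum f S \<odot>\<^bsub>R\<^esub> x"
proof (induction rule: finite_induct)
  case empty
  then show ?case using B.add_smult[of x 0 0] B.smult_closed[of x 0] by simp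
next
  case (insert c S)
  then show ?case by (simp add: B.smult_closed B.add_smult Pi_def)
qed

lemma finsum_trivial_module:
  "finite S \<Longrightarrow> finsum (trivial_module :: (('k::field, 'v option) alg_term set, 'k) module) f S = sum f S"
proof -
  let ?T = "trivial_module :: (('k, 'v option) alg_term set, 'k) module"
  interpret M: abelian_group ?T
    by (rule left_module.abelian_group[OF left_module_trivial])
  have T: "carrier ?T = UNIV" "\<zero>\<^bsub>?T\<^esub> = 0" "add ?T = (+)"
    by (simp_all add: trivial_module_def)
  assume "finite S"
  then show "finsum ?T f S = sum f S"
    by (induction rule: finite_induct) (simp_all add: M.finsum_insert T)
qed

text \<open>A map \<open>D\<close> as below is a 1-cocycle of the Lie algebra; it gives the cocycle
  \<open>f \<mapsto> \<Sum>\<^sub>c c \<sqdot> D (f c)\<close> on the kernel of \<open>F\<^sub>0 \<rightarrow> k\<close>. The functionals \<open>\<chi>\<close> separate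
  these classes when evaluated at the kernel elements \<open>a n\<close> times the basis vector of \<open>1\<close>.\<close>

lemma infinitely_many_endsI:
  fixes L :: "('k::field, 'v) module"
  defines "U \<equiv> uea L"
  assumes D_closed: "\<And>(n :: nat) u. u \<in> carrier U \<Longrightarrow> D n u \<in> carrier U"
    and D_add: "\<And>n u v. \<lbrakk>u \<in> carrier U; v \<in> carrier U\<rbrakk> \<Longrightarrow> D n (u \<oplus>\<^bsub>U\<^esub> v) = D n u \<oplus>\<^bsub>U\<^esub> D n v"
    and D_mult: "\<And>n u v. \<lbrakk>u \<in> carrier U; v \<in> carrier U\<rbrakk>
      \<Longrightarrow> D n (u \<otimes>\<^bsub>U\<^esub> v) = u \<otimes>\<^bsub>U\<^esub> D n v \<oplus>\<^bsub>U\<^esub> augmentation v \<odot>\<^bsub>U\<^esub> D n u"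
    and chi_add: "\<And>u v. \<lbrakk>u \<in> carrier U; v \<in> carrier U\<rbrakk> \<Longrightarrow> \<chi> (u \<oplus>\<^bsub>U\<^esub> v) = \<chi> u + \<chi> v"
    and chi_smult: "\<And>c u. u \<in> carrier U \<Longrightarrow> \<chi> (c \<odot>\<^bsub>U\<^esub> u) = c * \<chi> u"
    and a_closed: "\<And>n. a n \<in> carrier U"
    and a_aug: "\<And>n. augmentation (a n) = 0"
    and chi_a: "\<And>n u. u \<in> carrier U \<Longrightarrow> \<chi> (a n \<otimes>\<^bsub>U\<^esub> u) = 0"
    and chi_D: "\<And>m n. \<chi> (D m (a n)) = of_bool (m = n)"
  shows "infinitely_many_ends L"
proof -
  let ?T = "trivial_module :: (('k, 'v option) alg_term set, 'k) module"
  let ?N = "regular_module U"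
  interpret A: assoc_algebra U unfolding U_def by (rule assoc_algebra_uea)
  interpret hom_setting U ?T ?N
    by (intro hom_setting.intro A.assoc_algebra_axioms left_module_regular A.ring)
      (simp add: U_def left_module_trivial)
  have N: "carrier ?N = carrier U" "add ?N = add U" "\<zero>\<^bsub>?N\<^esub> = \<zero>\<^bsub>U\<^esub>" "smult ?N = mult U"
    by (simp_all add: regular_module_def)
  have T: "carrier ?T = UNIV" "\<zero>\<^bsub>?T\<^esub> = 0" "u \<odot>\<^bsub>?T\<^esub> c = augmentation u * c" for u c
    by (simp_all add: trivial_module_def)
  have D_zero: "D n \<zero>\<^bsub>U\<^esub> = \<zero>\<^bsub>U\<^esub>" for n
    using D_add[of "\<zero>\<^bsub>U\<^esub>" "\<zero>\<^bsub>U\<^esub>" n] D_closed[of "\<zero>\<^bsub>U\<^esub>" n] by simp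
  define h where "h n g = (\<Oplus>\<^bsub>U\<^esub>c\<in>{c. g c \<noteq> \<zero>\<^bsub>U\<^esub>}. A.scalar c \<otimes>\<^bsub>U\<^esub> D n (g c))" for n g
  have h_eq: "h n g = (\<Oplus>\<^bsub>U\<^esub>c\<in>S. A.scalar c \<otimes>\<^bsub>U\<^esub> D n (g c))"
    if "finite S" "{c. g c \<noteq> \<zero>\<^bsub>U\<^esub>} \<subseteq> S" "\<And>c. g c \<in> carrier U" for n g S
  proof -
    have "A.scalar c \<otimes>\<^bsub>U\<^esub> D n (g c) \<in> carrier U" for c
    proof -
      have "A.scalar c \<in> carrier U" by (rule A.B.smult_closed) (rule A.one_closed)
      moreover have "D n (g c) \<in> carrier U" by (rule D_closed) (rule that(3))
      ultimately show ?thesis by (rule A.m_closed)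
    qed
    moreover have "A.scalar c \<otimes>\<^bsub>U\<^esub> D n (g c) = \<zero>\<^bsub>U\<^esub>" if "g c = \<zero>\<^bsub>U\<^esub>" for c
      using that by (simp add: D_zero A.B.smult_closed)
    ultimately show ?thesis
      unfolding h_def using that(1,2)
      by (intro A.add.finprod_mono_neutral_cong_left) auto
  qed
  have F0: "g c \<in> carrier U" "finite {c. g c \<noteq> \<zero>\<^bsub>U\<^esub>}" if "g \<in> carrier (res0 U ?T)" for g c
    using free_module_closed[OF A.ring that[unfolded res0_def]] that
    by (simp_all add: res0_def free_module_def)
  have F0_ops: "f \<oplus>\<^bsub>res0 U ?T\<^esub> g = (\<lambda>c. f c \<oplus>\<^bsub>U\<^esub> g c)" "u \<odot>\<^bsub>res0 U ?T\<^esub> g = (\<lambda>c. u \<otimes>\<^bsub>U\<^esub> g c)"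
    "\<zero>\<^bsub>res0 U ?T\<^esub> = (\<lambda>c. \<zero>\<^bsub>U\<^esub>)" for f g u
    by (simp_all add: res0_def free_module_def)
  have h_closed: "h n g \<in> carrier U" if "g \<in> carrier (res0 U ?T)" for n g
    unfolding h_def using F0[OF that] by (intro A.finsum_closed) (auto simp: D_closed)
  have h_add: "h n (f \<oplus>\<^bsub>res0 U ?T\<^esub> g) = h n f \<oplus>\<^bsub>U\<^esub> h n g"
    if f: "f \<in> carrier (res0 U ?T)" and g: "g \<in> carrier (res0 U ?T)" for n f g
  proof -
    define S where "S = {c. f c \<noteq> \<zero>\<^bsub>U\<^esub>} \<union> {c. g c \<noteq> \<zero>\<^bsub>U\<^esub>}"
    have S: "finite S" "{c. f c \<noteq> \<zero>\<^bsub>U\<^esub>} \<subseteq> S" "{c. g c \<noteq> \<zero>\<^bsub>U\<^esub>} \<subseteq> S"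
      "{c. f c \<oplus>\<^bsub>U\<^esub> g c \<noteq> \<zero>\<^bsub>U\<^esub>} \<subseteq> S"
      using F0[OF f] F0[OF g] by (auto simp: S_def)
    have "h n (f \<oplus>\<^bsub>res0 U ?T\<^esub> g) = (\<Oplus>\<^bsub>U\<^esub>c\<in>S. A.scalar c \<otimes>\<^bsub>U\<^esub> D n (f c \<oplus>\<^bsub>U\<^esub> g c))"
      unfolding F0_ops using S F0(1)[OF f] F0(1)[OF g] by (intro h_eq) auto
    also have "\<dots> = (\<Oplus>\<^bsub>U\<^esub>c\<in>S. A.scalar c \<otimes>\<^bsub>U\<^esub> D n (f c) \<oplus>\<^bsub>U\<^esub> A.scalar c \<otimes>\<^bsub>U\<^esub> D n (g c))"
      using F0(1)[OF f] F0(1)[OF g]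
      by (intro A.add.finprod_cong') (auto simp: D_add D_closed A.r_distr)
    also have "\<dots> = h n f \<oplus>\<^bsub>U\<^esub> h n g"
      using F0(1)[OF f] F0(1)[OF g]
      by (subst A.finsum_addf) (auto simp: h_eq[OF S(1,2)] h_eq[OF S(1,3)] D_closed)
    finally show ?thesis .
  qed
  \<comment> \<open>Linearity is available on the kernel of the map to the field. The twisted
    Leibniz rule for \<open>D n (u g\<^sub>c)\<close> leaves the corrections
    \<open>c \<epsilon>(g\<^sub>c) D n u\<close>, with the augmentation written \<epsilon>, and
    their coefficients add up to the value of \<open>g\<close> in the field, which is zero.\<close>
  have h_smult: "h n (u \<odot>\<^bsub>res0 U ?T\<^esub> g) = u \<otimes>\<^bsub>U\<^esub> h n g"
    if u: "u \<in> carrier U" and g: "g \<in> carrier (res0 U ?T)" and ker: "free_eval U ?T g = 0" for n u g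
  proof -
    define S where "S = {c. g c \<noteq> \<zero>\<^bsub>U\<^esub>}"
    have S: "finite S" "{c. g c \<noteq> \<zero>\<^bsub>U\<^esub>} \<subseteq> S" "{c. u \<otimes>\<^bsub>U\<^esub> g c \<noteq> \<zero>\<^bsub>U\<^esub>} \<subseteq> S"
      using F0[OF g] u by (auto simp: S_def)
    have aug: "(\<Sum>c\<in>S. augmentation (g c) * c) = 0"
      using ker S by (simp add: free_eval_def S_def finsum_trivial_module T)
    have "h n (u \<odot>\<^bsub>res0 U ?T\<^esub> g) = (\<Oplus>\<^bsub>U\<^esub>c\<in>S. A.scalar c \<otimes>\<^bsub>U\<^esub> D n (u \<otimes>\<^bsub>U\<^esub> g c))"
      unfolding F0_ops using S F0(1)[OF g] u by (intro h_eq) auto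
    also have "\<dots> = (\<Oplus>\<^bsub>U\<^esub>c\<in>S. u \<otimes>\<^bsub>U\<^esub> (A.scalar c \<otimes>\<^bsub>U\<^esub> D n (g c))
        \<oplus>\<^bsub>U\<^esub> (augmentation (g c) * c) \<odot>\<^bsub>U\<^esub> D n u)"
    proof (intro A.add.finprod_cong')
      fix c
      have "A.scalar c \<otimes>\<^bsub>U\<^esub> (augmentation (g c) \<odot>\<^bsub>U\<^esub> D n u) = (augmentation (g c) * c) \<odot>\<^bsub>U\<^esub> D n u"
        using u by (simp add: A.scalar_mult A.B.smult_closed D_closed mult.commute flip: A.B.smult_smult)
      moreover have "A.scalar c \<otimes>\<^bsub>U\<^esub> (u \<otimes>\<^bsub>U\<^esub> D n (g c)) = u \<otimes>\<^bsub>U\<^esub> (A.scalar c \<otimes>\<^bsub>U\<^esub> D n (g c))"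
        using u F0(1)[OF g] by (simp add: A.scalar_mult D_closed A.B.mult_smult_right)
      ultimately show "A.scalar c \<otimes>\<^bsub>U\<^esub> D n (u \<otimes>\<^bsub>U\<^esub> g c) = u \<otimes>\<^bsub>U\<^esub> (A.scalar c \<otimes>\<^bsub>U\<^esub> D n (g c))
          \<oplus>\<^bsub>U\<^esub> (augmentation (g c) * c) \<odot>\<^bsub>U\<^esub> D n u"
        using u F0(1)[OF g] by (simp add: D_mult A.r_distr D_closed A.B.smult_closed)
    qed (use u F0(1)[OF g] in \<open>auto simp: D_closed A.B.smult_closed\<close>)
    also have "\<dots> = (\<Oplus>\<^bsub>U\<^esub>c\<in>S. u \<otimes>\<^bsub>U\<^esub> (A.scalar c \<otimes>\<^bsub>U\<^esub> D n (g c)))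
        \<oplus>\<^bsub>U\<^esub> (\<Oplus>\<^bsub>U\<^esub>c\<in>S. (augmentation (g c) * c) \<odot>\<^bsub>U\<^esub> D n u)"
      using u F0(1)[OF g] by (intro A.finsum_addf) (auto simp: D_closed A.B.smult_closed)
    also have "(\<Oplus>\<^bsub>U\<^esub>c\<in>S. (augmentation (g c) * c) \<odot>\<^bsub>U\<^esub> D n u) = 0 \<odot>\<^bsub>U\<^esub> D n u"
      using S u by (simp add: A.finsum_smult D_closed aug)
    also have "\<dots> = \<zero>\<^bsub>U\<^esub>"
      using A.finsum_smult[of "{}" "D n u"] u D_closed by simp
    also have "(\<Oplus>\<^bsub>U\<^esub>c\<in>S. u \<otimes>\<^bsub>U\<^esub> (A.scalar c \<otimes>\<^bsub>U\<^esub> D n (g c))) = u \<otimes>\<^bsub>U\<^esub> h n g"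
    proof -
      have "(\<lambda>c. A.scalar c \<otimes>\<^bsub>U\<^esub> D n (g c)) \<in> S \<rightarrow> carrier U"
        using F0(1)[OF g] by (auto simp: D_closed A.B.smult_closed)
      then show ?thesis
        by (simp add: h_eq[OF S(1,2) F0(1)[OF g]] A.finsum_rdistr S(1) u)
    qed
    finally show ?thesis
      using u h_closed[OF g] by simp
  qed
  define e where "e n = (\<lambda>y\<in>carrier (res1 U ?T). h n (free_eval U (res0 U ?T) y))" for n
  interpret H1: hom_setting U "res1 U ?T" ?N
    by (intro hom_setting.intro A.assoc_algebra_axioms left_module_res N.left_module_axioms)
  have e: "e n \<in> ext1_cocycles U ?T ?N" for n
  proof -
    have "e n \<in> carrier (hom_space U (res1 U ?T) ?N)"
      unfolding e_def
      by (rule H1.hom_spaceI)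
        (use res_complex(1) in \<open>simp_all add: free_eval_res1 h_closed h_add h_smult N T
          LinearCombinations.module_hom_add[OF free_eval_res(2)]
          LinearCombinations.module_hom_smult[OF free_eval_res(2)]\<close>)
    moreover have "h n \<zero>\<^bsub>res0 U ?T\<^esub> = \<zero>\<^bsub>U\<^esub>"
      by (simp add: h_def F0_ops)
    ultimately show ?thesis
      by (simp add: ext1_cocycles_def e_def free_eval_res1 res_complex N)
  qed
  \<comment> \<open>\<open>g1\<close> is the basis vector of 1 in the free module on the set of
    scalars. An element \<open>a n\<close> of augmentation 0 moves it into the kernel, while a map
    defined on all of the free module takes \<open>a n\<close> out as a left factor.\<close>
  define g1 where "g1 c = (if c = 1 then \<one>\<^bsub>U\<^esub> else \<zero>\<^bsub>U\<^esub>)" for c :: 'k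
  define g where "g n c = (if c = 1 then a n else \<zero>\<^bsub>U\<^esub>)" for n and c :: 'k
  have g1: "g1 \<in> carrier (res0 U ?T)"
    by (auto simp: res0_def free_module_def g1_def T)
  have g_eq: "g n = a n \<odot>\<^bsub>res0 U ?T\<^esub> g1" for n
    unfolding F0_ops by (rule HOL.ext) (simp add: g_def g1_def a_closed)
  have g: "g n \<in> carrier (res0 U ?T)" for n
    by (auto simp: res0_def free_module_def g_def T a_closed)
  have g_ker: "free_eval U ?T (g n) = \<zero>\<^bsub>?T\<^esub>" for n
  proof -
    have "{c. g n c \<noteq> \<zero>\<^bsub>U\<^esub>} \<subseteq> {1}" by (auto simp: g_def)
    then show ?thesis
      using left_module.free_eval_eq[OF M.left_module_axioms, of "{1}" "g n"] a_closed
      by (simp add: g_def T finsum_trivial_module a_aug)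
  qed
  \<comment> \<open>The kernel element \<open>g n\<close> indexes a basis vector of the next free
    module, and this vector maps to \<open>g n\<close>. Evaluating a cochain there reads off its
    value on \<open>g n\<close>.\<close>
  define b where "b n f = (if f = g n then \<one>\<^bsub>U\<^esub> else \<zero>\<^bsub>U\<^esub>)" for n f
  have b: "b n \<in> carrier (res1 U ?T)" for n
    using g g_ker by (auto simp: res1_def free_module_def b_def)
  have b_eval: "free_eval U (res0 U ?T) (b n) = g n" for n
  proof -
    interpret F0: left_module U "res0 U ?T" by (rule left_module_res(1))
    have "free_eval U (res0 U ?T) (b n) = (\<Oplus>\<^bsub>res0 U ?T\<^esub>f\<in>{g n}. b n f \<odot>\<^bsub>res0 U ?T\<^esub> f)"
      by (rule F0.free_eval_eq) (auto simp: b_def g)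
    also have "\<dots> = g n"
      using g by (simp add: b_def F0.smult_one)
    finally show ?thesis .
  qed
  have "\<not> vectorspace.fin_dim class_ring (ext1 U ?T ?N)"
  proof (rule not_fin_dim_ext1[where F = "\<lambda>n \<phi>. \<chi> (\<phi> (b n))" and e = e])
    have closed: "\<phi> (b n) \<in> carrier U" if "\<phi> \<in> ext1_cocycles U ?T ?N" for \<phi> n
      using that H1.hom_spaceD(1)[of \<phi> "b n"] b by (auto simp: ext1_cocycles_def N)
    show "\<chi> ((\<phi> \<oplus>\<^bsub>hom_space U (res1 U ?T) ?N\<^esub> \<psi>) (b n)) = \<chi> (\<phi> (b n)) + \<chi> (\<psi> (b n))"
      if "\<phi> \<in> ext1_cocycles U ?T ?N" "\<psi> \<in> ext1_cocycles U ?T ?N" for \<phi> \<psi> n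
      using closed that b by (simp add: H1.hom_space_simps N chi_add)
    show "\<chi> ((c \<odot>\<^bsub>hom_space U (res1 U ?T) ?N\<^esub> \<phi>) (b n)) = c * \<chi> (\<phi> (b n))"
      if "\<phi> \<in> ext1_cocycles U ?T ?N" for c \<phi> n
      using closed that b by (simp add: H1.hom_space_simps N A.scalar_mult chi_smult)
    show "\<chi> (\<phi> (b n)) = 0" if \<phi>: "\<phi> \<in> ext1_coboundaries U ?T ?N" for \<phi> n
    proof -
      interpret H0: hom_setting U "res0 U ?T" ?N
        by (intro hom_setting.intro A.assoc_algebra_axioms left_module_res N.left_module_axioms)
      obtain \<psi> where \<psi>: "\<psi> \<in> carrier (hom_space U (res0 U ?T) ?N)"
        and "\<phi> = (\<lambda>y\<in>carrier (res1 U ?T). \<psi> (free_eval U (res0 U ?T) y))"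
        using \<phi> by (auto simp: ext1_coboundaries_def)
      \<comment> \<open>The value of a coboundary lies in the right ideal \<open>a n U\<close>, on
        which \<chi> vanishes by \<open>chi_a\<close>.\<close>
      then have "\<phi> (b n) = a n \<otimes>\<^bsub>U\<^esub> \<psi> g1"
        using b b_eval H0.hom_spaceD(3)[OF \<psi> a_closed g1] by (simp add: g_eq N)
      then show ?thesis
        using H0.hom_spaceD(1)[OF \<psi> g1] by (simp add: chi_a N)
    qed
    show "\<chi> (e m (b n)) = of_bool (m = n)" for m n
    proof -
      have "e m (b n) = h m (g n)" using b by (simp add: e_def b_eval)
      also have "\<dots> = (\<Oplus>\<^bsub>U\<^esub>c\<in>{1}. A.scalar c \<otimes>\<^bsub>U\<^esub> D m (g n c))"
        by (rule h_eq) (auto simp: g_def a_closed)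
      also have "\<dots> = D m (a n)"
        by (simp add: g_def D_closed a_closed A.B.one_smult)
      finally show ?thesis by (simp add: chi_D)
    qed
  qed (rule e)
  then show ?thesis
    by (simp add: infinitely_many_ends_def U_def)
qed


section \<open>Linear forms and shift cocycles on the Lie algebra\<close>

definition abelian_map :: "(nat \<Rightarrow> 'k) \<Rightarrow> 'k lie \<Rightarrow> 'k::field" where
  "abelian_map g = (SOME h. lie_map (*) (\<lambda>_ _. 0) h \<and> (\<forall>n. h (lie_gen n) = g n))"

text \<open>The defining relations are sums of brackets, so in an abelian target they hold for
  arbitrary images of the generators.\<close>

lemma abelian_map: "lie_map (*) (\<lambda>_ _. 0) (abelian_map g)" "abelian_map g (lie_gen n) = g n"
proof -
  interpret A: lie_type_algebra "(*) :: 'a \<Rightarrow> _" "\<lambda>_ _. 0"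
    by unfold_locales (auto simp: algebra_simps)
  obtain h where "lie_map (*) (\<lambda>_ _. 0) h" "\<And>n. h (lie_gen n) = g n"
    by (rule A.lie_lift[of g]) auto
  then have "\<exists>h. lie_map (*) (\<lambda>_ _. 0) h \<and> (\<forall>n. h (lie_gen n) = g n)"
    by blast
  from someI_ex[OF this, folded abelian_map_def]
  show "lie_map (*) (\<lambda>_ _. 0) (abelian_map g)" "abelian_map g (lie_gen n) = g n"
    by auto
qed

text \<open>\<open>\<chi>\<close> is the second component of a homomorphism to the dual numbers.\<close>

lemma env_linear_part:
  fixes f :: "'k::field lie \<Rightarrow> 'k"
  assumes "lie_map (*) (\<lambda>_ _. 0) f"
  obtains \<chi> where "\<And>u v. \<chi> (u + v) = \<chi> u + \<chi> v" "\<And>c u. \<chi> (env_scale c u) = c * \<chi> u"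
    "\<And>u v. \<chi> (u * v) = counit u * \<chi> v + counit v * \<chi> u" "\<And>x. \<chi> (inc x) = f x"
proof -
  interpret f: lie_map "(*)" "\<lambda>_ _. 0" f by fact
  interpret A: type_algebra "\<lambda>c (x, y). (c * x, c * y)" "\<lambda>(x, y) (x', y'). (x * x', x * y' + x' * y)"
    by unfold_locales (auto simp: algebra_simps)
  obtain h where h: "\<And>u v. h (u + v) = h u + h v" "\<And>c u. h (env_scale c u) = (\<lambda>(x, y). (c * x, c * y)) (h u)"
    "\<And>u v. h (u * v) = (\<lambda>(x, y) (x', y'). (x * x', x * y' + x' * y)) (h u) (h v)"
    "h 1 = (1, 0)" "\<And>x. h (inc x) = (0, f x)"
  proof (rule A.env_lift[of "(1, 0)" "\<lambda>x. (0, f x)"])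
    show "lie_map (\<lambda>c (x, y). (c * x, c * y)) (\<lambda>x y. (case x of (x, y) \<Rightarrow> \<lambda>(x', y'). (x * x', x * y' + x' * y)) y -
        (case y of (x, y) \<Rightarrow> \<lambda>(x', y'). (x * x', x * y' + x' * y)) x) (\<lambda>x. (0, f x))"
      by unfold_locales (auto simp: f.map_add f.map_scale f.map_bracket zero_prod_def)
  qed (auto simp: algebra_simps zero_prod_def)
  have h_zero: "h 0 = 0"
    using h(1)[of 0 0] by simp
  \<comment> \<open>The first component respects the algebra operations, fixes the unit and kills
    \<open>inc x\<close>, as the counit does. The product rule for \<chi> is then the second
    component of multiplication in the dual numbers.\<close>
  have fst: "fst (h u) = counit u" for u
    by (induction u rule: env_induct)
      (simp_all add: h split_beta h_zero zero_prod_def)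
  show thesis
    by (rule that[of "\<lambda>u. snd (h u)"]) (auto simp: h split_beta fst)
qed

text \<open>The extension of \<open>U\<close> by the bimodule \<open>U\<close> with trivial right action. Its homomorphisms
  with first component the inclusion correspond to the 1-cocycles with values in \<open>U\<close>.\<close>

definition crossed_scale :: "'k \<Rightarrow> 'k env \<times> 'k env \<Rightarrow> 'k::field env \<times> 'k env" where
  "crossed_scale c p = (env_scale c (fst p), env_scale c (snd p))"

definition crossed_mult :: "'k env \<times> 'k env \<Rightarrow> 'k env \<times> 'k env \<Rightarrow> 'k::field env \<times> 'k env" where
  "crossed_mult p q = (fst p * fst q, fst p * snd q + env_scale (counit (fst q)) (snd p))"

interpretation crossed: type_algebra crossed_scale "crossed_mult :: _ \<Rightarrow> _ \<Rightarrow> 'k::field env \<times> 'k env"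
  by unfold_locales
    (auto simp: crossed_scale_def crossed_mult_def algebra_simps env.s_add env.add_s env.s_one
      env.m_s_left env.m_s_right simp flip: env.s_s)

lemma crossed_mult_assoc:
  "crossed_mult (crossed_mult p q) r = crossed_mult p (crossed_mult q r)"
  by (auto simp: crossed_mult_def algebra_simps env.s_add env.m_s_left env.m_s_right simp flip: env.s_s)

text \<open>Since \<open>counit (inc x) = 0\<close>, the right action disappears from the commutator
  of \<open>(inc x, f x)\<close> and \<open>(inc y, f y)\<close>. The cocycle identity for
  \<open>f\<close> thus says exactly that \<open>x \<mapsto> (inc x, f x)\<close> respects brackets,
  and \<open>D\<close> is the second component of its extension to the enveloping algebra.\<close>

lemma env_crossed_hom:
  fixes f :: "'k::field lie \<Rightarrow> 'k env"
  assumes "\<And>x y. f (x + y) = f x + f y" "\<And>c x. f (lie_scale c x) = env_scale c (f x)"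
    "\<And>x y. f (bracket x y) = inc x * f y - inc y * f x"
  obtains D where "\<And>u v. D (u + v) = D u + D v"
    "\<And>u v. D (u * v) = u * D v + env_scale (counit v) (D u)" "\<And>x. D (inc x) = f x"
proof -
  obtain h where h: "\<And>u v. h (u + v) = h u + h v" "\<And>c u. h (env_scale c u) = crossed_scale c (h u)"
    "\<And>u v. h (u * v) = crossed_mult (h u) (h v)" "h 1 = (1, 0)" "\<And>x. h (inc x) = (inc x, f x)"
  proof (rule crossed.env_lift[of "(1, 0)" "\<lambda>x. (inc x, f x)"])
    show "lie_map crossed_scale (\<lambda>x y. crossed_mult x y - crossed_mult y x) (\<lambda>x. (inc x, f x))"
      by unfold_locales
        (auto simp: crossed_scale_def crossed_mult_def assms inc_simps env.s_zero_left zero_prod_def)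
  qed (auto simp: crossed_mult_assoc, auto simp: crossed_mult_def env.s_one env.s_zero_right)
  have h_zero: "h 0 = 0"
    using h(1)[of 0 0] by simp
  \<comment> \<open>With the identity as first component, the second component of
    \<open>crossed_mult\<close> becomes the twisted Leibniz rule for \<open>D\<close>.\<close>
  have fst: "fst (h u) = u" for u
    by (induction u rule: env_induct)
      (simp_all add: h crossed_scale_def crossed_mult_def h_zero zero_prod_def)
  show thesis
    by (rule that[of "\<lambda>u. snd (h u)"]) (auto simp: h crossed_scale_def crossed_mult_def fst)
qed


text \<open>The cocycle \<open>a(t) \<mapsto> t\<^sup>m a(t)\<close>, \<open>b(t) \<mapsto> t\<^sup>m b(t)\<close>.\<close>

lemma shift_cocycle:
  obtains f :: "'k::field lie \<Rightarrow> 'k env" where "\<And>x y. f (x + y) = f x + f y"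
    "\<And>c x. f (lie_scale c x) = env_scale c (f x)"
    "\<And>x y. f (bracket x y) = inc x * f y - inc y * f x"
    "\<And>n. f (lie_gen n) = (if 2 * m \<le> n then inc (lie_gen (n - 2 * m)) else 0)"
proof -
  interpret lie_type_algebra crossed_scale
    "\<lambda>x y :: 'k env \<times> 'k env. crossed_mult x y - crossed_mult y x"
    by (rule crossed.lie_type_algebra_commutator) (rule crossed_mult_assoc)
  \<comment> \<open>The two series are interleaved, so multiplication of both by t^m shifts the
    index of a generator by \<open>2 * m\<close>. Coefficients below the shift are zero.\<close>
  define c :: "nat \<Rightarrow> 'k env" where
    "c n = (if 2 * m \<le> n then inc (lie_gen (n - 2 * m)) else 0)" for n
  have comm: "crossed_mult (inc x, u) (inc y, v) - crossed_mult (inc y, v) (inc x, u)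
      = (inc (bracket x y), inc x * v - inc y * u)" for x y and u v :: "'k env"
    by (simp add: crossed_mult_def inc_simps env.s_zero_left)
  have sum_comm: "(\<Sum>i\<le>n. (p i, q i)) = (\<Sum>i\<le>n. p i, \<Sum>i\<le>n. q i)"
    for n and p q :: "nat \<Rightarrow> 'k env"
    by (induction n) auto
  interpret inc: lie_map env_scale "\<lambda>u v. u * v - v * u" "inc :: 'k lie \<Rightarrow> _"
    by (rule lie_map_inc)
  \<comment> \<open>This is the coefficient of t^n in a(t) t^m b(t) - b(t) t^m a(t), hence that of
    t^(n-m) in [a(t), b(t)]. For n < m there is no such coefficient and every summand is
    zero.\<close>
  have "(\<Sum>i\<le>n. inc (lie_gen (2 * i)) * c (2 * (n - i) + 1)
      - inc (lie_gen (2 * (n - i) + 1)) * c (2 * i)) = 0" for n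
  proof (cases "m \<le> n")
    case True
    have "(\<Sum>i\<le>n. inc (lie_gen (2 * i)) * c (2 * (n - i) + 1))
        = (\<Sum>i\<le>n - m. inc (lie_gen (2 * i)) * inc (lie_gen (2 * (n - m - i) + 1)))"
      using True by (intro sum.mono_neutral_cong_right)
        (auto simp: c_def right_diff_distrib' intro!: arg_cong[of _ _ lie_gen] arg_cong[of _ _ inc]
          arg_cong2[of _ _ _ _ "(*)"])
    moreover have "(\<Sum>i\<le>n. inc (lie_gen (2 * (n - i) + 1)) * c (2 * i))
        = (\<Sum>i\<le>n - m. inc (lie_gen (2 * (n - m - i) + 1)) * inc (lie_gen (2 * i)))"
    proof -
      have "(\<Sum>i\<le>n. inc (lie_gen (2 * (n - i) + 1)) * c (2 * i))
          = (\<Sum>i\<in>{m..n}. inc (lie_gen (2 * (n - i) + 1)) * inc (lie_gen (2 * (i - m))))"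
        by (intro sum.mono_neutral_cong_right) (auto simp: c_def right_diff_distrib')
      also have "\<dots> = (\<Sum>i\<le>n - m. inc (lie_gen (2 * (n - m - i) + 1)) * inc (lie_gen (2 * i)))"
        using True by (intro sum.reindex_bij_witness[of _ "\<lambda>i. i + m" "\<lambda>i. i - m"]) auto
      finally show ?thesis .
    qed
    ultimately have "(\<Sum>i\<le>n. inc (lie_gen (2 * i)) * c (2 * (n - i) + 1)
        - inc (lie_gen (2 * (n - i) + 1)) * c (2 * i))
      = inc (\<Sum>i\<le>n - m. bracket (lie_gen (2 * i)) (lie_gen (2 * (n - m - i) + 1)))"
      by (simp add: sum_subtractf inc.map_sum inc_simps(3))
    then show ?thesis by (simp only: lie_gen_relation inc.map_zero)
  next
    case False
    then show ?thesis by (intro sum.neutral) (auto simp: c_def)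
  qed
  \<comment> \<open>The first component of the relation in the crossed algebra; it is the image
    under \<open>inc\<close> of the relation in L.\<close>
  moreover have "(\<Sum>i\<le>n. inc (bracket (lie_gen (2 * i)) (lie_gen (2 * (n - i) + 1)))) = (0 :: 'k env)" for n
    using inc.map_sum[of "\<lambda>i. bracket (lie_gen (2 * i)) (lie_gen (2 * (n - i) + 1))" "{..n}"]
    by (simp add: lie_gen_relation[of n, simplified] inc.map_zero)
  ultimately obtain h where h: "lie_map crossed_scale (\<lambda>x y. crossed_mult x y - crossed_mult y x) h"
      "\<And>n. h (lie_gen n) = (inc (lie_gen n), c n)"
    by (rule_tac lie_lift[of "\<lambda>n. (inc (lie_gen n), c n)"])
      (simp_all only: comm sum_comm zero_prod_def)
  interpret h: lie_map crossed_scale "\<lambda>x y. crossed_mult x y - crossed_mult y x" h by (rule h(1))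
  \<comment> \<open>The lift is prescribed on generators alone; uniqueness of Lie maps identifies
    its first component everywhere, which brings the bracket rule for \<open>snd (h x)\<close> into
    the form of the cocycle identity.\<close>
  have fst: "fst (h x) = inc x" for x
  proof (rule lie_map_eqI[OF _ lie_map_inc])
    show "lie_map env_scale (\<lambda>u v. u * v - v * u) (\<lambda>x. fst (h x))"
      by unfold_locales (simp_all add: h.map_add h.map_scale h.map_bracket crossed_scale_def crossed_mult_def)
  qed (simp add: h(2))
  show thesis
  proof (rule that[of "\<lambda>x. snd (h x)"])
    show "snd (h (bracket x y)) = inc x * snd (h y) - inc y * snd (h x)" for x y
      by (simp add: h.map_bracket crossed_mult_def fst env.s_zero_left)
  qed (simp_all add: h.map_add h.map_scale crossed_scale_def h(2) c_def)
qed

lemma infinitely_many_ends_lie_alg: "infinitely_many_ends (lie_alg :: ('k::field, nat \<Rightarrow> 'k) module)"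
proof -
  have "\<exists>D. (\<forall>u v. D (u + v) = D u + D v)
      \<and> (\<forall>u v. D (u * v) = u * D v + env_scale (counit v) (D u))
      \<and> (\<forall>n. D (inc (lie_gen n)) = (if 2 * m \<le> n then inc (lie_gen (n - 2 * m)) else (0 :: 'k env)))"
    for m
  proof -
    obtain f :: "'k lie \<Rightarrow> 'k env" where f: "\<And>x y. f (x + y) = f x + f y"
      "\<And>c x. f (lie_scale c x) = env_scale c (f x)"
      "\<And>x y. f (bracket x y) = inc x * f y - inc y * f x"
      "\<And>n. f (lie_gen n) = (if 2 * m \<le> n then inc (lie_gen (n - 2 * m)) else 0)"
      using shift_cocycle[of m] by blast
    obtain D where "\<And>u v. D (u + v) = D u + D v"
      "\<And>u v. D (u * v) = u * D v + env_scale (counit v) (D u)" "\<And>x. D (inc x) = f x"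
      using env_crossed_hom[OF f(1-3)] by blast
    with f(4) show ?thesis by (intro exI[of _ D]) simp
  qed
  then obtain D where D: "\<And>m u v. D m (u + v) = D m u + (D m v :: 'k env)"
    "\<And>m u v. D m (u * v) = u * D m v + env_scale (counit v) (D m u)"
    "\<And>m n. D m (inc (lie_gen n)) = (if 2 * m \<le> n then inc (lie_gen (n - 2 * m)) else 0)"
    by metis
  \<comment> \<open>\<chi> reads the linear part along x_0 = a_0.\<close>
  obtain \<chi> :: "'k env \<Rightarrow> 'k" where \<chi>: "\<And>u v. \<chi> (u + v) = \<chi> u + \<chi> v"
    "\<And>c u. \<chi> (env_scale c u) = c * \<chi> u" "\<And>u v. \<chi> (u * v) = counit u * \<chi> v + counit v * \<chi> u"
    "\<And>x. \<chi> (inc x) = abelian_map (\<lambda>n. of_bool (n = 0)) x"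
    by (rule env_linear_part[OF abelian_map(1)]) blast
  have \<chi>_zero: "\<chi> 0 = 0"
    using \<chi>(2)[of 0 0] by (simp add: env.s_zero_left)
  show ?thesis
  \<comment> \<open>Shifts and test elements start at 1, hence \<open>Suc\<close>. For the test
    element x_0 itself, \<chi> of \<open>inc (lie_gen 0) * u\<close> would be
    \<open>counit u\<close>, and the shift by 0 is the coboundary x \<mapsto> x. On a_(n+1) the
    shift by m + 1 yields a_(n-m) or 0, which \<chi> sees exactly when m = n.\<close>
  proof (rule infinitely_many_endsI[where D = "\<lambda>m u. Rep_env (D (Suc m) (Abs_env u))"
        and \<chi> = "\<lambda>u. \<chi> (Abs_env u)" and a = "\<lambda>n. Rep_env (inc (lie_gen (2 * Suc n)))"])
    fix u v :: "('k, (nat \<Rightarrow> 'k) option) alg_term set"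
    assume "u \<in> carrier (uea lie_alg)" "v \<in> carrier (uea lie_alg)"
    then obtain u' v' where uv: "u = Rep_env u'" "v = Rep_env v'"
      by (metis Rep_env_cases)
    show "Rep_env (D (Suc m) (Abs_env (u \<oplus>\<^bsub>uea lie_alg\<^esub> v)))
        = Rep_env (D (Suc m) (Abs_env u)) \<oplus>\<^bsub>uea lie_alg\<^esub> Rep_env (D (Suc m) (Abs_env v))" for m
      unfolding uv Rep_env_simps(3)[symmetric] Rep_env_inverse D ..
    show "Rep_env (D (Suc m) (Abs_env (u \<otimes>\<^bsub>uea lie_alg\<^esub> v)))
        = u \<otimes>\<^bsub>uea lie_alg\<^esub> Rep_env (D (Suc m) (Abs_env v))
          \<oplus>\<^bsub>uea lie_alg\<^esub> augmentation v \<odot>\<^bsub>uea lie_alg\<^esub> Rep_env (D (Suc m) (Abs_env u))" for m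
      unfolding uv Rep_env_simps(3,4)[symmetric] Rep_env_inverse D counit_def[symmetric]
        Rep_env_simps2[symmetric] ..
    show "\<chi> (Abs_env (u \<oplus>\<^bsub>uea lie_alg\<^esub> v)) = \<chi> (Abs_env u) + \<chi> (Abs_env v)"
      unfolding uv Rep_env_simps(3)[symmetric] Rep_env_inverse \<chi> ..
  next
    fix u :: "('k, (nat \<Rightarrow> 'k) option) alg_term set" and c n
    assume "u \<in> carrier (uea lie_alg)"
    then obtain u' where u: "u = Rep_env u'"
      by (metis Rep_env_cases)
    show "\<chi> (Abs_env (c \<odot>\<^bsub>uea lie_alg\<^esub> u)) = c * \<chi> (Abs_env u)"
      unfolding u Rep_env_simps2[symmetric] Rep_env_inverse \<chi> ..
    show "\<chi> (Abs_env (Rep_env (inc (lie_gen (2 * Suc n))) \<otimes>\<^bsub>uea lie_alg\<^esub> u)) = 0"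
      unfolding u Rep_env_simps(4)[symmetric] Rep_env_inverse by (simp add: \<chi> abelian_map(2))
  next
    fix m n
    show "\<chi> (Abs_env (Rep_env (D (Suc m) (Abs_env (Rep_env (inc (lie_gen (2 * Suc n))))))))
        = of_bool (m = n)"
      unfolding Rep_env_inverse D(3) by (auto simp: \<chi> abelian_map(2) \<chi>_zero)
    show "augmentation (Rep_env (inc (lie_gen (2 * Suc n)))) = 0"
      by (simp add: counit_def[symmetric])
  qed (rule Rep_env)+
qed


section \<open>The grading\<close>

text \<open>The bracket of formal power series over the Lie algebra. The grading will be the
  homomorphism to this algebra that sends x_n to x_n s^(n+1); the coefficient of s^i in the image is
  the component of degree i.\<close>

definition convolution :: "(nat \<Rightarrow> 'k lie) \<Rightarrow> (nat \<Rightarrow> 'k lie) \<Rightarrow> nat \<Rightarrow> 'k::field lie" where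
  "convolution f g n = (\<Sum>i\<le>n. bracket (f i) (g (n - i)))"

text \<open>The reflection of i to n - i alone shows only that twice the sum is zero, which says
  nothing in characteristic 2. Hence the two halves are cancelled against each other and the middle
  term is removed by the alternating law.\<close>

lemma sum_antisymmetric_zero:
  fixes B :: "nat \<Rightarrow> nat \<Rightarrow> 'a::ab_group_add"
  assumes "\<And>i. B i i = 0" "\<And>i j. B j i = - B i j"
  shows "(\<Sum>i\<le>n. B i (n - i)) = 0"
proof -
  let ?A = "{i. 2 * i < n}" and ?B = "{i. i \<le> n \<and> 2 * i = n}" and ?C = "{i. i \<le> n \<and> n < 2 * i}"
  let ?F = "\<lambda>i. B i (n - i)"
  have fin: "finite ?A"
    by (rule finite_subset[of _ "{..n}"]) auto
  have "{..n} = (?A \<union> ?B) \<union> ?C"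
    by auto
  then have "sum ?F {..n} = sum ?F ((?A \<union> ?B) \<union> ?C)"
    by (rule arg_cong)
  also have "\<dots> = sum ?F (?A \<union> ?B) + sum ?F ?C"
    by (rule sum.union_disjoint) (use fin in auto)
  also have "sum ?F (?A \<union> ?B) = sum ?F ?A + sum ?F ?B"
    by (rule sum.union_disjoint) (use fin in auto)
  finally have "sum ?F {..n} = sum ?F ?A + sum ?F ?B + sum ?F ?C" .
  moreover have "(\<Sum>i | i \<le> n \<and> 2 * i = n. B i (n - i)) = 0"
    by (rule sum.neutral) (auto simp: assms(1) simp flip: mult_2)
  moreover have "(\<Sum>i | i \<le> n \<and> n < 2 * i. B i (n - i)) = (\<Sum>i | 2 * i < n. B (n - i) i)"
    by (rule sum.reindex_bij_witness[of _ "\<lambda>i. n - i" "\<lambda>i. n - i"]) auto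
  moreover have "\<dots> = - (\<Sum>i | 2 * i < n. B i (n - i))"
    unfolding sum_negf[symmetric] by (rule sum.cong) (auto intro: assms(2))
  ultimately show ?thesis by simp
qed

definition triples :: "nat \<Rightarrow> (nat \<times> nat \<times> nat) set" where
  "triples n = {(i, j, k). i + j + k = n}"

text \<open>Over the symmetric index set \<open>triples\<close> the three cyclic terms of the Jacobi
  identity are brought to the same indices by a rotation.\<close>

lemma convolution_convolution:
  "convolution f (convolution g h) n = (\<Sum>(i, j, k)\<in>triples n. bracket (f i) (bracket (g j) (h k)))"
proof -
  have "convolution f (convolution g h) n
      = (\<Sum>i\<le>n. \<Sum>j\<le>n - i. bracket (f i) (bracket (g j) (h (n - i - j))))"
    by (simp add: convolution_def lie.m_sum_right)
  also have "\<dots> = (\<Sum>(i, j)\<in>(SIGMA i:{..n}. {..n - i}). bracket (f i) (bracket (g j) (h (n - i - j))))"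
    by (rule sum.Sigma) auto
  also have "\<dots> = (\<Sum>(i, j, k)\<in>triples n. bracket (f i) (bracket (g j) (h k)))"
    by (rule sum.reindex_bij_witness[of _ "\<lambda>(i, j, k). (i, j)" "\<lambda>(i, j). (i, j, n - i - j)"])
      (auto simp: triples_def)
  finally show ?thesis .
qed

interpretation graded: lie_type_algebra "\<lambda>c f i. lie_scale c (f i)"
  "convolution :: _ \<Rightarrow> _ \<Rightarrow> nat \<Rightarrow> 'k::field lie"
proof -
  have rotate: "(\<Sum>(i, j, k)\<in>triples n. F i j k) = (\<Sum>(i, j, k)\<in>triples n. F k i j)"
    for n and F :: "nat \<Rightarrow> nat \<Rightarrow> nat \<Rightarrow> 'k lie"
    by (rule sum.reindex_bij_witness[of _ "\<lambda>(i, j, k). (k, i, j)" "\<lambda>(i, j, k). (j, k, i)"])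
      (auto simp: triples_def)
  show "lie_type_algebra (\<lambda>c f i. lie_scale c (f i)) (convolution :: _ \<Rightarrow> _ \<Rightarrow> nat \<Rightarrow> 'k lie)"
  proof
    fix f g h :: "nat \<Rightarrow> 'k lie"
    show "convolution f f = 0"
    proof (rule HOL.ext)
      have "(\<Sum>i\<le>n. bracket (f i) (f (n - i))) = 0" for n
        by (rule sum_antisymmetric_zero[of "\<lambda>i j. bracket (f i) (f j)"]) (rule lie.m_self, rule lie.m_anticomm)
      then show "convolution f f n = 0 n" for n by (simp add: convolution_def)
    qed
    show "convolution f (convolution g h)
        + (convolution g (convolution h f) + convolution h (convolution f g)) = 0"
    proof (rule HOL.ext)
      fix n
      have "convolution g (convolution h f) n = (\<Sum>(i, j, k)\<in>triples n. bracket (g j) (bracket (h k) (f i)))"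
        unfolding convolution_convolution rotate[of "\<lambda>i j k. bracket (g j) (bracket (h k) (f i))"] ..
      moreover have "convolution h (convolution f g) n
          = (\<Sum>(i, j, k)\<in>triples n. bracket (h k) (bracket (f i) (g j)))"
        unfolding convolution_convolution rotate[of "\<lambda>i j k. bracket (h i) (bracket (f j) (g k))"] ..
      ultimately show "(convolution f (convolution g h)
          + (convolution g (convolution h f) + convolution h (convolution f g))) n = 0 n"
        by (simp add: convolution_convolution sum.distrib[symmetric] case_prod_unfold lie.m_jacobi)
    qed
  qed (auto simp: fun_eq_iff convolution_def lie.s_add lie.add_s lie.s_s lie.s_one lie.m_add_left
      lie.m_add_right lie.m_s_left lie.m_s_right lie.s_sum sum.distrib)
qed

definition single :: "nat \<Rightarrow> 'k lie \<Rightarrow> nat \<Rightarrow> 'k::field lie" where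
  "single p x i = (if i = p then x else 0)"

lemma single_simps:
  "single p x + single p y = single p (x + y)"
  "(\<lambda>i. lie_scale c (single p x i)) = single p (lie_scale c x)"
  "single p 0 = 0"
  by (auto simp: single_def fun_eq_iff lie.s_zero_right)

lemma convolution_single: "convolution (single p x) (single q y) = single (p + q) (bracket x y)"
proof (rule HOL.ext)
  fix n
  have "convolution (single p x) (single q y) n
      = (\<Sum>i\<le>n. if i = p then (if n - p = q then bracket x y else 0) else 0)"
    unfolding convolution_def single_def
    by (rule sum.cong) (auto simp: lie.m_zero_left lie.m_zero_right)
  also have "\<dots> = single (p + q) (bracket x y) n"
    by (auto simp: single_def)
  finally show "convolution (single p x) (single q y) n = single (p + q) (bracket x y) n" .
qed

section \<open>Homogeneous components\<close>

definition component :: "'k lie \<Rightarrow> nat \<Rightarrow> 'k::field lie" where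
  "component = (SOME h. lie_map (\<lambda>c f i. lie_scale c (f i)) convolution h
     \<and> (\<forall>n. h (lie_gen n) = single (Suc n) (lie_gen n)))"

text \<open>The degree of x_k is k + 1, so every term of relation n has degree (2 i + 1) + (2 (n -
  i) + 2) = 2 n + 3. Being homogeneous, the relation survives in the power series algebra.\<close>

lemma
  shows lie_map_component: "lie_map (\<lambda>c f i. lie_scale c (f i)) convolution (component :: 'k::field lie \<Rightarrow> _)"
    and component_gen: "component (lie_gen n :: 'k lie) = single (Suc n) (lie_gen n)"
proof -
  have sum_single: "(\<Sum>i\<in>I. single p (x i)) = single p (sum x I)" if "finite I" for p I and x :: "nat \<Rightarrow> 'k lie"
    using that by (induction I) (auto simp: single_def fun_eq_iff)
  have "(\<Sum>i\<le>n. convolution (single (Suc (2 * i)) (lie_gen (2 * i)))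
      (single (Suc (2 * (n - i) + 1)) (lie_gen (2 * (n - i) + 1)))) = (0 :: nat \<Rightarrow> 'k lie)" for n
  proof -
    have "(\<Sum>i\<le>n. convolution (single (Suc (2 * i)) (lie_gen (2 * i)))
        (single (Suc (2 * (n - i) + 1)) (lie_gen (2 * (n - i) + 1))))
      = (\<Sum>i\<le>n. single (2 * n + 3) (bracket (lie_gen (2 * i)) (lie_gen (2 * (n - i) + 1) :: 'k lie)))"
      unfolding convolution_single by (rule sum.cong) (auto intro!: arg_cong2[of _ _ _ _ single])
    also have "\<dots> = 0"
      unfolding sum_single[OF finite_atMost] lie_gen_relation by (auto simp: single_def fun_eq_iff)
    finally show ?thesis .
  qed
  then obtain h :: "'k lie \<Rightarrow> nat \<Rightarrow> 'k lie" where "lie_map (\<lambda>c f i. lie_scale c (f i)) convolution h"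
      "\<And>n. h (lie_gen n) = single (Suc n) (lie_gen n)"
    by (rule graded.lie_lift) blast
  then have "\<exists>h. lie_map (\<lambda>c f i. lie_scale c (f i)) convolution h
     \<and> (\<forall>n. h (lie_gen n) = single (Suc n) (lie_gen n :: 'k lie))" by blast
  from someI_ex[OF this, folded component_def]
  show "lie_map (\<lambda>c f i. lie_scale c (f i)) convolution (component :: 'k::field lie \<Rightarrow> _)"
    "component (lie_gen n :: 'k lie) = single (Suc n) (lie_gen n)"
    by auto
qed

interpretation component: lie_map "\<lambda>c f i. lie_scale c (f i)" convolution
  "component :: 'k::field lie \<Rightarrow> _"
  by (rule lie_map_component)

lemma component_simps:
  "component 0 i = (0 :: 'k::field lie)"
  "component (x + y) i = component x i + (component y i :: 'k lie)"
  "component (lie_scale c x) i = lie_scale c (component x i)"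
  "component (bracket x y) i = (\<Sum>j\<le>i. bracket (component x j) (component y (i - j)))"
  "component (lie_gen n) i = (if i = Suc n then lie_gen n else (0 :: 'k lie))"
  by (simp_all add: component.map_zero component.map_add component.map_scale component.map_bracket
      convolution_def component_gen single_def)

lemma component_sum: "component (sum f I) i = (\<Sum>j\<in>I. component (f j) i)"
  by (induction I rule: infinite_finite_induct) (auto simp: component_simps)

lemma component_at_zero: "component x 0 = (0 :: 'k::field lie)"
  by (induction x rule: lie_induct) (auto simp: component_simps lie.s_zero_right lie.m_zero_left)

text \<open>The projections to the degrees are orthogonal idempotents. On a bracket this follows
  since components of degrees p and i - p multiply into degree i.\<close>

lemma component_component: "component (component x i) = single i (component x i :: 'k::field lie)"
proof -
  have "component (component x i) j = (if j = i then component x i else 0)" for j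
  proof (induction x arbitrary: i j rule: lie_induct)
    case (bracket x y)
    \<comment> \<open>Only l = p contributes. Then p is at most both i and j, so the truncated
      differences \<open>j - p\<close> and \<open>i - p\<close> agree exactly when j = i.\<close>
    have "(\<Sum>l\<le>j. bracket (component (component x p) l) (component (component y (i - p)) (j - l)))
        = (if j = i then bracket (component x p) (component y (i - p)) else 0)" if "p \<le> i" for p
    proof -
      have "(\<Sum>l\<le>j. bracket (component (component x p) l) (component (component y (i - p)) (j - l)))
          = (\<Sum>l\<le>j. if l = p then (if j - p = i - p
              then bracket (component x p) (component y (i - p)) else 0) else 0)"
        by (rule sum.cong) (auto simp: bracket.IH lie.m_zero_left lie.m_zero_right)
      also have "\<dots> = (if j = i then bracket (component x p) (component y (i - p)) else 0)"
        using that by (auto simp: eq_diff_iff)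
      finally show ?thesis .
    qed
    then have "(\<Sum>p\<le>i. \<Sum>l\<le>j. bracket (component (component x p) l) (component (component y (i - p)) (j - l)))
        = (\<Sum>p\<le>i. if j = i then bracket (component x p) (component y (i - p)) else 0)"
      by (intro sum.cong) auto
    then show ?case
      by (simp add: component_simps component_sum)
  qed (auto simp: component_simps lie.s_zero_right)
  then show ?thesis by (auto simp: single_def fun_eq_iff)
qed

lemma component_homogeneous_eq:
  "component x = single p x \<Longrightarrow> component y = single q y
    \<Longrightarrow> component (bracket x y) = single (p + q) (bracket x (y :: 'k::field lie))"
  by (simp add: component.map_bracket convolution_single)

text \<open>Homogeneous elements have the property, and it is stable under finite sums; a bracket of
  two finite sums is a finite sum of homogeneous brackets. Asking for all large bounds lets two
  elements share one.\<close>

lemma sum_components: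
  "\<exists>N. \<forall>M\<ge>N. (\<Sum>i\<le>M. component x i) = (x :: 'k::field lie)"
proof -
  define Q where "Q x \<longleftrightarrow> (\<exists>N. \<forall>M\<ge>N. (\<Sum>i\<le>M. component x i) = (x :: 'k lie))" for x
  have Q_add: "Q (x + y)" if x: "Q x" and y: "Q y" for x y
  proof -
    obtain N N' where "\<forall>M\<ge>N. (\<Sum>i\<le>M. component x i) = x" "\<forall>M\<ge>N'. (\<Sum>i\<le>M. component y i) = y"
      using x y unfolding Q_def by blast
    then have "\<forall>M\<ge>max N N'. (\<Sum>i\<le>M. component (x + y) i) = x + y"
      by (simp add: component_simps sum.distrib)
    then show ?thesis
      unfolding Q_def by blast
  qed
  have Q_homogeneous: "Q x" if "component x = single p x" for x p
    unfolding Q_def that by (intro exI[of _ p]) (simp add: single_def)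
  have Q_zero: "Q 0"
    by (rule Q_homogeneous[of _ 0]) (simp add: component.map_zero single_simps)
  have Q_sum: "Q (sum f I)" if "finite I" "\<And>i. i \<in> I \<Longrightarrow> Q (f i)" for f :: "nat \<Rightarrow> 'k lie" and I
    using that by induction (simp_all add: Q_zero Q_add)
  have "Q x" for x
  proof (induction x rule: lie_induct)
    case (gen n)
    then show ?case by (rule Q_homogeneous) (rule component_gen)
  next
    case (scale c x)
    then obtain N where "\<forall>M\<ge>N. (\<Sum>i\<le>M. component x i) = x" unfolding Q_def by blast
    then have "\<forall>M\<ge>N. (\<Sum>i\<le>M. component (lie_scale c x) i) = lie_scale c x"
      by (simp add: component_simps flip: lie.s_sum)
    then show ?case unfolding Q_def by blast
  next
    case (bracket x y)
    then obtain M M' where M: "(\<Sum>i\<le>M. component x i) = x" "(\<Sum>i\<le>M'. component y i) = y"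
      unfolding Q_def by blast
    have "bracket (\<Sum>i\<le>M. component x i) (\<Sum>j\<le>M'. component y j)
        = (\<Sum>i\<le>M. \<Sum>j\<le>M'. bracket (component x i) (component y j))"
      unfolding lie.m_sum_left by (simp only: lie.m_sum_right)
    moreover have "Q (\<Sum>i\<le>M. \<Sum>j\<le>M'. bracket (component x i) (component y j))"
      by (intro Q_sum finite_atMost Q_homogeneous[OF component_homogeneous_eq[OF component_component component_component]])
    ultimately show ?case by (simp add: M)
  qed (rule Q_zero, rule Q_add)
  then show ?thesis unfolding Q_def .
qed

definition degree_space :: "nat \<Rightarrow> (nat \<Rightarrow> 'k::field) set" where
  "degree_space i = emb ` {x. component x = single i x}"

lemma finsum_lie_alg:
  "finite S \<Longrightarrow> (\<Oplus>\<^bsub>lie_alg\<^esub>i\<in>S. emb (g i)) = emb (sum g S)"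
proof (induction rule: finite_induct)
  interpret L: abelian_group lie_alg
    by (rule bilinear_algebra.abelian_group[OF bilinear_algebra_lie_alg])
  {
    case empty
    show ?case by simp
  next
    case (insert i S)
    then show ?case by (simp add: Pi_def)
  }
qed

lemma vectorspace_lie_alg: "vectorspace class_ring lie_alg"
  by (rule bilinear_algebra.vectorspace[OF bilinear_algebra_lie_alg])

text \<open>Uniqueness of the decomposition: applying the projection to degree i to the given sum
  leaves only its i-th summand.\<close>

lemma degree_decomposition:
  fixes x :: "'k::field lie"
  assumes "f 0 = \<zero>\<^bsub>lie_alg\<^esub>" "\<forall>i\<ge>1. f i \<in> degree_space i" "finite {i. f i \<noteq> \<zero>\<^bsub>lie_alg\<^esub>}"
    and "emb x = (\<Oplus>\<^bsub>lie_alg\<^esub>i\<in>{i. f i \<noteq> \<zero>\<^bsub>lie_alg\<^esub>}. f i)"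
  shows "f i = emb (component x i)"
proof -
  have "\<exists>y. f i = emb y \<and> component y = single i y" for i
  proof (cases "i = 0")
    case True
    then show ?thesis
      using assms(1) by (intro exI[of _ 0]) (auto simp: component_simps single_def)
  next
    case False
    then have "f i \<in> degree_space i" using assms(2) by simp
    then show ?thesis by (auto simp: degree_space_def)
  qed
  then obtain g where g: "\<And>i. f i = emb (g i)" "\<And>i. component (g i) = single i (g i)"
    by metis
  have fin: "finite {i. g i \<noteq> 0}" using assms(3) by (simp add: g(1))
  then have "x = (\<Sum>i | g i \<noteq> 0. g i)"
    using assms(4) by (simp add: g(1) finsum_lie_alg)
  then have "component x i = (\<Sum>j | g j \<noteq> 0. component (g j) i)"
    by (simp add: component_sum)
  also have "\<dots> = (\<Sum>j | g j \<noteq> 0. if j = i then g i else 0)"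
    by (rule sum.cong) (auto simp: g(2) single_def)
  also have "\<dots> = g i"
    using fin by simp
  finally show ?thesis by (simp add: g(1))
qed

lemma graded_lie_algebra_lie_alg:
  "graded_lie_algebra (lie_alg :: ('k::field, nat \<Rightarrow> 'k) module) degree_space"
  unfolding graded_lie_algebra_def is_direct_sum_def
proof (intro conjI lie_algebra_lie_alg allI impI ballI)
  interpret vectorspace "class_ring :: 'k ring" lie_alg by (rule vectorspace_lie_alg)
  fix i
  have "submodule class_ring (degree_space i) (lie_alg :: ('k, nat \<Rightarrow> 'k) module)"
    by unfold_locales
      (auto simp: degree_space_def component.map_add component.map_scale component.map_zero
        single_simps)
  then show "subspace class_ring (degree_space i) (lie_alg :: ('k, nat \<Rightarrow> 'k) module)"
    by (simp add: subspace_def vectorspace_lie_alg)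
  show "degree_space i \<subseteq> carrier (lie_alg :: ('k, nat \<Rightarrow> 'k) module)"
    by (auto simp: degree_space_def)
next
  fix i j and x y :: "nat \<Rightarrow> 'k"
  assume "x \<in> degree_space i" "y \<in> degree_space j"
  then show "x \<otimes>\<^bsub>lie_alg\<^esub> y \<in> degree_space (i + j)"
    by (auto simp: degree_space_def component_homogeneous_eq)
next
  fix X :: "nat \<Rightarrow> 'k" assume "X \<in> carrier lie_alg"
  then obtain x where x: "X = emb x" by auto
  obtain N where N: "\<And>M. M \<ge> N \<Longrightarrow> (\<Sum>i\<le>M. component x i) = x"
    using sum_components by blast
  \<comment> \<open>Two consecutive partial sums beyond \<open>N\<close> both equal x, and their
    difference is the component.\<close>
  have comp_zero: "component x i = 0" if "i > N" for i
  proof -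
    obtain j where "i = Suc j" "j \<ge> N" using \<open>i > N\<close> by (cases i) auto
    then show ?thesis using N[of j] N[of i] by simp
  qed
  then have sub: "{i. component x i \<noteq> 0} \<subseteq> {..N}" using comp_zero by (metis (mono_tags, lifting) atMost_iff mem_Collect_eq not_le subsetI)
  then have fin: "finite {i. component x i \<noteq> 0}" by (rule finite_subset) simp
  have "(\<Sum>i | component x i \<noteq> 0. component x i) = (\<Sum>i\<le>N. component x i)"
    by (rule sum.mono_neutral_left) (use sub in auto)
  then have "(\<Sum>i | component x i \<noteq> 0. component x i) = x"
    using N[of N] by simp
  then have "emb x = (\<Oplus>\<^bsub>lie_alg\<^esub>i\<in>{i. emb (component x i) \<noteq> \<zero>\<^bsub>lie_alg\<^esub>}. emb (component x i))"
    using finsum_lie_alg[OF fin, of "component x"] by simp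
  then show "\<exists>!f. f 0 = \<zero>\<^bsub>lie_alg\<^esub> \<and> (\<forall>i\<ge>1. f i \<in> degree_space i) \<and> finite {i. f i \<noteq> \<zero>\<^bsub>lie_alg\<^esub>}
      \<and> X = (\<Oplus>\<^bsub>lie_alg\<^esub>i\<in>{i. f i \<noteq> \<zero>\<^bsub>lie_alg\<^esub>}. f i)"
  proof (intro ex1I[of _ "\<lambda>i. emb (component x i)"])
    fix f assume "f 0 = \<zero>\<^bsub>lie_alg\<^esub> \<and> (\<forall>i\<ge>1. f i \<in> degree_space i) \<and> finite {i. f i \<noteq> \<zero>\<^bsub>lie_alg\<^esub>}
      \<and> X = (\<Oplus>\<^bsub>lie_alg\<^esub>i\<in>{i. f i \<noteq> \<zero>\<^bsub>lie_alg\<^esub>}. f i)"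
    then show "f = (\<lambda>i. emb (component x i))"
      using degree_decomposition[of f x] by (auto simp: x)
  qed (use fin in \<open>auto simp: x component_at_zero degree_space_def component_component\<close>)
qed

text \<open>For the last claim, the decomposition of an element inside C is also one inside L, hence
  consists of its components by \<open>degree_decomposition\<close>.\<close>

lemma graded_lie_subalgebra_lie_algD:
  fixes C :: "(nat \<Rightarrow> 'k::field) set"
  assumes C: "graded_lie_subalgebra lie_alg degree_space C"
  shows "C \<subseteq> range emb" "emb 0 \<in> C" "\<lbrakk>emb x \<in> C; emb y \<in> C\<rbrakk> \<Longrightarrow> emb (x + y) \<in> C"
    "emb x \<in> C \<Longrightarrow> emb (lie_scale c x) \<in> C" "\<lbrakk>emb x \<in> C; emb y \<in> C\<rbrakk> \<Longrightarrow> emb (bracket x y) \<in> C"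
    "emb x \<in> C \<Longrightarrow> emb (component x i) \<in> C"
proof -
  have sub: "subspace class_ring C (lie_alg :: ('k, nat \<Rightarrow> 'k) module)"
    using C by (simp add: graded_lie_subalgebra_def lie_subalgebra_def)
  interpret submodule "class_ring :: 'k ring" C lie_alg
    using sub by (simp add: subspace_def)
  show "C \<subseteq> range emb" using subset by simp
  show zero: "emb 0 \<in> C" using zero_closed by simp
  show "\<lbrakk>emb x \<in> C; emb y \<in> C\<rbrakk> \<Longrightarrow> emb (x + y) \<in> C"
    using m_closed[of "emb x" "emb y"] by simp
  show "emb x \<in> C \<Longrightarrow> emb (lie_scale c x) \<in> C"
    using smult_closed[of c "emb x"] by simp
  show "\<lbrakk>emb x \<in> C; emb y \<in> C\<rbrakk> \<Longrightarrow> emb (bracket x y) \<in> C"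
    using C by (auto simp: graded_lie_subalgebra_def lie_subalgebra_def simp flip: lie_alg_simps(4))
  show "emb (component x i) \<in> C" if x: "emb x \<in> C"
  proof -
    have "\<exists>f. f 0 = \<zero>\<^bsub>lie_alg\<^esub> \<and> (\<forall>i\<ge>1. f i \<in> C \<inter> degree_space i)
        \<and> finite {i. f i \<noteq> \<zero>\<^bsub>lie_alg\<^esub>} \<and> emb x = (\<Oplus>\<^bsub>lie_alg\<^esub>i\<in>{i. f i \<noteq> \<zero>\<^bsub>lie_alg\<^esub>}. f i)"
      using C x unfolding graded_lie_subalgebra_def is_direct_sum_def by blast
    then obtain f where f: "f 0 = \<zero>\<^bsub>lie_alg\<^esub>" "\<forall>i\<ge>1. f i \<in> C \<inter> degree_space i"
      "finite {i. f i \<noteq> \<zero>\<^bsub>lie_alg\<^esub>}" "emb x = (\<Oplus>\<^bsub>lie_alg\<^esub>i\<in>{i. f i \<noteq> \<zero>\<^bsub>lie_alg\<^esub>}. f i)"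
      by blast
    then have "f i = emb (component x i)"
      by (intro degree_decomposition) auto
    then show ?thesis
      using f(2) zero by (cases "i = 0") (simp add: component_at_zero, metis IntD1 less_one not_le)
  qed
qed


section \<open>Free product decompositions\<close>

locale lie_alg_free_product =
  fixes C D :: "(nat \<Rightarrow> 'k::field) set"
  assumes C: "C \<subseteq> range emb" and D: "D \<subseteq> range emb"
    and free_product: "is_lie_free_product lie_alg C D"
begin

definition fp_gens :: "((nat \<Rightarrow> 'k) + (nat \<Rightarrow> 'k)) set" where
  "fp_gens = Inl ` C \<union> Inr ` D"

definition fp_rels where
  "fp_rels = lie_rels \<union> linear_rels (lie_alg\<lparr>carrier := C\<rparr>) Inl \<union> mult_rels (lie_alg\<lparr>carrier := C\<rparr>) Inl
     \<union> linear_rels (lie_alg\<lparr>carrier := D\<rparr>) Inr \<union> mult_rels (lie_alg\<lparr>carrier := D\<rparr>) Inr"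

abbreviation "fp \<equiv> presented_algebra fp_gens fp_rels"

abbreviation "can \<equiv> induced_hom lie_alg (case_sum (\<lambda>x. x) (\<lambda>x. x))"

lemma can_iso: "can \<in> lie_iso fp lie_alg"
  using free_product by (simp add: is_lie_free_product_def lie_free_product_def fp_gens_def fp_rels_def)

lemma case_sum_closed: "x \<in> fp_gens \<Longrightarrow> case_sum (\<lambda>x. x) (\<lambda>x. x) x \<in> carrier lie_alg"
  using C D by (auto simp: fp_gens_def)

lemma can_class:
  assumes "t \<in> terms fp_gens"
  shows "can (cong_class fp_gens fp_rels t) = term_eval lie_alg (case_sum (\<lambda>x. x) (\<lambda>x. x)) t"
proof (rule bilinear_algebra.induced_hom_class[OF bilinear_algebra_lie_alg case_sum_closed _ assms])
  interpret L: lie_algebra lie_alg by (rule lie_algebra_lie_alg)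
  have closed: "term_eval lie_alg (case_sum (\<lambda>x. x) (\<lambda>x. x)) t \<in> carrier lie_alg"
    if "t \<in> terms fp_gens" for t
    using bilinear_algebra.term_eval_closed[OF bilinear_algebra_lie_alg that case_sum_closed] .
  fix s t :: "('k, (nat \<Rightarrow> 'k) + (nat \<Rightarrow> 'k)) alg_term"
  assume "(s, t) \<in> fp_rels" and s: "s \<in> terms fp_gens"
  then consider "(s, t) \<in> lie_rels" | "(s, t) \<in> fp_rels - lie_rels" by blast
  then show "term_eval lie_alg (case_sum (\<lambda>x. x) (\<lambda>x. x)) s = term_eval lie_alg (case_sum (\<lambda>x. x) (\<lambda>x. x)) t"
  proof cases
    case 1
    then show ?thesis
      using s closed unfolding lie_rels_def
      by (auto simp del: lie_alg_simps simp: closed L.bracket_self L.jacobi)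
  next
    case 2
    then show ?thesis
      by (auto simp: fp_rels_def linear_rels_def mult_rels_def)
  qed
qed

text \<open>Surjectivity of the canonical map: every element is the value of a term in elements of C
  and D.\<close>

lemma generated:
  assumes "Q 0" "\<And>x y. \<lbrakk>Q x; Q y\<rbrakk> \<Longrightarrow> Q (x + y)" "\<And>c x. Q x \<Longrightarrow> Q (lie_scale c x)"
    "\<And>x y. \<lbrakk>Q x; Q y\<rbrakk> \<Longrightarrow> Q (bracket x y)" "\<And>x. emb x \<in> C \<Longrightarrow> Q x" "\<And>x. emb x \<in> D \<Longrightarrow> Q x"
  shows "Q x"
proof -
  have eval: "\<exists>y. term_eval lie_alg (case_sum (\<lambda>x. x) (\<lambda>x. x)) t = emb y \<and> Q y"
    if "t \<in> terms fp_gens" for t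
    using that
  proof (induction t)
    case (Gen z)
    then show ?case using C D assms(5,6) by (auto simp: fp_gens_def)
  next
    case Zero
    then show ?case using assms(1) by auto
  next
    case (Plus s t)
    then obtain y z where "term_eval lie_alg (case_sum (\<lambda>x. x) (\<lambda>x. x)) s = emb y" "Q y"
      "term_eval lie_alg (case_sum (\<lambda>x. x) (\<lambda>x. x)) t = emb z" "Q z" by auto
    then show ?case using assms(2) by (intro exI[of _ "y + z"]) simp
  next
    case (Scale c t)
    then obtain y where "term_eval lie_alg (case_sum (\<lambda>x. x) (\<lambda>x. x)) t = emb y" "Q y" by auto
    then show ?case using assms(3) by (intro exI[of _ "lie_scale c y"]) simp
  next
    case (Times s t)
    then obtain y z where "term_eval lie_alg (case_sum (\<lambda>x. x) (\<lambda>x. x)) s = emb y" "Q y"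
      "term_eval lie_alg (case_sum (\<lambda>x. x) (\<lambda>x. x)) t = emb z" "Q z" by auto
    then show ?case using assms(4) by (intro exI[of _ "bracket y z"]) simp
  qed
  have "emb x \<in> can ` carrier fp"
    using can_iso by (auto simp: lie_iso_def bij_betw_def)
  then obtain t where t: "t \<in> terms fp_gens" "emb x = can (cong_class fp_gens fp_rels t)"
    by (auto simp: presented_algebra_simps)
  then show ?thesis
    using eval[OF t(1)] by (auto simp: can_class)
qed

text \<open>The coproduct property, transported to L along the inverse of the canonical isomorphism.
  The two maps to be glued are given on all of L and are used through their restrictions to C and
  D.\<close>

lemma lift:
  assumes "lie_type_algebra s m" "lie_map s m f" "lie_map s m g"
  obtains h where "lie_map s m h" "\<And>x. emb x \<in> C \<Longrightarrow> h x = f x" "\<And>x. emb x \<in> D \<Longrightarrow> h x = g x"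
proof -
  interpret A: lie_type_algebra s m by fact
  interpret f: lie_map s m f by fact
  interpret g: lie_map s m g by fact
  interpret R: bilinear_algebra A.rec by (rule A.bilinear_algebra_rec)
  define k where "k = case_sum (\<lambda>x. f (the_inv emb x)) (\<lambda>x. g (the_inv emb x))"
  have k: "k x \<in> carrier A.rec" for x by simp
  have "\<exists>x'. x = emb x'" if "x \<in> C \<or> x \<in> D" for x
    using that C D by auto
  then have E: "term_eval A.rec k t = term_eval A.rec k t'" if "(t, t') \<in> fp_rels" for t t'
    using that
    by (auto simp: fp_rels_def lie_rels_def linear_rels_def mult_rels_def A.m_self A.m_jacobi k_def)
      (metis (no_types, lifting) lie_alg_simps(3-5) inv_emb f.map_add f.map_scale f.map_bracket
        g.map_add g.map_scale g.map_bracket)+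
  interpret F: algebra_hom fp A.rec "induced_hom A.rec k"
    by (rule R.algebra_hom_induced[OF k E])
  interpret P: bilinear_algebra fp by (rule bilinear_algebra_presented)
  have inj: "inj_on can (carrier fp)" and surj: "can ` carrier fp = range emb"
    using can_iso by (auto simp: lie_iso_def bij_betw_def)
  \<comment> \<open>The inverse isomorphism; by injectivity of \<open>can\<close> it respects the
    operations, as \<open>p_eqI\<close> makes precise.\<close>
  define p where "p x = inv_into (carrier fp) can (emb x)" for x
  have p: "p x \<in> carrier fp" "can (p x) = emb x" for x
    using surj by (auto simp: p_def intro: inv_into_into f_inv_into_f)
  have p_eqI: "p x = q" if "q \<in> carrier fp" "can q = emb x" for x q
    using inv_into_f_f[OF inj that(1)] that(2) by (simp add: p_def)
  have can_add: "can (q \<oplus>\<^bsub>fp\<^esub> r) = can q \<oplus>\<^bsub>lie_alg\<^esub> can r"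
    and can_mult: "can (q \<otimes>\<^bsub>fp\<^esub> r) = can q \<otimes>\<^bsub>lie_alg\<^esub> can r"
    if "q \<in> carrier fp" "r \<in> carrier fp" for q r
    using can_iso that by (auto simp: lie_iso_def LinearCombinations.module_hom_def)
  have can_smult: "can (c \<odot>\<^bsub>fp\<^esub> q) = c \<odot>\<^bsub>lie_alg\<^esub> can q" if "q \<in> carrier fp" for q c
    using can_iso that by (auto simp: lie_iso_def LinearCombinations.module_hom_def)
  show thesis
  proof (rule that[of "\<lambda>x. induced_hom A.rec k (p x)"])
    show "lie_map s m (\<lambda>x. induced_hom A.rec k (p x))"
    proof
      fix x y and c :: 'k
      have "p (x + y) = p x \<oplus>\<^bsub>fp\<^esub> p y" "p (lie_scale c x) = c \<odot>\<^bsub>fp\<^esub> p x"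
        "p (bracket x y) = p x \<otimes>\<^bsub>fp\<^esub> p y"
        by (rule p_eqI; simp add: p can_add can_mult can_smult P.add_closed P.mult_closed P.smult_closed)+
      then show "induced_hom A.rec k (p (x + y)) = induced_hom A.rec k (p x) + induced_hom A.rec k (p y)"
        "induced_hom A.rec k (p (lie_scale c x)) = s c (induced_hom A.rec k (p x))"
        "induced_hom A.rec k (p (bracket x y)) = m (induced_hom A.rec k (p x)) (induced_hom A.rec k (p y))"
        using p by (simp_all add: F.hom_add F.hom_smult F.hom_mult)
    qed
    have gen: "induced_hom A.rec k (p x) = k z"
      if "z \<in> fp_gens" "case_sum (\<lambda>x. x) (\<lambda>x. x) z = emb x" for x z
    proof -
      have "p x = cong_class fp_gens fp_rels (Gen z)"
        using that by (intro p_eqI) (auto simp: presented_algebra_simps can_class)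
      then show ?thesis
        using R.induced_hom_class[OF k E, where X = fp_gens and t = "Gen z"] that by simp
    qed
    show "induced_hom A.rec k (p x) = f x" if "emb x \<in> C" for x
      using gen[of "Inl (emb x)" x] that by (simp add: fp_gens_def k_def)
    show "induced_hom A.rec k (p x) = g x" if "emb x \<in> D" for x
      using gen[of "Inr (emb x)" x] that by (simp add: fp_gens_def k_def)
  qed
qed

end

section \<open>Graded free decompositions and the induction over the generators\<close>

definition lie_closed :: "'k::field lie set \<Rightarrow> bool" where
  "lie_closed S \<longleftrightarrow> 0 \<in> S \<and> (\<forall>x\<in>S. \<forall>y\<in>S. x + y \<in> S \<and> bracket x y \<in> S)
     \<and> (\<forall>c. \<forall>x\<in>S. lie_scale c x \<in> S)"

lemma lie_closedD:
  assumes "lie_closed S"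
  shows "0 \<in> S" "\<lbrakk>x \<in> S; y \<in> S\<rbrakk> \<Longrightarrow> x + y \<in> S" "\<lbrakk>x \<in> S; y \<in> S\<rbrakk> \<Longrightarrow> bracket x y \<in> S"
    "x \<in> S \<Longrightarrow> lie_scale c x \<in> S" "\<lbrakk>x \<in> S; y \<in> S\<rbrakk> \<Longrightarrow> x - y \<in> S"
proof -
  show "0 \<in> S" "\<lbrakk>x \<in> S; y \<in> S\<rbrakk> \<Longrightarrow> x + y \<in> S" "\<lbrakk>x \<in> S; y \<in> S\<rbrakk> \<Longrightarrow> bracket x y \<in> S"
    "x \<in> S \<Longrightarrow> lie_scale c x \<in> S"
    using assms by (auto simp: lie_closed_def)
  assume "x \<in> S" "y \<in> S"
  then have "x + lie_scale (- 1) y \<in> S"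
    using assms by (auto simp: lie_closed_def)
  then show "x - y \<in> S" by (simp add: lie.s_uminus_one)
qed

lemma lie_closed_sum:
  "\<lbrakk>lie_closed S; \<And>i. i \<in> I \<Longrightarrow> f i \<in> S\<rbrakk> \<Longrightarrow> sum f I \<in> S"
  by (induction I rule: infinite_finite_induct) (auto simp: lie_closedD)

lemma lie_closed_UNIV: "\<lbrakk>lie_closed S; \<And>n. lie_gen n \<in> S\<rbrakk> \<Longrightarrow> x \<in> S"
  by (induction x rule: lie_induct) (auto simp: lie_closedD)

definition heisenberg_scale :: "'k \<Rightarrow> 'k \<times> 'k \<times> 'k \<Rightarrow> 'k::field \<times> 'k \<times> 'k" where
  "heisenberg_scale c = (\<lambda>(p, q, r). (c * p, c * q, c * r))"

definition heisenberg_bracket :: "'k \<times> 'k \<times> 'k \<Rightarrow> 'k \<times> 'k \<times> 'k \<Rightarrow> 'k::field \<times> 'k \<times> 'k" where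
  "heisenberg_bracket = (\<lambda>(p, q, r) (p', q', r'). (0, 0, p * q' - p' * q))"

lemma lie_type_algebra_heisenberg:
  "lie_type_algebra heisenberg_scale (heisenberg_bracket :: _ \<Rightarrow> _ \<Rightarrow> 'k::field \<times> 'k \<times> 'k)"
  by unfold_locales
    (auto simp: heisenberg_scale_def heisenberg_bracket_def algebra_simps zero_prod_def)

text \<open>The coefficient of x_n modulo brackets.\<close>

abbreviation gen_form :: "nat \<Rightarrow> 'k lie \<Rightarrow> 'k::field" where
  "gen_form n \<equiv> abelian_map (\<lambda>i. of_bool (i = n))"

interpretation gen_form: lie_map "(*)" "\<lambda>_ _. 0" "gen_form n :: 'k::field lie \<Rightarrow> 'k"
  by (rule abelian_map)

lemma gen_form_gen: "gen_form n (lie_gen i) = (of_bool (i = n) :: 'k::field)"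
  by (rule abelian_map)

text \<open>A bracket has no part of degree 1, because components of degree 0 vanish. Hence degree 1
  is the line spanned by x_0.\<close>

lemma component_one: "component x (Suc 0) = lie_scale (gen_form 0 x) (lie_gen 0 :: 'k::field lie)"
  by (induction x rule: lie_induct)
    (auto simp: component_simps gen_form.map_zero gen_form.map_add gen_form.map_scale
      gen_form.map_bracket gen_form_gen lie.s_zero_left lie.s_one lie.add_s lie.s_s
      component_at_zero lie.m_zero_left lie.m_zero_right)

text \<open>The consequences of L = C * D on which the argument rests, in a form symmetric in C and
  D. A locale assumption cannot range over all target types, so the universal property appears as
  its instances for the Heisenberg algebra and for L.\<close>

locale free_decomposition =
  fixes C D :: "'k::field lie set"
  assumes closed: "lie_closed C" "lie_closed D"
    and component: "\<And>x i. x \<in> C \<Longrightarrow> component x i \<in> C" "\<And>x i. x \<in> D \<Longrightarrow> component x i \<in> D"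
    and generated: "\<And>S x. \<lbrakk>lie_closed S; C \<subseteq> S; D \<subseteq> S\<rbrakk> \<Longrightarrow> x \<in> S"
    and lift_heisenberg: "\<And>f g. \<lbrakk>lie_map heisenberg_scale heisenberg_bracket f;
        lie_map heisenberg_scale heisenberg_bracket g\<rbrakk>
      \<Longrightarrow> \<exists>h. lie_map heisenberg_scale heisenberg_bracket h \<and> (\<forall>x\<in>C. h x = f x) \<and> (\<forall>x\<in>D. h x = g x)"
    and lift_lie: "\<And>f g. \<lbrakk>lie_map lie_scale bracket f; lie_map lie_scale bracket g\<rbrakk>
      \<Longrightarrow> \<exists>h. lie_map lie_scale bracket h \<and> (\<forall>x\<in>C. h x = f x) \<and> (\<forall>x\<in>D. h x = g x)"
begin

lemma swap: "free_decomposition D C"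
proof
  fix f g :: "'k lie \<Rightarrow> 'k \<times> 'k \<times> 'k"
  assume "lie_map heisenberg_scale heisenberg_bracket f" "lie_map heisenberg_scale heisenberg_bracket g"
  from lift_heisenberg[OF this(2,1)]
  show "\<exists>h. lie_map heisenberg_scale heisenberg_bracket h \<and> (\<forall>x\<in>D. h x = f x) \<and> (\<forall>x\<in>C. h x = g x)"
    by blast
next
  fix f g :: "'k lie \<Rightarrow> 'k lie"
  assume "lie_map lie_scale bracket f" "lie_map lie_scale bracket g"
  from lift_lie[OF this(2,1)]
  show "\<exists>h. lie_map lie_scale bracket h \<and> (\<forall>x\<in>D. h x = f x) \<and> (\<forall>x\<in>C. h x = g x)"
    by blast
qed (use closed component generated in blast)+

text \<open>In degrees up to n the only generators are x_0, ..., x_(n-1). The elements whose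
  components up to degree n lie in C form a subalgebra, since a component of a bracket involves no
  higher degrees.\<close>

lemma lower_component:
  assumes "\<And>i. i < n \<Longrightarrow> lie_gen i \<in> C" "i \<le> n"
  shows "component x i \<in> C"
proof -
  have "lie_closed {x. \<forall>i\<le>n. component x i \<in> C}"
    unfolding lie_closed_def
    by (auto simp: component_simps intro!: lie_closedD[OF closed(1)] lie_closed_sum[OF closed(1)])
  then have "x \<in> {x. \<forall>i\<le>n. component x i \<in> C}"
    by (rule lie_closed_UNIV) (use assms in \<open>auto simp: component_simps lie_closedD[OF closed(1)]\<close>)
  then show ?thesis using assms by simp
qed

text \<open>Without components of degree 0, the part of degree n + 1 of a bracket uses only degrees
  from 1 to n of its factors, and those lie in C.\<close>

lemma bracket_component:
  assumes lower: "\<And>i. i < n \<Longrightarrow> lie_gen i \<in> C"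
  shows "component (bracket x y) (Suc n) \<in> C"
proof -
  have "bracket (component x j) (component y (Suc n - j)) \<in> C" if j: "j \<le> Suc n" for j
  proof -
    consider "j = 0" | "j = Suc n" | "0 < j" "j \<le> n" using j by linarith
    then show ?thesis
    proof cases
      case 3
      then show ?thesis
        by (intro lie_closedD(3)[OF closed(1)] lower_component[OF lower]) auto
    qed (simp_all add: component_at_zero lie.m_zero_left lie.m_zero_right lie_closedD[OF closed(1)])
  qed
  then show ?thesis
    unfolding component_simps by (intro lie_closed_sum[OF closed(1)]) auto
qed

text \<open>A sum C + D of subalgebras need not be closed under brackets. In degree n + 1, however,
  brackets land in C by \<open>bracket_component\<close>, so the elements whose part of that degree
  lies in C + D form a subalgebra containing both factors.\<close>

lemma component_decomposition:
  assumes lower: "\<And>i. i < n \<Longrightarrow> lie_gen i \<in> C"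
  shows "\<exists>c\<in>C. \<exists>d\<in>D. component x (Suc n) = c + d"
proof -
  let ?S = "{x. \<exists>c\<in>C. \<exists>d\<in>D. component x (Suc n) = c + d}"
  note C = lie_closedD[OF closed(1)] and D = lie_closedD[OF closed(2)]
  have in_S: "x \<in> ?S" if "c \<in> C" "d \<in> D" "component x (Suc n) = c + d" for c d x
    using that by blast
  have in_C: "x \<in> ?S" if "component x (Suc n) \<in> C" for x
    by (rule in_S[OF that D(1)]) simp
  have in_D: "x \<in> ?S" if "component x (Suc n) \<in> D" for x
    by (rule in_S[OF C(1) that]) simp
  have "lie_closed ?S"
    unfolding lie_closed_def
  proof (intro conjI ballI allI)
    show "0 \<in> ?S" by (rule in_C) (simp add: component_simps C)
    fix x assume "x \<in> ?S"
    then obtain c d where cd: "c \<in> C" "d \<in> D" "component x (Suc n) = c + d" by auto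
    show "lie_scale a x \<in> ?S" for a
      by (rule in_S[of "lie_scale a c" "lie_scale a d"])
        (simp_all add: cd component_simps lie.s_add C D)
    fix y assume "y \<in> ?S"
    then obtain c' d' where cd': "c' \<in> C" "d' \<in> D" "component y (Suc n) = c' + d'" by auto
    show "x + y \<in> ?S"
      by (rule in_S[of "c + c'" "d + d'"])
        (simp_all add: cd cd' component_simps algebra_simps C D)
    show "bracket x y \<in> ?S"
      by (rule in_C) (rule bracket_component[OF lower])
  qed
  then have "x \<in> ?S"
    by (rule generated) (use in_C in_D component in auto)
  then show ?thesis by simp
qed

text \<open>Brackets contribute elements of C in degree n + 1, and x_n is the only generator of that
  degree. Modulo C this degree is thus spanned by x_n, with coefficient
  \<open>gen_form n\<close>.\<close>

lemma component_minus_gen: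
  assumes lower: "\<And>i. i < n \<Longrightarrow> lie_gen i \<in> C"
  shows "component x (Suc n) - lie_scale (gen_form n x) (lie_gen n) \<in> C"
proof -
  note C = lie_closedD[OF closed(1)]
  let ?r = "\<lambda>x. component x (Suc n) - lie_scale (gen_form n x) (lie_gen n)"
  have "lie_closed {x. ?r x \<in> C}"
    unfolding lie_closed_def
  proof (intro conjI ballI allI)
    show "0 \<in> {x. ?r x \<in> C}"
      by (simp add: component_simps gen_form.map_zero lie.s_zero_left C)
    fix x assume x: "x \<in> {x. ?r x \<in> C}"
    have "?r (lie_scale a x) = lie_scale a (?r x)" for a
      by (simp add: component_simps gen_form.map_scale lie.s_s lie.s_diff)
    then show "lie_scale a x \<in> {x. ?r x \<in> C}" for a
      using x C(4) by simp
    fix y assume y: "y \<in> {x. ?r x \<in> C}"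
    have "?r (x + y) = ?r x + ?r y"
      by (simp add: component_simps gen_form.map_add lie.add_s)
    then show "x + y \<in> {x. ?r x \<in> C}"
      using x y C(2) by simp
    show "bracket x y \<in> {x. ?r x \<in> C}"
      using bracket_component[OF lower] by (simp add: gen_form.map_bracket lie.s_zero_left)
  qed
  then have "x \<in> {x. ?r x \<in> C}"
    by (rule lie_closed_UNIV)
      (simp add: component_simps gen_form_gen lie.s_zero_left lie.s_one C)
  then show ?thesis by simp
qed

text \<open>The next generator is \<open>c + d\<close> up to \<open>C\<close>, where \<open>d\<close> has coefficient \<open>gen_form n d\<close> on it. A
  homomorphism to the Heisenberg algebra that separates \<open>C\<close> and \<open>D\<close> turns the first relation
  that involves this generator into \<open>gen_form n d = 0\<close>.\<close>

lemma next_gen: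
  assumes lower: "\<And>i. i < n \<Longrightarrow> lie_gen i \<in> C" and "0 < n"
  shows "lie_gen n \<in> C"
proof -
  \<comment> \<open>The index of the partner of x_n in relation \<open>n div 2\<close>: the term is
    [x_n, x_1] for even n and [x_0, x_n] for odd n.\<close>
  define j :: nat where "j = (if even n then 1 else 0)"
  have forms: "lie_map heisenberg_scale heisenberg_bracket (\<lambda>x :: 'k lie. (gen_form j x, 0, 0))"
    "lie_map heisenberg_scale heisenberg_bracket (\<lambda>x :: 'k lie. (0, gen_form n x, 0))"
    by (unfold_locales;
      simp add: gen_form.map_add gen_form.map_scale gen_form.map_bracket heisenberg_scale_def
        heisenberg_bracket_def)+
  obtain h where h: "lie_map heisenberg_scale heisenberg_bracket h"
    "\<And>x. x \<in> C \<Longrightarrow> h x = (gen_form j x, 0, 0)" "\<And>x. x \<in> D \<Longrightarrow> h x = (0, gen_form n x, 0)"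
    using lift_heisenberg[OF forms] by blast
  interpret h: lie_map heisenberg_scale heisenberg_bracket h by (rule h(1))
  obtain c d where cd: "c \<in> C" "d \<in> D" "lie_gen n = c + d"
    using component_decomposition[where n = n and x = "lie_gen n", OF lower] by (auto simp: component_simps)
  have h_gen: "h (lie_gen n) = (gen_form j c, gen_form n d, 0)"
    by (simp add: cd h h.map_add)
  have h_lower: "h (lie_gen i) = (of_bool (i = j), 0, 0)" if "i < n" for i
    using lower[OF that] by (simp add: h(2) gen_form_gen)
  define l where "l = n div 2"
  have relation: "(\<Sum>i\<le>l. heisenberg_bracket (h (lie_gen (2 * i))) (h (lie_gen (2 * (l - i) + 1)))) = 0"
    using h.map_sum[of "\<lambda>i. bracket (lie_gen (2 * i)) (lie_gen (2 * (l - i) + 1))" "{..l}"]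
    unfolding lie_gen_relation h.map_bracket h.map_zero by simp
  have "gen_form n d = 0"
  proof (cases "even n")
    case True
    then have n: "n = 2 * l" "j = 1" "1 < n"
      using \<open>0 < n\<close> by (auto simp: l_def j_def elim: evenE)
    have "(\<Sum>i\<le>l. heisenberg_bracket (h (lie_gen (2 * i))) (h (lie_gen (2 * (l - i) + 1))))
        = (\<Sum>i\<in>{l}. heisenberg_bracket (h (lie_gen (2 * i))) (h (lie_gen (2 * (l - i) + 1))))"
    proof (rule sum.mono_neutral_right)
      show "\<forall>i\<in>{..l} - {l}.
          heisenberg_bracket (h (lie_gen (2 * i))) (h (lie_gen (2 * (l - i) + 1))) = 0"
      proof
        fix i assume "i \<in> {..l} - {l}"
        \<comment> \<open>In the other terms the left factor has even index below n, while j = 1, so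
          it maps to 0. This also covers i = 0, whose right factor x_(n+1) is beyond the reach of
          the induction hypothesis.\<close>
        then have "2 * i < n" using n by auto
        moreover have "2 * i \<noteq> j" using n by presburger
        ultimately have "h (lie_gen (2 * i)) = (0, 0, 0)" by (simp add: h_lower)
        then show "heisenberg_bracket (h (lie_gen (2 * i))) (h (lie_gen (2 * (l - i) + 1))) = 0"
          by (simp add: heisenberg_bracket_def split_beta zero_prod_def)
      qed
    qed auto
    also have "\<dots> = heisenberg_bracket (h (lie_gen n)) (h (lie_gen 1))"
      using n by simp
    also have "\<dots> = (0, 0, - gen_form n d)"
    proof -
      have "h (lie_gen 1) = (1, 0, 0)"
        using h_lower[of 1] n by simp
      then show ?thesis
        unfolding h_gen by (simp add: heisenberg_bracket_def)
    qed
    finally show ?thesis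
      using relation by (simp add: zero_prod_def)
  next
    case False
    then have n: "n = 2 * l + 1" "j = 0"
      by (auto simp: l_def j_def elim: oddE)
    have "(\<Sum>i\<le>l. heisenberg_bracket (h (lie_gen (2 * i))) (h (lie_gen (2 * (l - i) + 1))))
        = (\<Sum>i\<in>{0}. heisenberg_bracket (h (lie_gen (2 * i))) (h (lie_gen (2 * (l - i) + 1))))"
    proof (rule sum.mono_neutral_right)
      show "\<forall>i\<in>{..l} - {0}.
          heisenberg_bracket (h (lie_gen (2 * i))) (h (lie_gen (2 * (l - i) + 1))) = 0"
      proof
        fix i assume "i \<in> {..l} - {0}"
        \<comment> \<open>Here j = 0, and the right factor of each remaining term has odd index
          below n, so it maps to 0.\<close>
        then have "2 * (l - i) + 1 < n" using n by auto
        then have "h (lie_gen (2 * (l - i) + 1)) = (0, 0, 0)" by (simp add: h_lower n)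
        then show "heisenberg_bracket (h (lie_gen (2 * i))) (h (lie_gen (2 * (l - i) + 1))) = 0"
          by (simp add: heisenberg_bracket_def split_beta zero_prod_def)
      qed
    qed auto
    also have "\<dots> = heisenberg_bracket (h (lie_gen 0)) (h (lie_gen n))"
      using n by simp
    also have "\<dots> = (0, 0, gen_form n d)"
    proof -
      have "h (lie_gen 0) = (1, 0, 0)"
        using h_lower[of 0] n by simp
      then show ?thesis
        unfolding h_gen by (simp add: heisenberg_bracket_def)
    qed
    finally show ?thesis
      using relation by (simp add: zero_prod_def)
  qed
  \<comment> \<open>With its coefficient on x_n gone, the part of d in degree n + 1 lies in C.
    Comparing parts of that degree in x_n = c + d places x_n in C.\<close>
  then have "component d (Suc n) \<in> C"
    using component_minus_gen[where n = n and x = d, OF lower] by (simp add: lie.s_zero_left)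
  moreover have "component c (Suc n) \<in> C"
    using component(1) cd by blast
  moreover have "lie_gen n = component c (Suc n) + component d (Suc n)"
    using arg_cong[OF cd(3), of "\<lambda>x. component x (Suc n)"] by (simp add: component_simps)
  ultimately show ?thesis
    using lie_closedD(2)[OF closed(1)] by metis
qed

lemma trivial_if_first_gen:
  assumes "lie_gen 0 \<in> C"
  shows "D = {0}"
proof -
  have "lie_gen n \<in> C" for n
  proof (induction n rule: less_induct)
    case (less n)
    then show ?case
      using assms next_gen by (cases "n = 0") auto
  qed
  then have C_UNIV: "x \<in> C" for x
    by (rule lie_closed_UNIV[OF closed(1)])
  have "lie_map lie_scale bracket (\<lambda>x :: 'k lie. 0 :: 'k lie)" "lie_map lie_scale bracket (\<lambda>x :: 'k lie. x)"
    by (unfold_locales; simp add: lie.s_zero_right lie.m_zero_left)+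
  from lift_lie[OF this] obtain h where "\<And>x. x \<in> C \<Longrightarrow> h x = 0" "\<And>x. x \<in> D \<Longrightarrow> h x = x"
    by blast
  then have "x = 0" if "x \<in> D" for x
    using that C_UNIV by metis
  then show ?thesis
    using lie_closedD(1)[OF closed(2)] by blast
qed

text \<open>Degree 1 is a line. The degree 1 parts of c and d in x_0 = c + d are multiples of x_0
  whose coefficients add up to 1, so one of them is nonzero, and the factors are closed under
  components and scaling.\<close>

lemma first_gen: "lie_gen 0 \<in> C \<or> lie_gen 0 \<in> D"
proof -
  obtain c d where cd: "c \<in> C" "d \<in> D" "lie_gen 0 = c + d"
    using component_decomposition[of 0 "lie_gen 0"] by (auto simp: component_simps)
  have unscale: "lie_gen 0 \<in> S" if "lie_scale a (lie_gen 0) \<in> S" "a \<noteq> 0" "lie_closed S" for a and S :: "'k lie set"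
  proof -
    have "lie_scale (inverse a) (lie_scale a (lie_gen 0)) \<in> S"
      using that lie_closedD(4) by blast
    then show ?thesis
      using that by (simp add: lie.s_one flip: lie.s_s)
  qed
  have "component c (Suc 0) \<in> C" "component d (Suc 0) \<in> D"
    using component cd by auto
  then have scaled: "lie_scale (gen_form 0 c) (lie_gen 0) \<in> C" "lie_scale (gen_form 0 d) (lie_gen 0) \<in> D"
    by (simp_all add: component_one)
  have "gen_form 0 c + gen_form 0 d = 1"
    using gen_form_gen[of 0 0, where 'k = 'k] by (simp add: cd(3) gen_form.map_add)
  then have "gen_form 0 c \<noteq> 0 \<or> gen_form 0 d \<noteq> 0" by auto
  then show ?thesis
    using unscale scaled closed by blast
qed

lemma trivial_factor: "C = {0} \<or> D = {0}"
  using first_gen trivial_if_first_gen free_decomposition.trivial_if_first_gen[OF swap] by blast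

end

section \<open>Transfer to the Lie algebra of sequences\<close>

lemma free_decompositionI:
  fixes C D :: "(nat \<Rightarrow> 'k::field) set"
  assumes gC: "graded_lie_subalgebra lie_alg degree_space C"
    and gD: "graded_lie_subalgebra lie_alg degree_space D"
    and "is_lie_free_product lie_alg C D"
  shows "free_decomposition {x. emb x \<in> C} {x. emb x \<in> D}"
proof -
  interpret lie_alg_free_product C D
    using assms graded_lie_subalgebra_lie_algD(1) by unfold_locales blast+
  show ?thesis
  proof
    show "lie_closed {x. emb x \<in> C}" "lie_closed {x. emb x \<in> D}"
      using graded_lie_subalgebra_lie_algD(2-5)[OF gC] graded_lie_subalgebra_lie_algD(2-5)[OF gD]
      by (auto simp: lie_closed_def)
    show "x \<in> {x. emb x \<in> C} \<Longrightarrow> component x i \<in> {x. emb x \<in> C}"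
      "x \<in> {x. emb x \<in> D} \<Longrightarrow> component x i \<in> {x. emb x \<in> D}" for x i
      using graded_lie_subalgebra_lie_algD(6)[OF gC] graded_lie_subalgebra_lie_algD(6)[OF gD] by auto
    show "x \<in> S" if "lie_closed S" "{x. emb x \<in> C} \<subseteq> S" "{x. emb x \<in> D} \<subseteq> S" for S x
      by (rule generated[of "\<lambda>x. x \<in> S"]) (use that(2,3) in \<open>auto simp: lie_closedD[OF that(1)]\<close>)
    show "\<exists>h. lie_map heisenberg_scale heisenberg_bracket h
        \<and> (\<forall>x\<in>{x. emb x \<in> C}. h x = f x) \<and> (\<forall>x\<in>{x. emb x \<in> D}. h x = g x)"
      if fg: "lie_map heisenberg_scale heisenberg_bracket f" "lie_map heisenberg_scale heisenberg_bracket g"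
      for f g :: "'k lie \<Rightarrow> 'k \<times> 'k \<times> 'k"
      by (rule lift[OF lie_type_algebra_heisenberg fg]) blast
    show "\<exists>h. lie_map lie_scale bracket h
        \<and> (\<forall>x\<in>{x. emb x \<in> C}. h x = f x) \<and> (\<forall>x\<in>{x. emb x \<in> D}. h x = g x)"
      if fg: "lie_map lie_scale bracket f" "lie_map lie_scale bracket g" for f g :: "'k lie \<Rightarrow> 'k lie"
      by (rule lift[OF lie.lie_type_algebra_axioms fg]) blast
  qed
qed

lemma free_product_trivial_factor:
  fixes C D :: "(nat \<Rightarrow> 'k::field) set"
  assumes gC: "graded_lie_subalgebra lie_alg degree_space C"
    and gD: "graded_lie_subalgebra lie_alg degree_space D"
    and fp: "is_lie_free_product lie_alg C D"
  shows "C = {\<zero>\<^bsub>lie_alg\<^esub>} \<or> D = {\<zero>\<^bsub>lie_alg\<^esub>}"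
proof -
  have zero: "S = {\<zero>\<^bsub>lie_alg\<^esub>}"
    if S: "graded_lie_subalgebra lie_alg degree_space S" and "{x. emb x \<in> S} = {0}"
    for S :: "(nat \<Rightarrow> 'k) set"
  proof -
    have "emb x \<in> S \<longleftrightarrow> x = 0" for x
      using that(2) by (simp only: set_eq_iff mem_Collect_eq singleton_iff)
    then have "S = emb ` {0}"
      using graded_lie_subalgebra_lie_algD(1)[OF S] by (auto dest: subsetD)
    then show ?thesis by simp
  qed
  show ?thesis
    using free_decomposition.trivial_factor[OF free_decompositionI[OF gC gD fp]]
    by (elim disjE) (simp_all add: zero[OF gC] zero[OF gD])
qed

theorem corollary6p5:
  shows "\<exists>(L :: ('k::field, nat \<Rightarrow> 'k) module) V.
    graded_lie_algebra L V \<and>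
    infinitely_many_ends L \<and>
    \<not> (\<exists>C D. graded_lie_subalgebra L V C \<and> C \<noteq> {\<zero>\<^bsub>L\<^esub>} \<and>
             graded_lie_subalgebra L V D \<and> D \<noteq> {\<zero>\<^bsub>L\<^esub>} \<and>
             is_lie_free_product L C D)"
proof (intro exI conjI notI)
  show "graded_lie_algebra (lie_alg :: ('k, nat \<Rightarrow> 'k) module) degree_space"
    by (rule graded_lie_algebra_lie_alg)
  show "infinitely_many_ends (lie_alg :: ('k, nat \<Rightarrow> 'k) module)"
    by (rule infinitely_many_ends_lie_alg)
  assume "\<exists>C D. graded_lie_subalgebra lie_alg degree_space C \<and> C \<noteq> {\<zero>\<^bsub>lie_alg\<^esub>} \<and>
    graded_lie_subalgebra lie_alg degree_space D \<and> D \<noteq> {\<zero>\<^bsub>lie_alg\<^esub>} \<and>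
    is_lie_free_product (lie_alg :: ('k, nat \<Rightarrow> 'k) module) C D"
  then obtain C D :: "(nat \<Rightarrow> 'k) set" where
    "graded_lie_subalgebra lie_alg degree_space C" "C \<noteq> {\<zero>\<^bsub>lie_alg\<^esub>}"
    "graded_lie_subalgebra lie_alg degree_space D" "D \<noteq> {\<zero>\<^bsub>lie_alg\<^esub>}"
    "is_lie_free_product lie_alg C D"
    by (elim exE conjE)
  then show False
    using free_product_trivial_factor[of C D] by simp
qed

end
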